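(* Let $\mathbb{K}=\mathbb{R}$ or $\mathbb{C}$, let $d,N,k_1,\dots,k_N$ be positive integers, and let $\boldsymbol{k}=(k_1,\dots,k_N)$. If $\mathcal{FF}^{\mathbb{K}^d,\boldsymbol{k}}$ contains a tight fusion frame, then every local minimum of the fusion frame potential $\operatorname{FFP}:\mathcal{FF}^{\mathbb{K}^d,\boldsymbol{k}}\to\mathbb{R}$ is a global minimum.
   Context: $\mathcal{FF}^{\mathbb{K}^d,\boldsymbol{k}}$ denotes the space of (square roots of) fusion frames with ranks $\boldsymbol{k}$: the set of $N$-tuples $\boldsymbol{A}=(A_1,\dots,A_N)$ of linear maps $A_i:\mathbb{K}^d\to\mathbb{K}^{k_i}$ such that each $P_i:=A_i^*A_i$ is an orthogonal projector of rank $k_i$ (equivalently, the rows of $A_i$ are orthonormal) and the frame operator $S_{\boldsymbol{A}}:=\sum_{i=1}^N A_i^*A_i$ is positive definite. It has the subspace topology from $\prod_{i=1}^N\mathbb{K}^{k_i\times d}$. $\boldsymbol{A}\in\mathcal{FF}^{\mathbb{K}^d,\boldsymbol{k}}$ is a tight fusion frame (TFF) if $S_{\boldsymbol{A}}$ is a scalar multiple of the identity; the multiple is then necessarily $n/d$, where $n=k_1+\dots+k_N$. The fusion frame potential is $\operatorname{FFP}(\boldsymbol{A})=\|S_{\boldsymbol{A}}\|^2$, where $\|\cdot\|$ is the Frobenius norm. *)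

theory Defs
  imports
    "HOL-Analysis.Function_Topology"
    "Jordan_Normal_Form.Schur_Decomposition"
    "Jordan_Normal_Form.DL_Rank"
begin

text \<open>
  The scalars form a type \<open>'a\<close>, to be instantiated with \<open>real\<close> or \<open>complex\<close>. On these types
  \<open>conjugate\<close> is the identity and complex conjugation, and for complex numbers \<open>0 < z\<close> means that
  \<open>z\<close> is real and positive.
  The \<open>N\<close>-tuple \<open>(A\<^sub>1, \<dots>, A\<^sub>N)\<close> is a function on \<open>{..<N}\<close>, extensional outside of it.
\<close>

definition hermitian_mat :: "'a :: conjugatable_field mat \<Rightarrow> bool" where
  "hermitian_mat M \<longleftrightarrow> mat_adjoint M = M"

definition orthogonal_projector :: "nat \<Rightarrow> 'a :: conjugatable_field mat \<Rightarrow> bool" where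
  "orthogonal_projector d P \<longleftrightarrow> P \<in> carrier_mat d d \<and> P * P = P \<and> hermitian_mat P"

definition positive_definite_mat :: "nat \<Rightarrow> 'a :: conjugatable_ordered_field mat \<Rightarrow> bool" where
  "positive_definite_mat d M \<longleftrightarrow> M \<in> carrier_mat d d \<and> hermitian_mat M \<and>
     (\<forall>v \<in> carrier_vec d. v \<noteq> 0\<^sub>v d \<longrightarrow> 0 < (M *\<^sub>v v) \<bullet>c v)"

definition frobenius_norm :: "'a :: real_normed_field mat \<Rightarrow> real" where
  "frobenius_norm M = sqrt (\<Sum>i<dim_row M. \<Sum>j<dim_col M. (norm (M $$ (i, j)))\<^sup>2)"

definition frame_operator ::
    "nat \<Rightarrow> nat \<Rightarrow> (nat \<Rightarrow> 'a :: conjugatable_field mat) \<Rightarrow> 'a mat" where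
  "frame_operator d N A = mat d d (\<lambda>rc. \<Sum>i<N. (mat_adjoint (A i) * A i) $$ rc)"

definition fusion_frames ::
    "nat \<Rightarrow> nat \<Rightarrow> (nat \<Rightarrow> nat) \<Rightarrow> (nat \<Rightarrow> 'a :: conjugatable_ordered_field mat) set" where
  "fusion_frames d N k =
     {A \<in> (\<Pi>\<^sub>E i\<in>{..<N}. carrier_mat (k i) d).
        (\<forall>i<N. orthogonal_projector d (mat_adjoint (A i) * A i) \<and>
               vec_space.rank d (mat_adjoint (A i) * A i) = k i) \<and>
        positive_definite_mat d (frame_operator d N A)}"

definition tight_fusion_frame ::
    "nat \<Rightarrow> nat \<Rightarrow> (nat \<Rightarrow> nat) \<Rightarrow> (nat \<Rightarrow> 'a :: conjugatable_ordered_field mat) \<Rightarrow> bool" where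
  "tight_fusion_frame d N k A \<longleftrightarrow>
     A \<in> fusion_frames d N k \<and> (\<exists>c. frame_operator d N A = c \<cdot>\<^sub>m 1\<^sub>m d)"

definition fusion_frame_potential ::
    "nat \<Rightarrow> nat \<Rightarrow> (nat \<Rightarrow> 'a :: {conjugatable_field, real_normed_field} mat) \<Rightarrow> real" where
  "fusion_frame_potential d N A = (frobenius_norm (frame_operator d N A))\<^sup>2"

text \<open>
  The type of matrices of all sizes carries no topology, so the usual topology on
  \<open>m \<times> n\<close> matrices is obtained by identifying a matrix with the family of its entries.
\<close>

definition mat_topology :: "nat \<Rightarrow> nat \<Rightarrow> 'a :: topological_space mat topology" where
  "mat_topology m n =
     pullback_topology (carrier_mat m n) (\<lambda>M. restrict (\<lambda>ij. M $$ ij) ({..<m} \<times> {..<n}))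
       (product_topology (\<lambda>_. euclidean) ({..<m} \<times> {..<n}))"

definition fusion_frame_topology ::
    "nat \<Rightarrow> nat \<Rightarrow> (nat \<Rightarrow> nat) \<Rightarrow>
     (nat \<Rightarrow> 'a :: {conjugatable_ordered_field, topological_space} mat) topology" where
  "fusion_frame_topology d N k =
     subtopology (product_topology (\<lambda>i. mat_topology (k i) d) {..<N}) (fusion_frames d N k)"

definition local_minimum :: "'b topology \<Rightarrow> ('b \<Rightarrow> real) \<Rightarrow> 'b \<Rightarrow> bool" where
  "local_minimum X f a \<longleftrightarrow> (\<exists>U. openin X U \<and> a \<in> U \<and> (\<forall>x\<in>U. f a \<le> f x))"

definition global_minimum :: "'b set \<Rightarrow> ('b \<Rightarrow> real) \<Rightarrow> 'b \<Rightarrow> bool" where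
  "global_minimum S f a \<longleftrightarrow> a \<in> S \<and> (\<forall>x\<in>S. f a \<le> f x)"

lemma topspace_mat_topology [simp]: "topspace (mat_topology m n) = carrier_mat m n"
  unfolding mat_topology_def topspace_pullback_topology by auto

lemma topspace_fusion_frame_topology [simp]:
  "topspace (fusion_frame_topology d N k) = fusion_frames d N k"
  unfolding fusion_frame_topology_def fusion_frames_def by auto

end

theory Submission
  imports Defs "HOL-Complex_Analysis.Complex_Analysis" "Jordan_Normal_Form.Spectral_Radius"
begin

text \<open>
  Write \<open>V\<^sub>i\<close> for the row space of \<open>A\<^sub>i\<close>, \<open>P\<^sub>i\<close> for the projector onto it and \<open>S\<close> for the sum of
  the \<open>P\<^sub>i\<close>. The trace of \<open>S\<close> is \<open>n\<close>, so by the Cauchy-Schwarz inequality the potential is at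
  least \<open>n\<^sup>2 / d\<close>, with equality exactly for tight frames. It therefore suffices that a local
  minimum \<open>A\<close> is tight as soon as some tight frame \<open>T\<close> exists (\<open>local_minimum_tight\<close>). Suppose
  that \<open>A\<close> is a local minimum for which \<open>S\<close> is not scalar.

  \<^item> The first variation shows that every \<open>P\<^sub>i\<close> commutes with \<open>S\<close>, and hence with the projector
    \<open>pr\<close> onto the eigenspace \<open>E\<close> of the largest eigenvalue \<open>\<Lambda>\<close> of \<open>S\<close>. As \<open>\<Lambda> > n / d\<close>, taking
    traces in \<open>S pr = \<Lambda> pr\<close> gives \<open>d (\<Sum>\<^sub>i dim (V\<^sub>i \<inter> E)) > n dim E\<close>: the subspace \<open>E\<close> destabilises the
    tuple \<open>(V\<^sub>i)\<close>.
  \<^item> The second variation (\<open>variation\<close>) shows that there is no nonzero tuple of maps \<open>X\<^sub>i\<close> from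
    \<open>V\<^sub>i \<inter> E\<close> to \<open>V\<^sub>i\<^sup>\<bottom> \<inter> E\<^sup>\<bottom>\<close> with sum zero: moving the \<open>V\<^sub>i\<close> in such a direction leaves \<open>S\<close> fixed to
    first order and lowers the potential at second order.
  \<^item> Dually (\<open>duality\<close>), every tuple of such maps is induced by a single map from \<open>E\<close> to \<open>E\<^sup>\<bottom>\<close>.
    This is the surjectivity that the implicit function theorem asks for: when the \<open>V\<^sub>i\<close> are
    perturbed, \<open>E\<close> can be moved along so that the dimensions of its intersections with the \<open>V\<^sub>i\<close>
    survive. A fixed-point iteration (\<open>approximate_graphs\<close>) gives entire functions that
    approximate the moving subspace along the complex line \<open>B\<^sub>i(w) = T\<^sub>i\<^sup>* + w (A\<^sub>i\<^sup>* - T\<^sub>i\<^sup>*)\<close> near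
    \<open>w = 1\<close>, with arbitrarily small error.

  Thus the frames near \<open>A\<close> on this line are unstable, while \<open>T\<close>, at \<open>w = 0\<close>, is tight and hence
  semistable. That is impossible because instability is a closed condition in the Zariski
  topology; the following is a quantitative version of this argument. Semistability of
  \<open>T\<close> means that its capacity is positive (\<open>tight_frame_capacity\<close>): for every invertible \<open>G\<close>
  there are coisometries \<open>C\<^sub>i\<close> with \<open>\<Prod>\<^sub>i |det (C\<^sub>i G T\<^sub>i\<^sup>*)|\<^sup>d \<ge> |det G|\<^sup>n\<close>. On the other hand there is
  an entire matrix function \<open>G\<close> that scales the moving subspace by a small factor \<open>e\<close> on
  an arc of the unit circle around \<open>1\<close> and is harmless elsewhere on the circle
  (\<open>destabilising_factor\<close>). The entire function
  \<open>Q(w) = \<Prod>\<^sub>i det (C\<^sub>i G(w) B\<^sub>i(w))\<^sup>d / det G(w)\<^sup>n\<close> is then bounded on the circle by a constant and is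
  arbitrarily small on the arc, because \<open>e\<close> occurs to the power \<open>d (\<Sum>\<^sub>i dim (V\<^sub>i \<inter> E))\<close> in the numerator
  and only to the power \<open>n dim E\<close> in the denominator; but \<open>|Q(0)| \<ge> 1\<close> by the capacity bound.
  The maximum principle excludes this (\<open>two_constants\<close>, \<open>not_tight\<close>).

  The argument takes place over the complex numbers. For real scalars, the variations have to
  be real, but the absence of real tuples \<open>X\<^sub>i\<close> implies the absence of complex ones, by taking
  real and imaginary parts.
\<close>

section \<open>Complex matrices of arbitrary size as one normed ring\<close>

text \<open>
  Matrices of all sizes are embedded in the algebra of complex \<open>\<nat> \<times> \<nat>\<close> matrices of finite
  support. Products of matrices of different sizes then live in one (non-unital) ring, whose
  Frobenius norm is submultiplicative, so that ring normalisation, limits and norm estimates are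
  all available without bookkeeping of dimensions.
\<close>

typedef fmat = "{f :: nat \<Rightarrow> nat \<Rightarrow> complex. \<exists>m. \<forall>i j. m \<le> i \<or> m \<le> j \<longrightarrow> f i j = 0}"
  morphisms entry Fmat
  by (rule exI[of _ "\<lambda>_ _. 0"]) auto

lemma fmat_eqI: "(\<And>i j. entry A i j = entry B i j) \<Longrightarrow> A = B"
  by (metis entry_inject ext)

lemma entry_Fmat:
  assumes "\<And>i j. m \<le> i \<or> m \<le> j \<Longrightarrow> f i j = 0"
  shows "entry (Fmat f) = f"
  using assms by (intro Fmat_inverse) blast

definition bd :: "fmat \<Rightarrow> nat" where
  "bd A = (SOME m. \<forall>i j. m \<le> i \<or> m \<le> j \<longrightarrow> entry A i j = 0)"

lemma entry_bd: "bd A \<le> i \<or> bd A \<le> j \<Longrightarrow> entry A i j = 0"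
proof -
  have "\<forall>i j. bd A \<le> i \<or> bd A \<le> j \<longrightarrow> entry A i j = 0"
    unfolding bd_def by (rule someI_ex) (use entry[of A] in auto)
  then show "bd A \<le> i \<or> bd A \<le> j \<Longrightarrow> entry A i j = 0" by blast
qed

lemma common_bound:
  obtains m where "\<And>A i j. A \<in> set As \<Longrightarrow> m \<le> i \<or> m \<le> j \<Longrightarrow> entry A i j = 0"
proof -
  have "entry A i j = 0" if "A \<in> set As" "sum_list (map bd As) \<le> i \<or> sum_list (map bd As) \<le> j" for A i j
    using that member_le_sum_list[of "bd A" "map bd As"] by (intro entry_bd) auto
  then show thesis using that by blast
qed

lemma sum_lessThan_extend:
  fixes f :: "nat \<Rightarrow> 'a :: comm_monoid_add"
  assumes "\<And>i. n \<le> i \<Longrightarrow> f i = 0" "\<And>i. m \<le> i \<Longrightarrow> f i = 0"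
  shows "sum f {..<n} = sum f {..<m}"
proof (cases "n \<le> m")
  case True
  then show ?thesis using assms by (intro sum.mono_neutral_left) auto
next
  case False
  then show ?thesis using assms by (intro sum.mono_neutral_right) auto
qed

instantiation fmat :: real_vector
begin

definition zero_fmat :: fmat where "0 = Fmat (\<lambda>_ _. 0)"
definition plus_fmat :: "fmat \<Rightarrow> fmat \<Rightarrow> fmat" where
  "A + B = Fmat (\<lambda>i j. entry A i j + entry B i j)"
definition minus_fmat :: "fmat \<Rightarrow> fmat \<Rightarrow> fmat" where
  "A - B = Fmat (\<lambda>i j. entry A i j - entry B i j)"
definition uminus_fmat :: "fmat \<Rightarrow> fmat" where
  "- A = Fmat (\<lambda>i j. - entry A i j)"
definition scaleR_fmat :: "real \<Rightarrow> fmat \<Rightarrow> fmat" where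
  "r *\<^sub>R A = Fmat (\<lambda>i j. of_real r * entry A i j)"

lemma entry_zero [simp]: "entry 0 i j = 0"
  unfolding zero_fmat_def by (subst entry_Fmat[of 0]) auto

lemma entry_plus [simp]: "entry (A + B) i j = entry A i j + entry B i j"
proof -
  obtain m where "\<And>C i j. C \<in> set [A, B] \<Longrightarrow> m \<le> i \<or> m \<le> j \<Longrightarrow> entry C i j = 0"
    using common_bound by blast
  then show ?thesis unfolding plus_fmat_def by (subst entry_Fmat[of m]) auto
qed

lemma entry_minus [simp]: "entry (A - B) i j = entry A i j - entry B i j"
proof -
  obtain m where "\<And>C i j. C \<in> set [A, B] \<Longrightarrow> m \<le> i \<or> m \<le> j \<Longrightarrow> entry C i j = 0"
    using common_bound by blast
  then show ?thesis unfolding minus_fmat_def by (subst entry_Fmat[of m]) auto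
qed

lemma entry_uminus [simp]: "entry (- A) i j = - entry A i j"
  unfolding uminus_fmat_def by (subst entry_Fmat[of "bd A"]) (auto simp: entry_bd)

lemma entry_scaleR [simp]: "entry (r *\<^sub>R A) i j = of_real r * entry A i j"
  unfolding scaleR_fmat_def by (subst entry_Fmat[of "bd A"]) (auto simp: entry_bd)

instance
  by standard (auto intro!: fmat_eqI simp: algebra_simps)

end

instantiation fmat :: real_inner
begin

definition inner_fmat :: "fmat \<Rightarrow> fmat \<Rightarrow> real" where
  "inner_fmat A B = (\<Sum>i<bd A. \<Sum>j<bd A. Re (cnj (entry A i j) * entry B i j))"
definition norm_fmat :: "fmat \<Rightarrow> real" where "norm_fmat A = sqrt (inner A A)"
definition sgn_fmat :: "fmat \<Rightarrow> fmat" where "sgn_fmat A = A /\<^sub>R norm A"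
definition dist_fmat :: "fmat \<Rightarrow> fmat \<Rightarrow> real" where "dist_fmat A B = norm (A - B)"
definition uniformity_fmat :: "(fmat \<times> fmat) filter" where
  "uniformity_fmat = (INF e\<in>{0<..}. principal {(x, y). dist x y < e})"
definition open_fmat :: "fmat set \<Rightarrow> bool" where
  "open_fmat U = (\<forall>x\<in>U. \<forall>\<^sub>F (x', y) in uniformity. x' = x \<longrightarrow> y \<in> U)"

lemma inner_fmat_bound:
  assumes "\<And>i j. m \<le> i \<or> m \<le> j \<Longrightarrow> entry A i j = 0"
  shows "inner A B = (\<Sum>i<m. \<Sum>j<m. Re (cnj (entry A i j) * entry B i j))"
proof -
  have "(\<Sum>i<bd A. \<Sum>j<bd A. Re (cnj (entry A i j) * entry B i j)) =
        (\<Sum>i<bd A. \<Sum>j<m. Re (cnj (entry A i j) * entry B i j))"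
    using assms entry_bd by (intro sum.cong[OF refl]) (rule sum_lessThan_extend, auto)
  also have "\<dots> = (\<Sum>i<m. \<Sum>j<m. Re (cnj (entry A i j) * entry B i j))"
    by (rule sum_lessThan_extend) (auto intro!: sum.neutral simp: assms entry_bd)
  finally show ?thesis unfolding inner_fmat_def .
qed

lemma inner_self_fmat: "inner A A = (\<Sum>i<bd A. \<Sum>j<bd A. (cmod (entry A i j))\<^sup>2)" for A :: fmat
  unfolding inner_fmat_def
  by (intro sum.cong refl) (simp add: cmod_power2 flip: power2_eq_square)

instance
proof
  fix A B C :: fmat and r :: real
  obtain m where m: "\<And>D i j. D \<in> set [A, B, C, A + B] \<Longrightarrow> m \<le> i \<or> m \<le> j \<Longrightarrow> entry D i j = 0"
    using common_bound by blast
  note b = inner_fmat_bound[of m]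
  show "inner A B = inner B A"
    using m by (subst (1 2) b) (auto intro!: sum.cong simp: algebra_simps)
  show "inner (A + B) C = inner A C + inner B C"
    using m by (subst (1 2 3) b) (auto simp: sum.distrib algebra_simps)
  show "inner (r *\<^sub>R A) B = r * inner A B"
    using m by (subst (1 2) b) (auto simp: sum_distrib_left algebra_simps)
  show "0 \<le> inner A A"
    unfolding inner_self_fmat by (intro sum_nonneg) auto
  show "(inner A A = 0) = (A = 0)"
  proof
    assume "inner A A = 0"
    then have "\<forall>i<bd A. \<forall>j<bd A. entry A i j = 0"
      unfolding inner_self_fmat by (subst (asm) sum_nonneg_eq_0_iff) (auto simp: sum_nonneg sum_nonneg_eq_0_iff)
    then show "A = 0" using entry_bd by (intro fmat_eqI) (metis entry_zero not_le)
  qed (simp add: inner_self_fmat)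
qed (simp_all add: norm_fmat_def sgn_fmat_def dist_fmat_def uniformity_fmat_def open_fmat_def)

end

lemma norm_fmat_sq:
  assumes "\<And>i j. m \<le> i \<or> n \<le> j \<Longrightarrow> entry A i j = 0"
  shows "(norm A)\<^sup>2 = (\<Sum>i<m. \<Sum>j<n. (cmod (entry A i j))\<^sup>2)"
proof -
  have "(norm A)\<^sup>2 = (\<Sum>i<bd A. \<Sum>j<bd A. (cmod (entry A i j))\<^sup>2)"
    by (metis inner_self_fmat power2_norm_eq_inner)
  also have "\<dots> = (\<Sum>i<bd A. \<Sum>j<n. (cmod (entry A i j))\<^sup>2)"
    using assms entry_bd by (intro sum.cong[OF refl]) (rule sum_lessThan_extend, auto)
  also have "\<dots> = (\<Sum>i<m. \<Sum>j<n. (cmod (entry A i j))\<^sup>2)"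
    by (rule sum_lessThan_extend) (auto intro!: sum.neutral simp: assms entry_bd)
  finally show ?thesis .
qed

lemma norm_entry_le: "cmod (entry A i j) \<le> norm A"
proof (cases "bd A \<le> i \<or> bd A \<le> j")
  case True
  then show ?thesis by (simp add: entry_bd)
next
  case False
  have "(cmod (entry A i j))\<^sup>2 \<le> (\<Sum>j<bd A. (cmod (entry A i j))\<^sup>2)"
    using False by (intro member_le_sum) auto
  also have "\<dots> \<le> (\<Sum>i<bd A. \<Sum>j<bd A. (cmod (entry A i j))\<^sup>2)"
    using False by (intro member_le_sum[of i _ "\<lambda>i. \<Sum>j<bd A. (cmod (entry A i j))\<^sup>2"]) (auto intro: sum_nonneg)
  also have "\<dots> = (norm A)\<^sup>2" by (metis inner_self_fmat power2_norm_eq_inner)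
  finally show ?thesis by (rule power2_le_imp_le) simp
qed

instantiation fmat :: real_normed_algebra
begin

definition times_fmat :: "fmat \<Rightarrow> fmat \<Rightarrow> fmat" where
  "A * B = Fmat (\<lambda>i j. \<Sum>l<bd A. entry A i l * entry B l j)"

lemma entry_times_bd: "entry (A * B) i j = (\<Sum>l<bd A. entry A i l * entry B l j)"
  unfolding times_fmat_def
  by (subst entry_Fmat[of "bd A + bd B"]) (auto simp: entry_bd intro!: sum.neutral)

lemma entry_times:
  assumes "\<And>l. m \<le> l \<Longrightarrow> entry A i l = 0 \<or> entry B l j = 0"
  shows "entry (A * B) i j = (\<Sum>l<m. entry A i l * entry B l j)"
  unfolding entry_times_bd using assms by (intro sum_lessThan_extend) (auto simp: entry_bd)

instance
proof
  fix A B C :: fmat and r :: real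
  obtain m where m: "\<And>D i j. D \<in> set [A, B, C, A * B, B * C] \<Longrightarrow> m \<le> i \<or> m \<le> j \<Longrightarrow> entry D i j = 0"
    using common_bound by blast
  show "A * B * C = A * (B * C)"
  proof (rule fmat_eqI)
    fix i j
    have "entry (A * B * C) i j = (\<Sum>l<m. (\<Sum>k<m. entry A i k * entry B k l) * entry C l j)"
      using m by (simp add: entry_times[of m])
    also have "\<dots> = (\<Sum>k<m. \<Sum>l<m. entry A i k * entry B k l * entry C l j)"
      by (subst sum.swap) (simp add: sum_distrib_right)
    also have "\<dots> = (\<Sum>k<m. entry A i k * (\<Sum>l<m. entry B k l * entry C l j))"
      by (simp add: sum_distrib_left mult.assoc)
    also have "\<dots> = entry (A * (B * C)) i j"
      using m by (simp add: entry_times[of m])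
    finally show "entry (A * B * C) i j = entry (A * (B * C)) i j" .
  qed
  show "(A + B) * C = A * C + B * C"
    by (rule fmat_eqI) (use m in \<open>simp add: entry_times[of m] sum.distrib algebra_simps\<close>)
  show "A * (B + C) = A * B + A * C"
    by (rule fmat_eqI) (use m in \<open>simp add: entry_times[of m] sum.distrib algebra_simps\<close>)
  show "r *\<^sub>R A * B = r *\<^sub>R (A * B)" "A * r *\<^sub>R B = r *\<^sub>R (A * B)"
    by (rule fmat_eqI; use m in \<open>simp add: entry_times[of m] sum_distrib_left algebra_simps\<close>)+
  show "norm (A * B) \<le> norm A * norm B"
  proof (rule power2_le_imp_le)
    have nm: "(norm D)\<^sup>2 = (\<Sum>i<m. \<Sum>j<m. (cmod (entry D i j))\<^sup>2)" if "D \<in> {A, B, A * B}" for D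
      using m that by (intro norm_fmat_sq) auto
    have cs: "(cmod (entry (A * B) i j))\<^sup>2 \<le> (\<Sum>l<m. (cmod (entry A i l))\<^sup>2) * (\<Sum>l<m. (cmod (entry B l j))\<^sup>2)" for i j
    proof -
      have "cmod (entry (A * B) i j) \<le> (\<Sum>l<m. cmod (entry A i l) * cmod (entry B l j))"
        using m by (subst entry_times[of m]) (auto intro!: sum_norm_le simp: norm_mult)
      then have "(cmod (entry (A * B) i j))\<^sup>2 \<le> (\<Sum>l<m. cmod (entry A i l) * cmod (entry B l j))\<^sup>2"
        by (intro power_mono) auto
      also have "\<dots> \<le> (\<Sum>l<m. (cmod (entry A i l))\<^sup>2) * (\<Sum>l<m. (cmod (entry B l j))\<^sup>2)"
        by (rule Cauchy_Schwarz_ineq_sum)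
      finally show ?thesis .
    qed
    have "(norm (A * B))\<^sup>2 \<le> (\<Sum>i<m. \<Sum>j<m. (\<Sum>l<m. (cmod (entry A i l))\<^sup>2) * (\<Sum>l<m. (cmod (entry B l j))\<^sup>2))"
      unfolding nm[of "A * B", simplified] using cs by (intro sum_mono) auto
    also have "\<dots> = (\<Sum>i<m. \<Sum>l<m. (cmod (entry A i l))\<^sup>2) * (\<Sum>j<m. \<Sum>l<m. (cmod (entry B l j))\<^sup>2)"
      by (simp add: sum_product)
    also have "\<dots> = (norm A)\<^sup>2 * (norm B)\<^sup>2"
      using nm[of A] nm[of B] by (simp, subst (2) sum.swap) simp
    finally show "(norm (A * B))\<^sup>2 \<le> (norm A * norm B)\<^sup>2" by (simp add: power_mult_distrib)
  qed simp
qed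

end

lemma entry_sum [simp]: "entry (sum f S) i j = (\<Sum>x\<in>S. entry (f x) i j)"
  by (induction S rule: infinite_finite_induct) auto

definition cscale :: "complex \<Rightarrow> fmat \<Rightarrow> fmat" where
  "cscale c A = Fmat (\<lambda>i j. c * entry A i j)"

definition adj :: "fmat \<Rightarrow> fmat" where
  "adj A = Fmat (\<lambda>i j. cnj (entry A j i))"

definition cconj :: "fmat \<Rightarrow> fmat" where
  "cconj A = Fmat (\<lambda>i j. cnj (entry A i j))"

definition Diag :: "nat \<Rightarrow> (nat \<Rightarrow> complex) \<Rightarrow> fmat" where
  "Diag n x = Fmat (\<lambda>i j. if i = j \<and> i < n then x i else 0)"

abbreviation Id :: "nat \<Rightarrow> fmat" where "Id n \<equiv> Diag n (\<lambda>_. 1)"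

definition mats :: "nat \<Rightarrow> nat \<Rightarrow> fmat set" where
  "mats m n = {A. \<forall>i j. m \<le> i \<or> n \<le> j \<longrightarrow> entry A i j = 0}"

definition tr :: "fmat \<Rightarrow> complex" where
  "tr A = (\<Sum>i<bd A. entry A i i)"

definition elem :: "nat \<Rightarrow> nat \<Rightarrow> fmat" where
  "elem a b = Fmat (\<lambda>i j. if i = a \<and> j = b then 1 else 0)"

lemma entry_cscale [simp]: "entry (cscale c A) i j = c * entry A i j"
  unfolding cscale_def by (subst entry_Fmat[of "bd A"]) (auto simp: entry_bd)

lemma entry_adj [simp]: "entry (adj A) i j = cnj (entry A j i)"
  unfolding adj_def by (subst entry_Fmat[of "bd A"]) (auto simp: entry_bd)

lemma entry_cconj [simp]: "entry (cconj A) i j = cnj (entry A i j)"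
  unfolding cconj_def by (subst entry_Fmat[of "bd A"]) (auto simp: entry_bd)

lemma entry_Diag [simp]: "entry (Diag n x) i j = (if i = j \<and> i < n then x i else 0)"
  unfolding Diag_def by (subst entry_Fmat[of n]) auto

lemma entry_elem [simp]: "entry (elem a b) i j = (if i = a \<and> j = b then 1 else 0)"
  unfolding elem_def by (subst entry_Fmat[of "Suc a + Suc b"]) auto

lemma entry_mats: "A \<in> mats m n \<Longrightarrow> m \<le> i \<or> n \<le> j \<Longrightarrow> entry A i j = 0"
  unfolding mats_def by blast

lemma matsI: "(\<And>i j. m \<le> i \<or> n \<le> j \<Longrightarrow> entry A i j = 0) \<Longrightarrow> A \<in> mats m n"
  unfolding mats_def by blast

lemma mats_eqI:
  assumes "A \<in> mats m n" "B \<in> mats m n" "\<And>i j. i < m \<Longrightarrow> j < n \<Longrightarrow> entry A i j = entry B i j"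
  shows "A = B"
  using assms by (intro fmat_eqI) (metis entry_mats not_le)

lemma entry_times_mats:
  "A \<in> mats m n \<or> B \<in> mats n k \<Longrightarrow> entry (A * B) i j = (\<Sum>l<n. entry A i l * entry B l j)"
  by (rule entry_times) (auto simp: entry_mats)

lemma mats_mono: "A \<in> mats m n \<Longrightarrow> m \<le> m' \<Longrightarrow> n \<le> n' \<Longrightarrow> A \<in> mats m' n'"
  by (auto intro!: matsI simp: entry_mats)

named_theorems mats_intro

lemma mats_zero [mats_intro, simp]: "0 \<in> mats m n" by (rule matsI) auto
lemma mats_plus [mats_intro]: "A \<in> mats m n \<Longrightarrow> B \<in> mats m n \<Longrightarrow> A + B \<in> mats m n"
  by (auto intro!: matsI simp: entry_mats)
lemma mats_minus [mats_intro]: "A \<in> mats m n \<Longrightarrow> B \<in> mats m n \<Longrightarrow> A - B \<in> mats m n"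
  by (auto intro!: matsI simp: entry_mats)
lemma mats_uminus [mats_intro]: "A \<in> mats m n \<Longrightarrow> - A \<in> mats m n"
  by (auto intro!: matsI simp: entry_mats)
lemma mats_scaleR [mats_intro]: "A \<in> mats m n \<Longrightarrow> r *\<^sub>R A \<in> mats m n"
  by (auto intro!: matsI simp: entry_mats)
lemma mats_cscale [mats_intro]: "A \<in> mats m n \<Longrightarrow> cscale c A \<in> mats m n"
  by (auto intro!: matsI simp: entry_mats)
lemma mats_adj [mats_intro]: "A \<in> mats m n \<Longrightarrow> adj A \<in> mats n m"
  by (auto intro!: matsI simp: entry_mats)
lemma mats_cconj [mats_intro]: "A \<in> mats m n \<Longrightarrow> cconj A \<in> mats m n"
  by (auto intro!: matsI simp: entry_mats)
lemma mats_sum [mats_intro]: "(\<And>x. x \<in> S \<Longrightarrow> f x \<in> mats m n) \<Longrightarrow> sum f S \<in> mats m n"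
  by (rule matsI) (auto intro!: sum.neutral dest: entry_mats)
lemma mats_times: "A \<in> mats m k \<Longrightarrow> B \<in> mats l n \<Longrightarrow> A * B \<in> mats m n"
  by (auto intro!: matsI sum.neutral simp: entry_mats entry_times_bd)
lemma mats_times_same [mats_intro]: "A \<in> mats m k \<Longrightarrow> B \<in> mats k n \<Longrightarrow> A * B \<in> mats m n"
  by (rule mats_times)
lemma mats_Diag [mats_intro, simp]: "Diag n x \<in> mats n n" by (rule matsI) auto
lemma mats_elem: "a < m \<Longrightarrow> b < n \<Longrightarrow> elem a b \<in> mats m n" by (rule matsI) auto

lemma entry_Diag_times: "entry (Diag n x * A) i j = (if i < n then x i * entry A i j else 0)"
  by (subst entry_times_mats[of _ n n], simp) (auto simp: if_distrib[of "\<lambda>y. y * _"] cong: if_cong)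

lemma entry_times_Diag: "entry (A * Diag n x) i j = (if j < n then entry A i j * x j else 0)"
  by (subst entry_times[of n]) (auto simp: if_distrib[of "\<lambda>y. _ * y"] cong: if_cong)

lemma Id_times [simp]: "A \<in> mats m n \<Longrightarrow> Id m * A = A"
  by (rule fmat_eqI) (auto simp: entry_Diag_times entry_mats)

lemma times_Id [simp]: "A \<in> mats m n \<Longrightarrow> A * Id n = A"
  by (rule fmat_eqI) (auto simp: entry_times_Diag entry_mats)

lemma adj_adj [simp]: "adj (adj A) = A" by (rule fmat_eqI) simp
lemma adj_zero [simp]: "adj 0 = 0" by (rule fmat_eqI) simp
lemma adj_eq_0_iff [simp]: "adj A = 0 \<longleftrightarrow> A = 0" by (metis adj_adj adj_zero)
lemma adj_plus: "adj (A + B) = adj A + adj B" by (rule fmat_eqI) simp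
lemma adj_minus: "adj (A - B) = adj A - adj B" by (rule fmat_eqI) simp
lemma adj_uminus: "adj (- A) = - adj A" by (rule fmat_eqI) simp
lemma adj_scaleR: "adj (r *\<^sub>R A) = r *\<^sub>R adj A" by (rule fmat_eqI) simp
lemma adj_cscale: "adj (cscale c A) = cscale (cnj c) (adj A)" by (rule fmat_eqI) simp
lemma adj_sum: "adj (sum f S) = (\<Sum>x\<in>S. adj (f x))" by (rule fmat_eqI) simp
lemma adj_Diag: "adj (Diag n x) = Diag n (\<lambda>i. cnj (x i))" by (rule fmat_eqI) auto
lemma adj_Id [simp]: "adj (Id n) = Id n" by (simp add: adj_Diag)
lemma adj_times: "adj (A * B) = adj B * adj A"
proof -
  obtain m where m: "\<And>C i j. C \<in> set [A, B] \<Longrightarrow> m \<le> i \<or> m \<le> j \<Longrightarrow> entry C i j = 0"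
    using common_bound by blast
  then show ?thesis
    by (intro fmat_eqI) (simp add: entry_times[of m] mult.commute)
qed
lemmas adj_simps = adj_plus adj_minus adj_uminus adj_scaleR adj_cscale adj_sum adj_times

lemma cconj_cconj [simp]: "cconj (cconj A) = A" by (rule fmat_eqI) simp
lemma cconj_zero [simp]: "cconj 0 = 0" by (rule fmat_eqI) simp
lemma cconj_plus: "cconj (A + B) = cconj A + cconj B" by (rule fmat_eqI) simp
lemma cconj_minus: "cconj (A - B) = cconj A - cconj B" by (rule fmat_eqI) simp
lemma cconj_uminus: "cconj (- A) = - cconj A" by (rule fmat_eqI) simp
lemma cconj_scaleR: "cconj (r *\<^sub>R A) = r *\<^sub>R cconj A" by (rule fmat_eqI) simp
lemma cconj_sum: "cconj (sum f S) = (\<Sum>x\<in>S. cconj (f x))" by (rule fmat_eqI) simp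
lemma cconj_Id [simp]: "cconj (Id n) = Id n" by (rule fmat_eqI) auto
lemma cconj_adj: "cconj (adj A) = adj (cconj A)" by (rule fmat_eqI) simp
lemma cconj_cscale: "cconj (cscale c A) = cscale (cnj c) (cconj A)" by (rule fmat_eqI) simp
lemma cconj_times: "cconj (A * B) = cconj A * cconj B"
proof -
  obtain m where m: "\<And>C i j. C \<in> set [A, B] \<Longrightarrow> m \<le> i \<or> m \<le> j \<Longrightarrow> entry C i j = 0"
    using common_bound by blast
  then show ?thesis by (intro fmat_eqI) (simp add: entry_times[of m])
qed
lemmas cconj_simps = cconj_plus cconj_minus cconj_uminus cconj_scaleR cconj_sum cconj_times cconj_adj cconj_cscale

lemma cscale_one [simp]: "cscale 1 A = A" by (rule fmat_eqI) simp
lemma cscale_zero [simp]: "cscale 0 A = 0" by (rule fmat_eqI) simp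
lemma cscale_0_right [simp]: "cscale c 0 = 0" by (rule fmat_eqI) simp
lemma cscale_cscale [simp]: "cscale c (cscale b A) = cscale (c * b) A" by (rule fmat_eqI) simp
lemma cscale_of_real: "cscale (of_real r) A = r *\<^sub>R A" by (rule fmat_eqI) simp
lemma cscale_plus: "cscale c (A + B) = cscale c A + cscale c B" by (rule fmat_eqI) (simp add: algebra_simps)
lemma cscale_minus: "cscale c (A - B) = cscale c A - cscale c B" by (rule fmat_eqI) (simp add: algebra_simps)
lemma cscale_diff_left: "cscale (c - b) A = cscale c A - cscale b A" by (rule fmat_eqI) (simp add: algebra_simps)
lemma cscale_sum: "cscale c (sum f S) = (\<Sum>x\<in>S. cscale c (f x))" by (rule fmat_eqI) (simp add: sum_distrib_left)
lemma cscale_times [simp]: "cscale c A * B = cscale c (A * B)"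
  by (rule fmat_eqI) (simp add: entry_times[of "bd A + bd B"] entry_bd sum_distrib_left mult.assoc)
lemma times_cscale [simp]: "A * cscale c B = cscale c (A * B)"
  by (rule fmat_eqI) (simp add: entry_times[of "bd A + bd B"] entry_bd sum_distrib_left algebra_simps)
lemma norm_cscale: "norm (cscale c A) = cmod c * norm A"
proof (rule power2_eq_imp_eq)
  show "(norm (cscale c A))\<^sup>2 = (cmod c * norm A)\<^sup>2"
    by (simp add: norm_fmat_sq[of "bd A" "bd A"] entry_bd norm_mult power_mult_distrib sum_distrib_left)
qed simp_all

lemma tr_mats: "A \<in> mats m n \<Longrightarrow> tr A = (\<Sum>i<m. entry A i i)"
  unfolding tr_def by (rule sum_lessThan_extend) (auto simp: entry_bd entry_mats)
lemma tr_bound: "(\<And>i. m \<le> i \<Longrightarrow> entry A i i = 0) \<Longrightarrow> tr A = (\<Sum>i<m. entry A i i)"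
  unfolding tr_def by (rule sum_lessThan_extend) (auto simp: entry_bd entry_mats)
lemma tr_zero [simp]: "tr 0 = 0" by (simp add: tr_mats[of _ 0 0])
lemma tr_Diag: "tr (Diag n x) = (\<Sum>i<n. x i)" by (simp add: tr_mats[of _ n n])
lemma tr_Id [simp]: "tr (Id n) = of_nat n" by (simp add: tr_Diag)
lemma tr_plus: "tr (A + B) = tr A + tr B"
  by (simp add: tr_bound[of "bd A + bd B"] entry_bd sum.distrib)
lemma tr_minus: "tr (A - B) = tr A - tr B"
  by (simp add: tr_bound[of "bd A + bd B"] entry_bd sum_subtractf)
lemma tr_cscale: "tr (cscale c A) = c * tr A"
  by (simp add: tr_bound[of "bd A"] entry_bd sum_distrib_left)
lemma tr_scaleR: "tr (r *\<^sub>R A) = r *\<^sub>R tr A"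
  by (simp add: tr_bound[of "bd A"] entry_bd scaleR_conv_of_real sum_distrib_left)
lemma tr_sum: "tr (sum f S) = (\<Sum>x\<in>S. tr (f x))"
  by (induction S rule: infinite_finite_induct) (auto simp: tr_plus)
lemma tr_times_commute: "tr (A * B) = tr (B * A)"
proof -
  obtain m where m: "\<And>C i j. C \<in> set [A, B, A * B, B * A] \<Longrightarrow> m \<le> i \<or> m \<le> j \<Longrightarrow> entry C i j = 0"
    using common_bound by blast
  have "tr (A * B) = (\<Sum>i<m. \<Sum>l<m. entry A i l * entry B l i)"
    using m by (subst tr_bound[of m]) (auto simp: entry_times[of m])
  also have "\<dots> = (\<Sum>l<m. \<Sum>i<m. entry B l i * entry A i l)"
    by (subst sum.swap) (simp add: mult.commute)
  also have "\<dots> = tr (B * A)"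
    using m by (subst tr_bound[of m]) (auto simp: entry_times[of m])
  finally show ?thesis .
qed

lemma inner_tr: "inner A B = Re (tr (adj A * B))"
proof -
  obtain m where m: "\<And>C i j. C \<in> set [A, B, adj A * B] \<Longrightarrow> m \<le> i \<or> m \<le> j \<Longrightarrow> entry C i j = 0"
    using common_bound by blast
  have "inner A B = (\<Sum>i<m. \<Sum>j<m. Re (cnj (entry A i j) * entry B i j))"
    using m by (intro inner_fmat_bound) auto
  also have "\<dots> = (\<Sum>j<m. \<Sum>i<m. Re (cnj (entry A i j) * entry B i j))" by (rule sum.swap)
  also have "\<dots> = Re (\<Sum>j<m. entry (adj A * B) j j)"
    using m by (simp add: entry_times[of m])
  also have "\<dots> = Re (tr (adj A * B))"
    using m by (subst tr_bound[of m]) auto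
  finally show ?thesis .
qed

lemma tr_adj_self: "tr (adj A * A) = of_real ((norm A)\<^sup>2)"
proof -
  obtain m where m: "\<And>C i j. C \<in> set [A, adj A * A] \<Longrightarrow> m \<le> i \<or> m \<le> j \<Longrightarrow> entry C i j = 0"
    using common_bound by blast
  have "tr (adj A * A) = (\<Sum>j<m. \<Sum>i<m. cnj (entry A i j) * entry A i j)"
    using m by (subst tr_bound[of m]) (auto simp: entry_times[of m])
  also have "\<dots> = (\<Sum>j<m. \<Sum>i<m. of_real ((cmod (entry A i j))\<^sup>2))"
    by (simp only: complex_norm_square mult.commute)
  also have "\<dots> = of_real (\<Sum>j<m. \<Sum>i<m. (cmod (entry A i j))\<^sup>2)" by simp
  also have "(\<Sum>j<m. \<Sum>i<m. (cmod (entry A i j))\<^sup>2) = (norm A)\<^sup>2"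
    using m by (subst sum.swap, subst norm_fmat_sq[of m m]) auto
  finally show ?thesis .
qed

lemma norm_sq_tr: "(norm A)\<^sup>2 = Re (tr (adj A * A))"
  by (simp add: tr_adj_self)

lemma norm_adj [simp]: "norm (adj A) = norm A"
proof -
  have "(norm (adj A))\<^sup>2 = (norm A)\<^sup>2"
    unfolding norm_sq_tr by (simp add: tr_times_commute)
  then show ?thesis by simp
qed

lemma norm_Id: "norm (Id n) = sqrt (real n)"
proof -
  have "(norm (Id n))\<^sup>2 = real n"
    unfolding norm_sq_tr by (simp add: times_Id[OF mats_Diag])
  then show ?thesis by (metis norm_ge_zero real_sqrt_unique)
qed

lemma coisometry_norm:
  assumes "C * adj C = Id m"
  shows "norm C = norm (Id m)"
proof -
  have "(norm (adj C))\<^sup>2 = (norm (Id m))\<^sup>2"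
    unfolding norm_sq_tr by (simp add: assms Id_times[OF mats_Diag])
  then show ?thesis by simp
qed

text \<open>
  The trace of \<open>adj A * A\<close> is the squared norm of \<open>A\<close>. This cancellation replaces arguments with
  kernels and orthogonal complements.
\<close>

lemma adj_times_eq_0_iff [simp]: "adj A * A = 0 \<longleftrightarrow> A = 0"
proof
  assume "adj A * A = 0"
  then have "(norm A)\<^sup>2 = 0" unfolding norm_sq_tr by simp
  then show "A = 0" by simp
qed simp

lemma times_adj_eq_0_iff [simp]: "A * adj A = 0 \<longleftrightarrow> A = 0"
  using adj_times_eq_0_iff[of "adj A"] by simp

section \<open>Determinants, inverses and the spectral theorem\<close>

(* Column vectors are elements of mats d 1, so the numeral must stay recognisable. *)
declare One_nat_def [simp del]

lemma bounded_linear_entry: "bounded_linear (\<lambda>A. entry A i j)"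
  by (rule bounded_linear_intro[of _ 1]) (auto simp: scaleR_conv_of_real norm_entry_le)

lemmas tendsto_entry = bounded_linear.tendsto[OF bounded_linear_entry]

abbreviation jmat :: "nat \<Rightarrow> nat \<Rightarrow> fmat \<Rightarrow> complex Matrix.mat" where
  "jmat m n A \<equiv> Matrix.mat m n (\<lambda>(i, j). entry A i j)"

definition dt :: "nat \<Rightarrow> fmat \<Rightarrow> complex" where
  "dt k A = Determinant.det (jmat k k A)"

lemma jmat_times:
  assumes "A \<in> mats m n \<or> B \<in> mats n k"
  shows "jmat m k (A * B) = jmat m n A * jmat n k B"
  using assms
  by (intro eq_matI) (auto simp: scalar_prod_def entry_times_mats lessThan_atLeast0)

lemma jmat_Id [simp]: "jmat k k (Id k) = Matrix.one_mat k"
  by (intro eq_matI) auto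

lemma dt_times: "A \<in> mats k k \<or> B \<in> mats k k \<Longrightarrow> dt k (A * B) = dt k A * dt k B"
  unfolding dt_def by (simp add: jmat_times Determinant.det_mult[of _ k])

lemma dt_Id [simp]: "dt k (Id k) = 1"
  unfolding dt_def by simp

lemma dt_leibniz: "dt k A = (\<Sum>p | p permutes {0..<k}. signof p * (\<Prod>i = 0..<k. entry A i (p i)))"
proof -
  have "dt k A = (\<Sum>p | p permutes {0..<k}. signof p * (\<Prod>i = 0..<k. jmat k k A $$ (i, p i)))"
    unfolding dt_def by (rule Determinant.det_def') simp
  also have "\<dots> = (\<Sum>p | p permutes {0..<k}. signof p * (\<Prod>i = 0..<k. entry A i (p i)))"
  proof (intro sum.cong refl arg_cong2[of _ _ _ _ "(*)"] prod.cong)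
    fix p i assume "p \<in> {p. p permutes {0..<k}}" "i \<in> {0..<k}"
    then have "p i < k" "i < k" using permutes_in_image[of p "{0..<k}" i] by auto
    then show "jmat k k A $$ (i, p i) = entry A i (p i)" by simp
  qed
  finally show ?thesis .
qed

lemma tendsto_dt [tendsto_intros]: "(f \<longlongrightarrow> A) F \<Longrightarrow> ((\<lambda>x. dt k (f x)) \<longlongrightarrow> dt k A) F"
  unfolding dt_leibniz by (intro tendsto_intros tendsto_entry)

lemma holomorphic_dt:
  assumes "\<And>i j. (\<lambda>w. entry (F w) i j) holomorphic_on S"
  shows "(\<lambda>w. dt k (F w)) holomorphic_on S"
  unfolding dt_leibniz by (intro holomorphic_intros assms)

lemma dt_cscale: "dt k (cscale c A) = c ^ k * dt k A"
  unfolding dt_leibniz by (simp add: prod.distrib sum_distrib_left algebra_simps)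

lemma dt_Diag: "dt k (Diag k x) = (\<Prod>i<k. x i)"
proof -
  have "dt k (Diag k x) = prod_list (diag_mat (jmat k k (Diag k x)))"
    unfolding dt_def by (rule Determinant.det_lower_triangular[where n = k]) auto
  also have "\<dots> = (\<Prod>i<k. x i)"
    unfolding prod_list_diag_prod by (simp add: lessThan_atLeast0)
  finally show ?thesis .
qed

lemma dt_adj: "dt k (adj A) = cnj (dt k A)"
proof -
  have "dt k (adj A) = Determinant.det (transpose_mat (jmat k k (adj A)))"
    unfolding dt_def by (rule Determinant.det_transpose[symmetric, where n = k]) simp
  also have "transpose_mat (jmat k k (adj A)) = jmat k k (cconj A)"
    by (intro eq_matI) auto
  also have "Determinant.det \<dots> = dt k (cconj A)" by (simp add: dt_def)
  also have "\<dots> = cnj (dt k A)"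
    unfolding dt_leibniz by (simp add: sign_def)
  finally show ?thesis .
qed

lemma norm_dt_le: "cmod (dt k A) \<le> fact k * norm A ^ k"
proof -
  have "cmod (dt k A) \<le> (\<Sum>p | p permutes {0..<k}. norm A ^ k)"
    unfolding dt_leibniz
  proof (intro sum_norm_le)
    fix p
    have "cmod (signof p * (\<Prod>i = 0..<k. entry A i (p i))) = (\<Prod>i = 0..<k. cmod (entry A i (p i)))"
      by (simp add: norm_mult prod_norm sign_def)
    also have "\<dots> \<le> (\<Prod>i = 0..<k. norm A)"
      by (intro prod_mono) (auto simp: norm_entry_le)
    finally show "cmod (signof p * (\<Prod>i = 0..<k. entry A i (p i))) \<le> norm A ^ k" by simp
  qed
  also have "\<dots> = fact k * norm A ^ k"
    by (simp add: card_permutations[of _ k])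
  finally show ?thesis .
qed

definition fvec :: "complex Matrix.vec \<Rightarrow> fmat" where
  "fvec v = Fmat (\<lambda>i j. if j = 0 \<and> i < dim_vec v then vec_index v i else 0)"

lemma entry_fvec: "entry (fvec v) i j = (if j = 0 \<and> i < dim_vec v then vec_index v i else 0)"
  unfolding fvec_def by (subst entry_Fmat[of "Suc (dim_vec v)"]) auto

lemma fvec_mats: "v \<in> carrier_vec d \<Longrightarrow> fvec v \<in> mats d 1"
  by (intro matsI) (auto simp: entry_fvec)

lemma fvec_eq_0: "v \<in> carrier_vec d \<Longrightarrow> fvec v = 0 \<Longrightarrow> v = 0\<^sub>v d"
  by (intro eq_vecI) (auto dest!: arg_cong[of _ _ "\<lambda>A. entry A _ 0"] simp: entry_fvec split: if_splits)

lemma fvec_mult: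
  assumes "v \<in> carrier_vec d" "A \<in> mats d d"
  shows "A * fvec v = fvec (jmat d d A *\<^sub>v v)"
  using assms
proof (intro mats_eqI[of _ d 1])
  fix i j :: nat assume "i < d" "j < 1"
  then show "entry (A * fvec v) i j = entry (fvec (jmat d d A *\<^sub>v v)) i j"
    using assms by (auto simp: entry_times_mats[of A d d] entry_fvec scalar_prod_def lessThan_atLeast0)
qed (use assms in \<open>auto intro!: mats_times_same fvec_mats mult_mat_vec_carrier\<close>)

lemma dt_zero_kernel:
  assumes "A \<in> mats d d" "dt d A = 0"
  obtains v where "v \<in> mats d 1" "v \<noteq> 0" "A * v = 0"
proof -
  have "\<exists>v. v \<in> carrier_vec d \<and> v \<noteq> 0\<^sub>v d \<and> jmat d d A *\<^sub>v v = 0\<^sub>v d"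
    using assms by (subst det_0_iff_vec_prod_zero_field[symmetric]) (auto simp: dt_def)
  then obtain v where v: "v \<in> carrier_vec d" "v \<noteq> 0\<^sub>v d" "jmat d d A *\<^sub>v v = 0\<^sub>v d" by blast
  have "fvec (0\<^sub>v d) = 0" by (rule fmat_eqI) (simp add: entry_fvec)
  then show ?thesis
    using v assms fvec_eq_0[of v d] by (intro that[of "fvec v"]) (auto simp: fvec_mats fvec_mult)
qed

lemma dt_nonzero_inverse:
  assumes "A \<in> mats d d" "dt d A \<noteq> 0"
  obtains B where "B \<in> mats d d" "A * B = Id d" "B * A = Id d"
proof -
  have "jmat d d A \<in> Units (ring_mat TYPE(complex) d ())"
    using assms by (intro det_non_zero_imp_unit) (auto simp: dt_def)
  then obtain C where C: "C \<in> carrier_mat d d" "C * jmat d d A = 1\<^sub>m d" "jmat d d A * C = 1\<^sub>m d"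
    by (auto simp: Units_def ring_mat_def)
  define B where "B = Fmat (\<lambda>i j. if i < d \<and> j < d then C $$ (i, j) else 0)"
  have eB: "entry B i j = (if i < d \<and> j < d then C $$ (i, j) else 0)" for i j
    unfolding B_def by (subst entry_Fmat[of d]) auto
  have B: "B \<in> mats d d" by (intro matsI) (auto simp: eB)
  have jB: "jmat d d B = C" using C(1) by (intro eq_matI) (auto simp: eB)
  have inj: "X = Y" if "X \<in> mats d d" "Y \<in> mats d d" "jmat d d X = jmat d d Y" for X Y
    using that(1,2)
  proof (rule mats_eqI)
    fix i j assume "i < d" "j < d"
    then show "entry X i j = entry Y i j"
      using arg_cong[OF that(3), of "\<lambda>M. M $$ (i, j)"] by simp
  qed
  show ?thesis
  proof (rule that[OF B])
    show "A * B = Id d"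
      using assms B C jB jmat_times[of A d d B d] by (intro inj) (auto intro: mats_intro)
    show "B * A = Id d"
      using assms B C jB jmat_times[of B d d A d] by (intro inj) (auto intro: mats_intro)
  qed
qed

lemma eigenvector_exists:
  assumes "A \<in> mats d d" "d > 0"
  obtains \<mu> v where "v \<in> mats d 1" "v \<noteq> 0" "A * v = cscale \<mu> v"
proof -
  obtain \<mu> where "\<mu> \<in> spectrum (jmat d d A)"
    using spectrum_non_empty[of "jmat d d A" d] assms by auto
  then obtain v where v: "v \<in> carrier_vec d" "v \<noteq> 0\<^sub>v d" "jmat d d A *\<^sub>v v = \<mu> \<cdot>\<^sub>v v"
    by (auto simp: spectrum_def eigenvalue_def eigenvector_def)
  have "fvec (\<mu> \<cdot>\<^sub>v v) = cscale \<mu> (fvec v)" by (rule fmat_eqI) (simp add: entry_fvec)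
  then show ?thesis
    using v assms fvec_eq_0[of v d] by (intro that[of "fvec v"]) (auto simp: fvec_mats fvec_mult)
qed

lemma entry_times_elem: "entry (A * elem a b) i j = (if j = b then entry A i a else 0)"
  by (subst entry_times[of "Suc a"])
     (auto simp: if_distrib[of "\<lambda>y. _ * y"] cong: if_cong)

lemma entry_elem_times: "entry (elem a b * A) i j = (if i = a then entry A b j else 0)"
  by (subst entry_times[of "Suc b"])
     (auto simp: if_distrib[of "\<lambda>y. y * _"] cong: if_cong)

lemma elem_times_elem: "elem a b * elem c e = (if b = c then elem a e else 0)"
  by (rule fmat_eqI) (auto simp: entry_elem_times)

lemma adj_elem [simp]: "adj (elem a b) = elem b a"
  by (rule fmat_eqI) auto

lemma Id_Suc: "Id (Suc d) = Id d + elem d d"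
  by (rule fmat_eqI) auto

lemma mats_1_1: "A \<in> mats 1 1 \<Longrightarrow> A = cscale (entry A 0 0) (Id 1)"
  by (rule mats_eqI[of _ 1 1]) (auto intro: mats_intro)

lemma adj_times_self_vec:
  assumes "v \<in> mats d 1"
  shows "adj v * v = cscale (of_real ((norm v)\<^sup>2)) (Id 1)"
proof -
  have *: "adj v * v \<in> mats 1 1" using assms by (intro mats_intro)
  have "entry (adj v * v) 0 0 = tr (adj v * v)" by (simp add: tr_mats[OF *] One_nat_def)
  then show ?thesis using mats_1_1[OF *] by (simp add: tr_adj_self)
qed

definition unitary :: "nat \<Rightarrow> fmat \<Rightarrow> bool" where
  "unitary d Q \<longleftrightarrow> Q \<in> mats d d \<and> adj Q * Q = Id d \<and> Q * adj Q = Id d"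

lemma unitary_Id [simp]: "unitary d (Id d)"
  unfolding unitary_def by (auto simp: Id_times[OF mats_Diag])

lemma unitary_adj: "unitary d Q \<Longrightarrow> unitary d (adj Q)"
  unfolding unitary_def by (auto intro: mats_intro)

lemma unitary_times: "unitary d Q \<Longrightarrow> unitary d R \<Longrightarrow> unitary d (Q * R)"
  unfolding unitary_def
proof (intro conjI; elim conjE)
  assume Q: "Q \<in> mats d d" "adj Q * Q = Id d" "Q * adj Q = Id d"
    and R: "R \<in> mats d d" "adj R * R = Id d" "R * adj R = Id d"
  show "Q * R \<in> mats d d" using Q R by (intro mats_intro)
  have "adj (Q * R) * (Q * R) = adj R * (adj Q * Q) * R" by (simp add: adj_times mult.assoc)
  also have "\<dots> = adj R * R" using Q R times_Id[OF mats_adj[OF R(1)]] by simp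
  finally show "adj (Q * R) * (Q * R) = Id d" using R by simp
  have "(Q * R) * adj (Q * R) = Q * (R * adj R) * adj Q" by (simp add: adj_times mult.assoc)
  also have "\<dots> = Q * adj Q" using Q R by simp
  finally show "(Q * R) * adj (Q * R) = Id d" using Q by simp
qed

lemma unitary_dt: "unitary d Q \<Longrightarrow> cmod (dt d Q) = 1"
proof -
  assume "unitary d Q"
  then have "dt d (adj Q * Q) = 1" "Q \<in> mats d d" unfolding unitary_def by auto
  then have "cnj (dt d Q) * dt d Q = 1" by (simp add: dt_times dt_adj)
  then have "cmod (dt d Q) * cmod (dt d Q) = 1" by (metis complex_mod_cnj norm_mult norm_one)
  then show ?thesis by (metis mult_cancel_left2 norm_ge_zero power2_eq_square power2_eq_iff_nonneg power_one zero_le_one)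
qed

lemma norm_unitary_times: "unitary d Q \<Longrightarrow> A \<in> mats d n \<Longrightarrow> norm (Q * A) = norm A"
proof -
  assume "unitary d Q" "A \<in> mats d n"
  then have "adj (Q * A) * (Q * A) = adj A * A"
    unfolding unitary_def adj_times mult.assoc by (metis Id_times mult.assoc)
  then have "(norm (Q * A))\<^sup>2 = (norm A)\<^sup>2" unfolding norm_sq_tr by simp
  then show ?thesis by simp
qed

lemma norm_times_unitary: "unitary d Q \<Longrightarrow> A \<in> mats n d \<Longrightarrow> norm (A * Q) = norm A"
  using norm_unitary_times[OF unitary_adj mats_adj, of d Q A n] by (metis adj_times norm_adj)

text \<open>
  The reflection \<open>Id - u u* / (1 - s)\<close> along \<open>u = e - v\<close> exchanges \<open>e\<close> and \<open>v\<close>, because the scalar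
  product \<open>s\<close> of the two unit vectors is real.
\<close>

lemma householder:
  assumes "v \<in> mats (Suc d) 1" "norm v = 1" "entry v d 0 \<in> \<real>"
  obtains W where "unitary (Suc d) W" "adj W = W" "W * elem d 0 = v"
proof (cases "v = elem d 0")
  case True
  then show ?thesis by (intro that[of "Id (Suc d)"]) (auto simp: Id_times[OF mats_elem[of d "Suc d" 0 1]])
next
  case False
  define e where "e = elem d 0"
  have e: "e \<in> mats (Suc d) 1" unfolding e_def by (rule mats_elem) auto
  define u where "u = e - v"
  have u: "u \<in> mats (Suc d) 1" unfolding u_def using e assms by (intro mats_intro)
  obtain s where s: "entry v d 0 = of_real s" using assms(3) by (auto elim: Reals_cases)
  have ev: "adj e * v = cscale (of_real s) (Id 1)"
    using mats_1_1[OF mats_times_same[OF mats_adj[OF e] assms(1)]] s by (simp add: e_def entry_elem_times)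
  have ve: "adj v * e = cscale (of_real s) (Id 1)"
    using arg_cong[OF ev, of adj] by (simp add: adj_simps)
  have ee: "adj e * e = Id 1" by (simp add: e_def elem_times_elem) (rule fmat_eqI, auto)
  have vv: "adj v * v = Id 1" using adj_times_self_vec[OF assms(1)] assms(2) by simp
  have ue: "adj u * e = cscale (of_real (1 - s)) (Id 1)"
    unfolding u_def by (simp add: adj_minus left_diff_distrib ee ve cscale_diff_left)
  have uu: "adj u * u = cscale (of_real (2 - 2 * s)) (Id 1)"
    unfolding u_def by (simp add: adj_minus algebra_simps ee ve ev vv cscale_diff_left)
      (rule fmat_eqI, auto)
  have "s \<noteq> 1"
  proof
    assume "s = 1"
    then have "adj u * u = 0" using uu by simp
    then show False using False by (simp add: u_def e_def)
  qed
  define W where "W = Id (Suc d) - (1 / (1 - s)) *\<^sub>R (u * adj u)"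
  have Wm: "W \<in> mats (Suc d) (Suc d)" unfolding W_def using u by (intro mats_intro mats_times_same[of _ _ 1])
  have adjW: "adj W = W" unfolding W_def by (simp add: adj_simps)
  have uuuu: "u * adj u * (u * adj u) = (2 - 2 * s) *\<^sub>R (u * adj u)"
  proof -
    have "u * adj u * (u * adj u) = u * (adj u * u) * adj u" by (simp add: mult.assoc)
    also have "\<dots> = (2 - 2 * s) *\<^sub>R (u * adj u)"
      unfolding uu cscale_of_real using u by simp
    finally show ?thesis .
  qed
  have m: "u * adj u \<in> mats (Suc d) (Suc d)" using u by (intro mats_intro)
  define P where "P = u * adj u"
  define k where "k = 1 / (1 - s)"
  have k: "k * (1 - s) = 1" using \<open>s \<noteq> 1\<close> by (simp add: k_def)
  have "k * (k * (2 - 2 * s)) = 2 * k * (k * (1 - s))" by (simp add: algebra_simps)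
  then have "k * (k * (2 - 2 * s)) = k + k" unfolding k by simp
  then have kPP: "k *\<^sub>R (k *\<^sub>R (P * P)) = k *\<^sub>R P + k *\<^sub>R P"
    unfolding P_def uuuu by (simp add: mult.assoc flip: scaleR_add_left)
  have "W * W = Id (Suc d) - k *\<^sub>R P - (k *\<^sub>R P - k *\<^sub>R (k *\<^sub>R (P * P)))"
    unfolding W_def P_def[symmetric] k_def[symmetric]
    by (simp add: left_diff_distrib right_diff_distrib Id_times[OF m[folded P_def]] times_Id[OF m[folded P_def]]
        Id_times[OF mats_Diag] scaleR_diff_right)
  then have WW: "W * W = Id (Suc d)" unfolding kPP by simp
  have "W * e = e - (1 / (1 - s)) *\<^sub>R (u * (adj u * e))"
    unfolding W_def by (simp add: left_diff_distrib Id_times[OF e] mult.assoc)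
  also have "\<dots> = e - u"
    unfolding ue cscale_of_real using u \<open>s \<noteq> 1\<close> by simp
  also have "\<dots> = v" by (simp add: u_def)
  finally show ?thesis
    using WW Wm adjW by (intro that[of W]) (auto simp: unitary_def e_def)
qed

text \<open>
  Induction on \<open>d\<close>: a reflection \<open>W\<close> moves an eigenvector to the last basis vector, after which the
  last row and column of the matrix vanish off the diagonal. The eigenvector is first multiplied
  by a phase that makes its last coordinate real, as \<open>householder\<close> requires.
\<close>

theorem spectral_theorem:
  assumes "H \<in> mats d d" "adj H = H"
  obtains Q x where "unitary d Q" "H = Q * Diag d (\<lambda>i. complex_of_real (x i)) * adj Q"
  using assms
proof (induction d arbitrary: H thesis)
  case 0
  have "A = 0" if "A \<in> mats 0 0" for A using that by (intro mats_eqI[of _ 0 0]) auto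
  then have "H = 0" "Diag 0 x = 0" for x using 0 by auto
  then show ?case by (intro 0(1)[of 0 "\<lambda>_. 0"]) (auto simp: unitary_def)
next
  case (Suc d)
  obtain \<mu> v' where v': "v' \<in> mats (Suc d) 1" "v' \<noteq> 0" "H * v' = cscale \<mu> v'"
    using eigenvector_exists[OF Suc(3) zero_less_Suc] by metis
  define z where "z = entry v' d 0"
  define c where "c = (if z = 0 then 1 else cnj z / of_real (cmod z)) / of_real (norm v')"
  define v where "v = cscale c v'"
  have "cmod c = 1 / norm v'" by (auto simp: c_def norm_divide)
  then have vn: "norm v = 1" using v'(2) by (simp add: v_def norm_cscale)
  have "c * z \<in> \<real>"
    by (auto simp: c_def mult.commute[of _ z] complex_norm_square[symmetric] simp flip: of_real_power of_real_mult of_real_divide)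
  then obtain W where W: "unitary (Suc d) W" "adj W = W" "W * elem d 0 = v"
    using householder[of v d] vn v' by (auto simp: v_def z_def mats_intro)
  have Hv: "H * v = cscale \<mu> v" using v'(3) by (simp add: v_def mult.commute)
  have Wm: "W \<in> mats (Suc d) (Suc d)" and WW: "W * W = Id (Suc d)"
    using W unfolding unitary_def by auto
  define H' where "H' = W * H * W"
  have H'm: "H' \<in> mats (Suc d) (Suc d)" unfolding H'_def using Wm Suc(3) by (intro mats_intro)
  have H'a: "adj H' = H'" unfolding H'_def using W Suc(4) by (simp add: adj_times mult.assoc)
  have "H' * elem d 0 = W * (H * v)" unfolding H'_def by (simp add: mult.assoc W)
  also have "\<dots> = cscale \<mu> (W * W * elem d 0)" by (simp add: Hv W mult.assoc)
  also have "\<dots> = cscale \<mu> (elem d 0)" unfolding WW by (simp add: Id_times[OF mats_elem[of d "Suc d" 0 1]])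
  finally have He: "H' * elem d 0 = cscale \<mu> (elem d 0)" .
  have col: "entry H' i d = (if i = d then \<mu> else 0)" for i
    using arg_cong[OF He, of "\<lambda>A. entry A i 0"] by (simp add: entry_times_elem)
  have row: "entry H' d i = (if i = d then \<mu> else 0)" for i
    using arg_cong[OF H'a, of "\<lambda>A. entry A d i"] arg_cong[OF H'a, of "\<lambda>A. entry A d d"] col[of i] col[of d]
    by auto
  have "cnj \<mu> = \<mu>" using arg_cong[OF H'a, of "\<lambda>A. entry A d d"] col[of d] by simp
  then obtain y where y: "\<mu> = complex_of_real y" by (metis Reals_cnj_iff Reals_cases)
  define M where "M = Id d * H' * Id d"
  have Mm: "M \<in> mats d d" unfolding M_def by (intro mats_times[of _ d "Suc d" _ d] mats_times[of _ d d _ "Suc d"] H'm) auto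
  have Ma: "adj M = M" unfolding M_def by (simp add: adj_times H'a mult.assoc)
  have H'M: "H' = M + cscale \<mu> (elem d d)"
  proof (rule mats_eqI[OF H'm])
    show "M + cscale \<mu> (elem d d) \<in> mats (Suc d) (Suc d)"
      by (intro mats_intro mats_elem mats_mono[OF Mm]) auto
    fix i j assume "i < Suc d" "j < Suc d"
    then show "entry H' i j = entry (M + cscale \<mu> (elem d d)) i j"
      unfolding M_def by (cases "i = d"; cases "j = d") (auto simp: entry_Diag_times entry_times_Diag col row less_Suc_eq)
  qed
  obtain Q x where Q: "unitary d Q" "M = Q * Diag d (\<lambda>i. complex_of_real (x i)) * adj Q"
    using Suc(1)[OF _ Mm Ma] by blast
  have Qm: "Q \<in> mats d d" using Q by (auto simp: unitary_def)
  have Qe: "Q * elem d d = 0" "elem d d * adj Q = 0" "elem d d * Q = 0" "adj Q * elem d d = 0"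
    using Qm by (auto intro!: fmat_eqI simp: entry_times_elem entry_elem_times entry_mats)
  define Q' where "Q' = Q + elem d d"
  have Q': "unitary (Suc d) Q'"
    unfolding unitary_def
  proof (intro conjI)
    show "Q' \<in> mats (Suc d) (Suc d)" unfolding Q'_def by (intro mats_intro mats_elem mats_mono[OF Qm]) auto
    show "adj Q' * Q' = Id (Suc d)" "Q' * adj Q' = Id (Suc d)"
      using Q(1) unfolding Q'_def unitary_def
      by (auto simp: adj_plus distrib_left distrib_right Qe elem_times_elem Id_Suc)
  qed
  define x' where "x' = x(d := y)"
  have D': "Diag (Suc d) (\<lambda>i. complex_of_real (x' i)) = Diag d (\<lambda>i. complex_of_real (x i)) + cscale \<mu> (elem d d)"
    by (rule fmat_eqI) (auto simp: x'_def y)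
  have De: "Diag d f * elem d d = 0" "elem d d * Diag d f = 0" for f
    by (auto intro!: fmat_eqI simp: entry_times_elem entry_elem_times)
  have "Q' * Diag (Suc d) (\<lambda>i. complex_of_real (x' i)) * adj Q' = H'"
    unfolding D' Q'_def H'M Q(2)
    by (simp add: adj_plus distrib_left distrib_right Qe De elem_times_elem mult.assoc)
  then have "H = (W * Q') * Diag (Suc d) (\<lambda>i. complex_of_real (x' i)) * adj (W * Q')"
  proof -
    assume *: "Q' * Diag (Suc d) (\<lambda>i. complex_of_real (x' i)) * adj Q' = H'"
    have "H = (W * W) * H * (W * W)" unfolding WW using Suc(3) by simp
    also have "\<dots> = W * H' * W" unfolding H'_def by (simp add: mult.assoc)
    also have "\<dots> = (W * Q') * Diag (Suc d) (\<lambda>i. complex_of_real (x' i)) * adj (W * Q')"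
      unfolding *[symmetric] by (simp add: adj_times W mult.assoc)
    finally show ?thesis .
  qed
  then show ?case using unitary_times[OF W(1) Q'] by (intro Suc(2)) auto
qed

definition projector :: "nat \<Rightarrow> fmat \<Rightarrow> bool" where
  "projector d p \<longleftrightarrow> p \<in> mats d d \<and> adj p = p \<and> p * p = p"

text \<open>
  In an eigenbasis of \<open>p\<close> the matrix is diagonal with entries \<open>1\<close> and \<open>s\<close>; the multiplicity \<open>r\<close>
  of \<open>s\<close> is the rank of \<open>p\<close>.
\<close>

lemma projector_dt:
  assumes "projector d p"
  obtains r :: nat where "tr p = of_nat r" "\<And>s. dt d (Id d - p + cscale s p) = s ^ r"
proof -
  obtain Q x where Q: "unitary d Q" "p = Q * Diag d (\<lambda>i. complex_of_real (x i)) * adj Q"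
    using spectral_theorem[of p d] assms unfolding projector_def by metis
  define D where "D = Diag d (\<lambda>i. complex_of_real (x i))"
  have Qm: "Q \<in> mats d d" "adj Q * Q = Id d" "Q * adj Q = Id d" using Q by (auto simp: unitary_def)
  have "D = (adj Q * Q) * D * (adj Q * Q)" unfolding Qm D_def by (simp add: Id_times[OF mats_Diag] times_Id[OF mats_Diag])
  also have "\<dots> = adj Q * p * Q" unfolding Q(2) D_def by (simp add: mult.assoc)
  finally have Dp: "D = adj Q * p * Q" .
  have pm: "p \<in> mats d d" "p * p = p" using assms by (auto simp: projector_def)
  have "D * D = adj Q * (p * (Q * adj Q) * p) * Q" unfolding Dp by (simp add: mult.assoc)
  also have "\<dots> = D" unfolding Dp Qm times_Id[OF pm(1)] pm ..
  finally have DD: "D * D = D" .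
  have x01: "x i = 0 \<or> x i = 1" if "i < d" for i
  proof -
    have "entry (D * D) i i = entry D i i" by (simp only: DD)
    then have "complex_of_real (x i) * complex_of_real (x i) = complex_of_real (x i)"
      using that by (simp add: D_def entry_Diag_times del: mult_cancel_left1 mult_cancel_right1)
    then have "x i * x i = x i" by (metis of_real_mult of_real_eq_iff)
    then show ?thesis by simp
  qed
  define r where "r = card ({..<d} \<inter> {i. x i = 1})"
  have "tr p = tr D" unfolding Dp using assms Qm
    by (metis Q(2) D_def Dp mult.assoc tr_times_commute times_Id mats_Diag)
  also have "\<dots> = (\<Sum>i<d. if x i = 1 then 1 else 0)"
    unfolding D_def tr_Diag using x01 by (intro sum.cong) auto
  also have "\<dots> = of_nat r" by (simp add: r_def sum.If_cases)
  finally have tr: "tr p = of_nat r" .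
  have "dt d (Id d - p + cscale s p) = s ^ r" for s
  proof -
    have "Id d - p + cscale s p = Q * (Id d - D + cscale s D) * adj Q"
      unfolding Q(2) D_def[symmetric] using Qm
      by (simp add: distrib_left distrib_right right_diff_distrib left_diff_distrib times_Id)
    also have "Id d - D + cscale s D = Diag d (\<lambda>i. if x i = 1 then s else 1)"
      unfolding D_def using x01 by (intro fmat_eqI) auto
    finally have "dt d (Id d - p + cscale s p) = dt d Q * (\<Prod>i<d. if x i = 1 then s else 1) * cnj (dt d Q)"
      using Qm by (simp add: dt_times dt_Diag dt_adj mats_intro mats_times[of Q d d])
    also have "(\<Prod>i<d. if x i = 1 then s else 1) = s ^ r"
      by (simp add: r_def prod.If_cases)
    also have "dt d Q * s ^ r * cnj (dt d Q) = s ^ r * (dt d Q * cnj (dt d Q))" by simp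
    also have "dt d Q * cnj (dt d Q) = 1"
      using unitary_dt[OF Q(1)] by (simp flip: complex_norm_square)
    finally show ?thesis by simp
  qed
  with tr show ?thesis using that by blast
qed

text \<open>
  Conjugation by \<open>Id - p + s p\<close> multiplies the off-diagonal block \<open>\<nu>\<close> by \<open>1 / s\<close>, so the determinant
  does not change when \<open>\<nu>\<close> is shrunk to zero.
\<close>

lemma dt_unipotent:
  assumes p: "projector d p" and \<nu>: "\<nu> \<in> mats d d" "p * \<nu> = 0" "\<nu> * p = \<nu>"
  shows "dt d (Id d + \<nu>) = 1"
proof -
  have pm: "p \<in> mats d d" "p * p = p" using p by (auto simp: projector_def)
  define D where "D s = Id d - p + cscale s p" for s
  have Dm: "D s \<in> mats d d" for s unfolding D_def using pm by (intro mats_intro)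
  obtain r where r: "\<And>s. dt d (D s) = s ^ r" using projector_dt[OF p] unfolding D_def by metis
  have "dt d (Id d + cscale (1 / s) \<nu>) = dt d (Id d + \<nu>)" if "s \<noteq> 0" for s
  proof -
    have "D s * (Id d + \<nu>) * D (1 / s) = Id d + cscale (1 / s) \<nu>"
      unfolding D_def using pm \<nu> that
      by (simp add: algebra_simps Id_times[OF mats_Diag] times_Id[OF mats_Diag] Id_times[of _ d d] times_Id[of _ d d] cscale_plus cscale_minus)
    then have "dt d (Id d + cscale (1 / s) \<nu>) = dt d (D s) * dt d (Id d + \<nu>) * dt d (D (1 / s))"
      using Dm \<nu> by (metis dt_times)
    then show ?thesis using that by (simp add: r field_simps)
  qed
  then have "(\<lambda>n. dt d (Id d + cscale (1 / of_nat (Suc n)) \<nu>)) = (\<lambda>n. dt d (Id d + \<nu>))"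
    by (metis of_nat_Suc of_nat_neq_0)
  moreover have "(\<lambda>n. dt d (Id d + cscale (1 / of_nat (Suc n)) \<nu>)) \<longlonglongrightarrow> dt d (Id d + 0)"
  proof (intro tendsto_intros)
    have "(\<lambda>n. inverse (real (Suc n)) *\<^sub>R \<nu>) \<longlonglongrightarrow> 0 *\<^sub>R \<nu>"
      by (intro tendsto_intros LIMSEQ_inverse_real_of_nat)
    moreover have "cscale (1 / of_nat (Suc n)) \<nu> = inverse (real (Suc n)) *\<^sub>R \<nu>" for n
      by (simp add: cscale_of_real[symmetric] divide_inverse)
    ultimately show "(\<lambda>n. cscale (1 / of_nat (Suc n)) \<nu>) \<longlonglongrightarrow> 0" by simp
  qed
  ultimately show ?thesis by (simp add: LIMSEQ_const_iff)
qed

section \<open>Capacity of a tight frame\<close>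

lemma norm_sq_row:
  assumes "r \<in> mats k d"
  shows "entry (r * adj r) a a = of_real (\<Sum>j<d. (cmod (entry r a j))\<^sup>2)"
  using assms by (subst entry_times_mats[of _ k d]) (auto simp: complex_norm_square simp del: of_real_power)

lemma norm_sq_col:
  assumes "r \<in> mats k d"
  shows "entry (adj r * r) j j = of_real (\<Sum>a<k. (cmod (entry r a j))\<^sup>2)"
  using norm_sq_row[OF mats_adj[OF assms], of j] by simp

text \<open>
  The best \<open>C\<close> has as its row space the image under \<open>G\<close> of the row space of \<open>T\<close>; then the squared
  modulus of the determinant is the determinant of the compression of \<open>adj G * G\<close> to the row space of \<open>T\<close>. In
  an eigenbasis of this compression, each of its eigenvalues is an average of the eigenvalues \<open>x j\<close>
  of \<open>adj G * G\<close>, and concavity of the logarithm bounds its logarithm from below.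
\<close>

lemma isometry_compression_det:
  assumes T: "T \<in> mats k d" "T * adj T = Id k" and G: "G \<in> mats d d"
    and Q: "unitary d Q" and GQ: "adj G * G = Q * Diag d (\<lambda>i. complex_of_real (x i)) * adj Q"
    and x: "\<And>j. j < d \<Longrightarrow> x j > 0"
  obtains C where "C \<in> mats k d" "C * adj C = Id k" "dt k (C * G * adj T) \<noteq> 0"
    "(\<Sum>j<d. ln (x j) * Re (entry (adj Q * (adj T * T) * Q) j j)) \<le> 2 * ln (cmod (dt k (C * G * adj T)))"
proof -
  have Qm: "Q \<in> mats d d" "adj Q * Q = Id d" "Q * adj Q = Id d" using Q by (auto simp: unitary_def)
  define M where "M = T * (adj G * G) * adj T"
  have M: "M \<in> mats k k" "adj M = M" unfolding M_def using T G by (auto intro!: mats_intro simp: adj_times mult.assoc)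
  obtain W \<mu> where W: "unitary k W" and MW: "M = W * Diag k (\<lambda>i. complex_of_real (\<mu> i)) * adj W"
    using spectral_theorem[OF M] by metis
  have Wm: "W \<in> mats k k" "adj W * W = Id k" "W * adj W = Id k" using W by (auto simp: unitary_def)
  define D where "D = Diag k (\<lambda>i. complex_of_real (\<mu> i))"
  have DM: "D = adj W * M * W"
  proof -
    have "adj W * M * W = (adj W * W) * D * (adj W * W)" unfolding MW D_def by (simp add: mult.assoc)
    also have "\<dots> = D" unfolding Wm D_def by (simp add: Id_times[OF mats_Diag] times_Id[OF mats_Diag])
    finally show ?thesis ..
  qed
  define r where "r = adj W * T * Q"
  have rm: "r \<in> mats k d" unfolding r_def using Wm Qm T by (intro mats_intro)
  have "r * adj r = adj W * (T * (Q * adj Q) * adj T) * W"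
    unfolding r_def by (simp add: adj_times mult.assoc)
  then have rr: "r * adj r = Id k" unfolding Qm using T Wm by (simp add: times_Id[OF T(1)] mult.assoc)
  have r1: "(\<Sum>j<d. (cmod (entry r a j))\<^sup>2) = 1" if "a < k" for a
    using arg_cong[OF rr, of "\<lambda>A. entry A a a"] that unfolding norm_sq_row[OF rm] by (simp flip: of_real_power of_real_sum)
  have rxr: "r * Diag d (\<lambda>i. complex_of_real (x i)) * adj r = D"
    unfolding r_def DM M_def GQ by (simp add: adj_times mult.assoc)
  have \<mu>: "\<mu> a = (\<Sum>j<d. (cmod (entry r a j))\<^sup>2 * x j)" if "a < k" for a
  proof -
    have "entry (r * Diag d (\<lambda>i. complex_of_real (x i)) * adj r) a a
      = (\<Sum>j<d. entry r a j * complex_of_real (x j) * cnj (entry r a j))"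
      using rm by (subst entry_times_mats[of _ k d]) (auto simp: entry_times_Diag intro!: mats_intro)
    also have "\<dots> = of_real (\<Sum>j<d. (cmod (entry r a j))\<^sup>2 * x j)"
      by (simp add: complex_norm_square mult_ac del: of_real_power)
    finally show ?thesis using that unfolding rxr D_def by (simp add: of_real_eq_iff del: of_real_sum)
  qed
  have \<mu>pos: "\<mu> a > 0" if "a < k" for a
  proof -
    have nn: "0 \<le> (cmod (entry r a j))\<^sup>2 * x j" if "j \<in> {..<d}" for j
      using x[of j] that by (intro mult_nonneg_nonneg) auto
    have "0 \<le> \<mu> a" unfolding \<mu>[OF that] by (intro sum_nonneg nn)
    moreover have "\<mu> a \<noteq> 0"
    proof
      assume "\<mu> a = 0"
      then have "\<forall>j\<in>{..<d}. (cmod (entry r a j))\<^sup>2 * x j = 0"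
        unfolding \<mu>[OF that] by (subst (asm) sum_nonneg_eq_0_iff) (auto intro: nn)
      then have "\<forall>j\<in>{..<d}. (cmod (entry r a j))\<^sup>2 = 0" using x by force
      then have "(\<Sum>j<d. (cmod (entry r a j))\<^sup>2) = 0" by (intro sum.neutral)
      then show False using r1[OF that] by linarith
    qed
    ultimately show ?thesis by simp
  qed
  have ln\<mu>: "(\<Sum>j<d. (cmod (entry r a j))\<^sup>2 * ln (x j)) \<le> ln (\<mu> a)" if a: "a < k" for a
  proof -
    \<comment> \<open>Jensen's inequality, through the tangent of the logarithm at the mean \<open>\<mu> a\<close>.\<close>
    have "ln (x j) \<le> ln (\<mu> a) + (x j / \<mu> a - 1)" if "j < d" for j
    proof -
      have "ln (x j / \<mu> a) \<le> x j / \<mu> a - 1" using x[OF that] \<mu>pos[OF a] by (intro ln_le_minus_one) simp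
      then show ?thesis using x[OF that] \<mu>pos[OF a] by (simp add: ln_div)
    qed
    then have "(\<Sum>j<d. (cmod (entry r a j))\<^sup>2 * ln (x j))
      \<le> (\<Sum>j<d. (cmod (entry r a j))\<^sup>2 * (ln (\<mu> a) + (x j / \<mu> a - 1)))"
      by (intro sum_mono mult_left_mono) auto
    also have "\<dots> = (\<Sum>j<d. (cmod (entry r a j))\<^sup>2) * (ln (\<mu> a) - 1) + (\<Sum>j<d. (cmod (entry r a j))\<^sup>2 * x j) / \<mu> a"
      by (simp add: sum_distrib_left sum_distrib_right sum_divide_distrib algebra_simps sum.distrib sum_subtractf)
    also have "\<dots> = ln (\<mu> a)" unfolding r1[OF a] \<mu>[OF a, symmetric] using \<mu>pos[OF a] by simp
    finally show ?thesis .
  qed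
  \<comment> \<open>The inverse square root of the compression makes the rows of \<open>T * adj G\<close> orthonormal.\<close>
  define S where "S = Diag k (\<lambda>a. complex_of_real (1 / sqrt (\<mu> a)))"
  define C where "C = S * adj W * T * adj G"
  have Cm: "C \<in> mats k d" unfolding C_def S_def using Wm T G by (auto intro!: mats_intro)
  have adjS: "adj S = S" by (simp add: S_def adj_Diag)
  have sqrt: "complex_of_real (sqrt (\<mu> a)) * complex_of_real (sqrt (\<mu> a)) = complex_of_real (\<mu> a)" if "a < k" for a
    using \<mu>pos[OF that] by (simp flip: of_real_mult)
  have SD: "S * D = Diag k (\<lambda>a. complex_of_real (sqrt (\<mu> a)))"
    using \<mu>pos by (intro fmat_eqI) (auto simp: S_def D_def entry_Diag_times real_div_sqrt less_imp_le simp flip: of_real_mult of_real_divide)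
  have "C * adj C = S * (adj W * M * W) * S"
    unfolding C_def M_def by (simp add: adj_times adjS mult.assoc)
  also have "\<dots> = S * D * S" unfolding DM ..
  also have "\<dots> = Id k" unfolding SD
    using \<mu>pos by (intro fmat_eqI) (auto simp: S_def entry_Diag_times dest!: \<mu>pos)
  finally have CC: "C * adj C = Id k" .
  have "C * G * adj T = S * adj W * M" unfolding C_def M_def by (simp add: mult.assoc)
  also have "\<dots> = S * adj W * M * (W * adj W)" unfolding Wm times_Id[OF M(1)] using times_Id[OF M(1)] by (simp add: mult.assoc)
  also have "\<dots> = S * D * adj W" unfolding DM by (simp add: mult.assoc)
  finally have "C * G * adj T = S * D * adj W" .
  then have "cmod (dt k (C * G * adj T)) = cmod (\<Prod>a<k. complex_of_real (sqrt (\<mu> a))) * cmod (dt k (adj W))"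
    unfolding SD by (simp add: dt_times dt_Diag norm_mult)
  also have "\<dots> = (\<Prod>a<k. sqrt (\<mu> a))"
    using unitary_dt[OF W] \<mu>pos by (simp add: dt_adj prod_norm[symmetric] less_imp_le)
  finally have dtC: "cmod (dt k (C * G * adj T)) = (\<Prod>a<k. sqrt (\<mu> a))" .
  then have pos: "cmod (dt k (C * G * adj T)) > 0" using \<mu>pos by (auto intro!: prod_pos)
  have "2 * ln (cmod (dt k (C * G * adj T))) = (\<Sum>a<k. 2 * ln (sqrt (\<mu> a)))"
    unfolding dtC by (subst ln_prod) (auto simp: sum_distrib_left dest: \<mu>pos)
  also have "\<dots> = (\<Sum>a<k. ln (\<mu> a))" by (intro sum.cong refl) (use \<mu>pos in \<open>auto simp: sqrt_def ln_root\<close>)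
  also have "\<dots> \<ge> (\<Sum>a<k. \<Sum>j<d. (cmod (entry r a j))\<^sup>2 * ln (x j))"
    by (intro sum_mono ln\<mu>) simp
  also have "(\<Sum>a<k. \<Sum>j<d. (cmod (entry r a j))\<^sup>2 * ln (x j)) = (\<Sum>j<d. ln (x j) * (\<Sum>a<k. (cmod (entry r a j))\<^sup>2))"
    by (subst sum.swap) (simp add: sum_distrib_left mult.commute)
  also have "\<dots> = (\<Sum>j<d. ln (x j) * Re (entry (adj r * r) j j))"
    unfolding norm_sq_col[OF rm] by simp
  also have "adj r * r = adj Q * (adj T * (W * adj W) * T) * Q" unfolding r_def by (simp add: adj_times mult.assoc)
  also have "\<dots> = adj Q * (adj T * T) * Q" unfolding Wm using T by (simp add: mult.assoc Id_times[OF mats_times_same])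
  finally show ?thesis using that[OF Cm CC] pos by simp
qed

text \<open>
  For a tight frame the weights in the previous bound add up to the frame constant for every
  eigenvalue, so the bound becomes a lower bound by a power of the determinant of \<open>G\<close>: the capacity
  of a tight frame is positive.
\<close>

lemma tight_frame_capacity:
  assumes T: "\<And>i. i < N \<Longrightarrow> T i \<in> mats (k i) d" "\<And>i. i < N \<Longrightarrow> T i * adj (T i) = Id (k i)"
    and tight: "(\<Sum>i<N. adj (T i) * T i) = c *\<^sub>R Id d"
    and G: "G \<in> mats d d" "dt d G \<noteq> 0"
  obtains C where "\<And>i. i < N \<Longrightarrow> C i \<in> mats (k i) d" "\<And>i. i < N \<Longrightarrow> C i * adj (C i) = Id (k i)"
    "\<And>i. i < N \<Longrightarrow> dt (k i) (C i * G * adj (T i)) \<noteq> 0"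
    "c * ln (cmod (dt d G)) \<le> (\<Sum>i<N. ln (cmod (dt (k i) (C i * G * adj (T i)))))"
proof -
  have H: "adj G * G \<in> mats d d" "adj (adj G * G) = adj G * G" using G by (auto intro!: mats_intro simp: adj_times)
  obtain Q x where Q: "unitary d Q" and GQ: "adj G * G = Q * Diag d (\<lambda>i. complex_of_real (x i)) * adj Q"
    using spectral_theorem[OF H] by metis
  have Qm: "Q \<in> mats d d" "adj Q * Q = Id d" "Q * adj Q = Id d" using Q by (auto simp: unitary_def)
  have "adj (G * Q) * (G * Q) = adj Q * (adj G * G) * Q" by (simp add: adj_times mult.assoc)
  also have "\<dots> = (adj Q * Q) * Diag d (\<lambda>i. complex_of_real (x i)) * (adj Q * Q)" unfolding GQ by (simp add: mult.assoc)
  also have "\<dots> = Diag d (\<lambda>i. complex_of_real (x i))" unfolding Qm by (simp add: Id_times[OF mats_Diag] times_Id[OF mats_Diag])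
  finally have GQ': "adj (G * Q) * (G * Q) = Diag d (\<lambda>i. complex_of_real (x i))" .
  have GQm: "G * Q \<in> mats d d" using G Qm by (intro mats_intro)
  have x0: "x j \<ge> 0" if "j < d" for j
  proof -
    have "complex_of_real (x j) = of_real (\<Sum>a<d. (cmod (entry (G * Q) a j))\<^sup>2)"
      using that norm_sq_col[OF GQm, of j] unfolding GQ' by simp
    then have "x j = (\<Sum>a<d. (cmod (entry (G * Q) a j))\<^sup>2)" unfolding of_real_eq_iff .
    then show ?thesis by (simp add: sum_nonneg)
  qed
  have "dt d (adj G * G) = (\<Prod>j<d. complex_of_real (x j)) * (dt d Q * cnj (dt d Q))"
    unfolding GQ using Qm by (simp add: dt_times dt_Diag dt_adj mats_intro)
  also have "dt d Q * cnj (dt d Q) = 1" using unitary_dt[OF Q] by (simp flip: complex_norm_square)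
  finally have "cnj (dt d G) * dt d G = (\<Prod>j<d. complex_of_real (x j))"
    using G by (simp add: dt_times dt_adj)
  then have "cmod (cnj (dt d G) * dt d G) = cmod (\<Prod>j<d. complex_of_real (x j))" by (rule arg_cong)
  then have dtx: "(cmod (dt d G))\<^sup>2 = (\<Prod>j<d. x j)"
    using x0 by (simp add: norm_mult power2_eq_square prod_norm[symmetric])
  have x: "x j > 0" if "j < d" for j
  proof -
    have "(\<Prod>j<d. x j) \<noteq> 0" using dtx G(2) by (metis norm_eq_zero power_eq_0_iff)
    then have "x j \<noteq> 0" using that by (metis finite_lessThan lessThan_iff prod_zero_iff)
    then show ?thesis using x0[OF that] by simp
  qed
  define P where "P i C \<longleftrightarrow> C \<in> mats (k i) d \<and> C * adj C = Id (k i) \<and> dt (k i) (C * G * adj (T i)) \<noteq> 0 \<and>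
    (\<Sum>j<d. ln (x j) * Re (entry (adj Q * (adj (T i) * T i) * Q) j j)) \<le> 2 * ln (cmod (dt (k i) (C * G * adj (T i))))"
    for i C
  have "\<exists>C. P i C" if "i < N" for i
    by (rule isometry_compression_det[OF T(1)[OF that] T(2)[OF that] G(1) Q GQ x]) (unfold P_def, blast+)
  then obtain C where CP: "\<And>i. i < N \<Longrightarrow> P i (C i)" by metis
  have C: "C i \<in> mats (k i) d" "C i * adj (C i) = Id (k i)" "dt (k i) (C i * G * adj (T i)) \<noteq> 0"
    "(\<Sum>j<d. ln (x j) * Re (entry (adj Q * (adj (T i) * T i) * Q) j j))
      \<le> 2 * ln (cmod (dt (k i) (C i * G * adj (T i))))" if "i < N" for i
    using CP[OF that] unfolding P_def by blast+
  have "c * (2 * ln (cmod (dt d G))) = c * (\<Sum>j<d. ln (x j))"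
  proof -
    have "2 * ln (cmod (dt d G)) = ln ((cmod (dt d G))\<^sup>2)" using G(2) by (simp add: ln_realpow)
    also have "\<dots> = (\<Sum>j<d. ln (x j))" unfolding dtx by (subst ln_prod) (auto dest: x)
    finally show ?thesis by simp
  qed
  also have "\<dots> = (\<Sum>j<d. ln (x j) * Re (entry (adj Q * (\<Sum>i<N. adj (T i) * T i) * Q) j j))"
    unfolding tight using Qm by (simp add: sum_distrib_left mult.commute times_Id[OF mats_adj])
  also have "\<dots> = (\<Sum>i<N. \<Sum>j<d. ln (x j) * Re (entry (adj Q * (adj (T i) * T i) * Q) j j))"
    by (subst sum.swap) (simp add: sum_distrib_left sum_distrib_right)
  also have "\<dots> \<le> (\<Sum>i<N. 2 * ln (cmod (dt (k i) (C i * G * adj (T i)))))"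
    by (intro sum_mono C(4)) simp
  finally have "c * ln (cmod (dt d G)) \<le> (\<Sum>i<N. ln (cmod (dt (k i) (C i * G * adj (T i)))))"
    by (simp flip: sum_distrib_left)
  then show ?thesis using that C by blast
qed

section \<open>Entire matrix functions\<close>

lemma holomorphic_eq_at_0:
  assumes "f holomorphic_on UNIV" "g holomorphic_on UNIV" "\<And>w. w \<noteq> 0 \<Longrightarrow> f w = g w"
  shows "f w = g (w :: complex)"
proof (cases "w = 0")
  case True
  have "(f \<longlongrightarrow> f 0) (at 0)" "(g \<longlongrightarrow> g 0) (at 0)"
    using assms(1,2)[THEN holomorphic_on_imp_continuous_on] by (auto simp: continuous_on_def)
  moreover have "(f \<longlongrightarrow> g 0) (at 0)"
    using \<open>(g \<longlongrightarrow> g 0) (at 0)\<close>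
    by (rule Lim_transform_eventually) (auto simp: eventually_at_filter assms(3))
  ultimately have "f 0 = g 0" using tendsto_unique[OF trivial_limit_at] by blast
  then show ?thesis using True by simp
qed (rule assms(3))

definition entire :: "nat \<Rightarrow> nat \<Rightarrow> (complex \<Rightarrow> fmat) \<Rightarrow> bool" where
  "entire m n F \<longleftrightarrow> (\<forall>w. F w \<in> mats m n) \<and> (\<forall>i j. (\<lambda>w. entry (F w) i j) holomorphic_on UNIV)"

lemma entire_mats: "entire m n F \<Longrightarrow> F w \<in> mats m n"
  unfolding entire_def by blast

lemma entire_const: "A \<in> mats m n \<Longrightarrow> entire m n (\<lambda>_. A)"
  unfolding entire_def by (auto intro: holomorphic_intros)

lemma entire_plus: "entire m n F \<Longrightarrow> entire m n G \<Longrightarrow> entire m n (\<lambda>w. F w + G w)"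
  unfolding entire_def by (auto intro!: holomorphic_intros mats_intro)

lemma entire_minus: "entire m n F \<Longrightarrow> entire m n G \<Longrightarrow> entire m n (\<lambda>w. F w - G w)"
  unfolding entire_def by (auto intro!: holomorphic_intros mats_intro)

lemma entire_sum: "(\<And>x. x \<in> S \<Longrightarrow> entire m n (F x)) \<Longrightarrow> entire m n (\<lambda>w. \<Sum>x\<in>S. F x w)"
  unfolding entire_def by (auto intro!: holomorphic_intros mats_intro)

lemma entire_cscale: "f holomorphic_on UNIV \<Longrightarrow> entire m n F \<Longrightarrow> entire m n (\<lambda>w. cscale (f w) (F w))"
  unfolding entire_def by (auto intro!: holomorphic_intros mats_intro)

lemma entire_times: "entire m n F \<Longrightarrow> entire n k G \<Longrightarrow> entire m k (\<lambda>w. F w * G w)"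
  unfolding entire_def
  by (auto intro!: holomorphic_intros mats_intro simp: entry_times_mats[of _ m n _ k])

lemmas entire_intros = entire_const entire_plus entire_minus entire_sum entire_cscale entire_times

lemma entire_dt: "entire m n F \<Longrightarrow> (\<lambda>w. dt k (F w)) holomorphic_on UNIV"
  unfolding entire_def by (intro holomorphic_dt) blast

lemma entire_bounded:
  assumes "entire m n F"
  obtains K where "K > 0" "\<And>w. cmod w \<le> R \<Longrightarrow> norm (F w) \<le> K"
proof -
  have "\<exists>B. \<forall>w. cmod w \<le> R \<longrightarrow> cmod (entry (F w) i j) \<le> B" for i j
  proof -
    have "continuous_on (cball 0 R) (\<lambda>w. entry (F w) i j)"
      using assms unfolding entire_def by (meson holomorphic_on_imp_continuous_on continuous_on_subset subset_UNIV)
    then have "bounded ((\<lambda>w. entry (F w) i j) ` cball 0 R)"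
      by (intro compact_imp_bounded compact_continuous_image) auto
    then obtain B where "\<forall>y\<in>(\<lambda>w. entry (F w) i j) ` cball 0 R. cmod y \<le> B" unfolding bounded_iff by blast
    then show ?thesis by (intro exI[of _ B]) auto
  qed
  then obtain B where B: "\<And>i j w. cmod w \<le> R \<Longrightarrow> cmod (entry (F w) i j) \<le> B i j" by metis
  define K2 where "K2 = (\<Sum>i<m. \<Sum>j<n. (B i j)\<^sup>2)"
  have "norm (F w) \<le> sqrt K2 + 1" if "cmod w \<le> R" for w
  proof -
    have "(norm (F w))\<^sup>2 = (\<Sum>i<m. \<Sum>j<n. (cmod (entry (F w) i j))\<^sup>2)"
      using entire_mats[OF assms, of w] by (intro norm_fmat_sq) (auto simp: entry_mats)
    also have "\<dots> \<le> K2" unfolding K2_def using B[OF that] by (intro sum_mono power_mono) auto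
    finally show ?thesis using real_le_rsqrt by fastforce
  qed
  moreover have "sqrt K2 + 1 > 0" unfolding K2_def by (intro add_nonneg_pos real_sqrt_ge_zero sum_nonneg) auto
  ultimately show ?thesis using that by blast
qed

text \<open>
  Blaschke-Potapov factorisation at the origin. If \<open>G 0\<close> is singular, a unit vector \<open>v\<close> is orthogonal
  to its range; dividing the component of \<open>G\<close> along \<open>v\<close> by \<open>w\<close> keeps \<open>G\<close> entire, lowers the order of
  vanishing of the determinant by one and multiplies \<open>G\<close> by a unitary matrix on the unit circle.
\<close>

lemma blaschke_potapov:
  assumes "entire d d G" "u holomorphic_on UNIV" "\<And>w. dt d (G w) = w ^ m * u w"
  obtains G' where "entire d d G'" "\<And>w. dt d (G' w) = u w"
    "\<And>w. cmod w = 1 \<Longrightarrow> \<exists>U. unitary d U \<and> G' w = U * G w"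
  using assms
proof (induction m arbitrary: G thesis)
  case 0
  have "\<exists>U. unitary d U \<and> G w = U * G w" for w
    using entire_mats[OF 0(2), of w] by (intro exI[of _ "Id d"]) auto
  then show ?case using 0 by auto
next
  case (Suc m)
  have Gm: "G w \<in> mats d d" for w using entire_mats[OF Suc(3)] .
  have "dt d (adj (G 0)) = 0" using Suc(5)[of 0] by (simp add: dt_adj)
  then obtain v' where v': "v' \<in> mats d 1" "v' \<noteq> 0" "adj (G 0) * v' = 0"
    using dt_zero_kernel[of "adj (G 0)" d] Gm by (metis mats_adj)
  define v where "v = (1 / norm v') *\<^sub>R v'"
  have v: "v \<in> mats d 1" "norm v = 1" "adj (G 0) * v = 0" using v' by (auto simp: v_def mats_intro)
  define p where "p = v * adj v"
  have vv: "adj v * v = Id 1" using adj_times_self_vec[OF v(1)] v(2) by simp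
  have pm: "p \<in> mats d d" unfolding p_def using v by (intro mats_intro)
  have pp: "p * p = p"
  proof -
    have "p * p = v * (adj v * v) * adj v" by (simp add: p_def mult.assoc)
    then show ?thesis unfolding vv using v by (simp add: p_def)
  qed
  have pa: "adj p = p" by (simp add: p_def adj_times)
  have proj: "projector d p" using pm pp pa by (simp add: projector_def)
  have pG0: "p * G 0 = 0"
    using arg_cong[OF v(3), of adj] by (simp add: p_def adj_times mult.assoc)
  have trp: "tr p = 1" unfolding p_def by (subst tr_times_commute) (simp add: vv)
  obtain r where r: "tr p = of_nat r" "\<And>s. dt d (Id d - p + cscale s p) = s ^ r" using projector_dt[OF proj] by blast
  have r1: "r = 1" using r(1) trp by (metis of_nat_1 of_nat_eq_iff)
  define f where "f i j w = entry (p * G w) i j" for i j w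
  have pG: "entire d d (\<lambda>w. p * G w)" using Suc(3) pm by (intro entire_intros)
  have f0: "f i j 0 = 0" for i j by (simp add: f_def pG0)
  \<comment> \<open>The entries of \<open>p * G w / w\<close>, whose singularity at \<open>0\<close> is removable.\<close>
  define g where "g i j w = (if w = 0 then deriv (f i j) 0 else (f i j w - f i j 0) / (w - 0))" for i j w
  have gh: "g i j holomorphic_on UNIV" for i j
    unfolding g_def using pG by (intro pole_lemma) (auto simp: entire_def f_def[abs_def])
  define E where "E w = Fmat (\<lambda>i j. if i < d \<and> j < d then g i j w else 0)" for w
  have eE: "entry (E w) i j = (if i < d \<and> j < d then g i j w else 0)" for w i j
    unfolding E_def by (subst entry_Fmat[of d]) auto
  have "(\<lambda>w. if i < d \<and> j < d then g i j w else 0) holomorphic_on UNIV" for i j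
    using gh by (cases "i < d"; cases "j < d") auto
  then have Ee: "entire d d E"
    unfolding entire_def by (auto intro!: matsI simp: eE)
  have Ew: "E w = cscale (1 / w) (p * G w)" if "w \<noteq> 0" for w
    using that entire_mats[OF Ee] entire_mats[OF pG]
    by (intro mats_eqI[of _ d d]) (auto intro: mats_intro simp: eE g_def f0 f_def[of _ _ w])
  define G' where "G' w = (G w - p * G w) + E w" for w
  have G'e: "entire d d G'" unfolding G'_def using Suc(3) pG Ee pm by (intro entire_intros)
  have G'w: "G' w = (Id d - p + cscale (1 / w) p) * G w" if "w \<noteq> 0" for w
    unfolding G'_def Ew[OF that] by (simp add: distrib_right left_diff_distrib Id_times[OF Gm])
  have fm: "Id d - p + cscale s p \<in> mats d d" for s using pm by (intro mats_intro)
  have dtG': "dt d (G' w) = w ^ m * u w" if "w \<noteq> 0" for w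
    unfolding G'w[OF that] using fm Suc(5)[of w] that by (simp add: dt_times r(2) r1)
  have dtG'': "dt d (G' w) = w ^ m * u w" for w
  proof (rule holomorphic_eq_at_0[where f = "\<lambda>w. dt d (G' w)" and g = "\<lambda>w. w ^ m * u w"])
    show "(\<lambda>w. dt d (G' w)) holomorphic_on UNIV" by (rule entire_dt[OF G'e])
    show "(\<lambda>w. w ^ m * u w) holomorphic_on UNIV" using Suc(4) by (intro holomorphic_intros)
  qed (rule dtG')
  obtain G'' where G'': "entire d d G''" "\<And>w. dt d (G'' w) = u w"
    "\<And>w. cmod w = 1 \<Longrightarrow> \<exists>U. unitary d U \<and> G'' w = U * G' w"
    using Suc(1)[OF _ G'e Suc(4) dtG''] by blast
  show ?case
  proof (rule Suc(2)[OF G''(1,2)])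
    fix w :: complex assume w: "cmod w = 1"
    define V where "V = Id d - p + cscale (1 / w) p"
    have w0: "w \<noteq> 0" using w by auto
    have ww: "1 / w * cnj (1 / w) = 1" "cnj (1 / w) * (1 / w) = 1" using w
      by (simp_all add: complex_norm_square[symmetric] mult.commute norm_divide del: complex_cnj_divide)
    have "unitary d V"
      unfolding unitary_def
    proof (intro conjI)
      show "V \<in> mats d d" unfolding V_def by (rule fm)
      have "adj V * V = Id d - p + cscale (cnj (1 / w) * (1 / w)) p"
        unfolding V_def using pm pp
        by (simp add: adj_simps pa algebra_simps Id_times[OF mats_Diag] Id_times[OF pm] times_Id[OF pm] cscale_plus cscale_minus del: complex_cnj_divide)
      then show "adj V * V = Id d" unfolding ww by simp
      have "V * adj V = Id d - p + cscale (1 / w * cnj (1 / w)) p"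
        unfolding V_def using pm pp
        by (simp add: adj_simps pa algebra_simps Id_times[OF mats_Diag] Id_times[OF pm] times_Id[OF pm] cscale_plus cscale_minus del: complex_cnj_divide)
      then show "V * adj V = Id d" unfolding ww by simp
    qed
    moreover obtain U where "unitary d U" "G'' w = U * G' w" using G''(3)[OF w] by blast
    ultimately show "\<exists>U. unitary d U \<and> G'' w = U * G w"
      using G'w[OF w0] unitary_times[of d U V] by (intro exI[of _ "U * V"]) (auto simp: V_def mult.assoc)
  qed
qed

section \<open>Laurent approximation on the unit circle\<close>

text \<open>
  On the unit circle the real and imaginary parts of \<open>w\<close> are \<open>(w + 1 / w) / 2\<close> and
  \<open>(w - 1 / w) / (2 \<i>)\<close>, so a polynomial in them is a Laurent polynomial in \<open>w\<close>.
\<close>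

lemma real_polynomial_laurent:
  fixes p :: "complex \<Rightarrow> real"
  assumes "real_polynomial_function p"
  obtains L q where "\<And>w. cmod w = 1 \<Longrightarrow> of_real (p w) * w ^ L = poly q w"
  using assms
proof (induction arbitrary: thesis)
  case (linear f)
  define q where "q = [:(of_real (f 1) + \<i> * of_real (f \<i>)) / 2, 0, (of_real (f 1) - \<i> * of_real (f \<i>)) / 2:]"
  show ?case
  proof (rule linear(2)[of 1 q])
    fix w :: complex assume w: "cmod w = 1"
    have cw: "cnj w * w = 1" using w by (simp add: mult.commute complex_norm_square[symmetric])
    have "f w = f (Re w *\<^sub>R 1 + Im w *\<^sub>R \<i>)" by (rule arg_cong[of _ _ f]) (simp add: complex_eq_iff)
    also have "\<dots> = Re w * f 1 + Im w * f \<i>"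
      by (simp only: linear_add[OF bounded_linear.linear[OF linear(1)]]
          linear_cmul[OF bounded_linear.linear[OF linear(1)]] real_scaleR_def)
    finally have A: "of_real (f w) * w = of_real (Re w) * w * of_real (f 1) + of_real (Im w) * w * of_real (f \<i>)"
      by (simp add: algebra_simps)
    have B: "of_real (Re w) * w = (w\<^sup>2 + 1) / 2"
      using cw by (simp add: complex_eq_iff power2_eq_square algebra_simps)
    have C: "of_real (Im w) * w = - \<i> * (w\<^sup>2 - 1) / 2"
      using cw by (simp add: complex_eq_iff power2_eq_square algebra_simps)
    have "of_real (f w) * w ^ 1 = (w\<^sup>2 + 1) / 2 * of_real (f 1) + - \<i> * (w\<^sup>2 - 1) / 2 * of_real (f \<i>)"
      by (simp only: power_one_right A B C)
    also have "\<dots> = poly q w" by (simp add: q_def power2_eq_square field_simps)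
    finally show "of_real (f w) * w ^ 1 = poly q w" .
  qed
next
  case (const c)
  show ?case by (rule const[of 0 "[:of_real c:]"]) simp
next
  case (add f g)
  obtain L q where 1: "\<And>w. cmod w = 1 \<Longrightarrow> of_real (f w) * w ^ L = poly q w" using add(3) by blast
  obtain L' q' where 2: "\<And>w. cmod w = 1 \<Longrightarrow> of_real (g w) * w ^ L' = poly q' w" using add(4) by blast
  show ?case
    by (rule add(5)[of "L + L'" "q * monom 1 L' + q' * monom 1 L"])
       (simp add: 1[symmetric] 2[symmetric] poly_monom power_add algebra_simps)
next
  case (mult f g)
  obtain L q where 1: "\<And>w. cmod w = 1 \<Longrightarrow> of_real (f w) * w ^ L = poly q w" using mult(3) by blast
  obtain L' q' where 2: "\<And>w. cmod w = 1 \<Longrightarrow> of_real (g w) * w ^ L' = poly q' w" using mult(4) by blast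
  show ?case
    by (rule mult(5)[of "L + L'" "q * q'"]) (simp add: 1[symmetric] 2[symmetric] power_add algebra_simps)
qed

lemma circle_inverse_power:
  assumes "cmod w = 1" "k \<le> L"
  shows "w ^ k / w ^ L = cnj (w ^ (L - k))"
proof -
  have w0: "w \<noteq> 0" using assms by auto
  have "cnj w * w = 1" using assms by (simp add: mult.commute complex_norm_square[symmetric])
  then have "cnj w = 1 / w" using w0 by (simp add: field_simps)
  moreover obtain m where "L = k + m" using assms(2) le_Suc_ex by blast
  ultimately show ?thesis using w0 by (simp add: power_add power_one_over)
qed

lemma laurent_approximation:
  fixes h :: "complex \<Rightarrow> real"
  assumes "continuous_on (sphere 0 1) h" "\<epsilon> > 0"
  obtains L q where "q holomorphic_on UNIV" "\<And>w. cmod w = 1 \<Longrightarrow> cmod (q w / w ^ L - of_real (h w)) < \<epsilon>"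
proof -
  obtain p where p: "real_polynomial_function p" "\<And>w. w \<in> sphere 0 1 \<Longrightarrow> \<bar>h w - p w\<bar> < \<epsilon>"
    using Stone_Weierstrass_real_polynomial_function[OF compact_sphere assms] by blast
  obtain L q where q: "\<And>w. cmod w = 1 \<Longrightarrow> of_real (p w) * w ^ L = poly q w"
    using real_polynomial_laurent[OF p(1)] by blast
  show ?thesis
  proof (rule that[of "poly q" L])
    show "poly q holomorphic_on UNIV" by (rule poly_holomorphic_on) (auto intro: holomorphic_intros)
    fix w :: complex assume w: "cmod w = 1"
    then have "w \<noteq> 0" by auto
    then have "poly q w / w ^ L = of_real (p w)" using q[OF w] by (auto simp: field_simps)
    then have "cmod (poly q w / w ^ L - of_real (h w)) = \<bar>p w - h w\<bar>"
      by (simp flip: of_real_diff)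
    then show "cmod (poly q w / w ^ L - of_real (h w)) < \<epsilon>" using p(2)[of w] w by (simp add: abs_minus_commute)
  qed
qed

text \<open>A real Laurent polynomial is the real part of a polynomial: reflect its negative powers.\<close>

lemma real_part_approximation:
  fixes h :: "complex \<Rightarrow> real"
  assumes "continuous_on (sphere 0 1) h" "\<epsilon> > 0"
  obtains f where "f holomorphic_on UNIV" "\<And>w. cmod w = 1 \<Longrightarrow> \<bar>Re (f w) - h w\<bar> < \<epsilon>"
proof -
  obtain p where p: "real_polynomial_function p" "\<And>w. w \<in> sphere 0 1 \<Longrightarrow> \<bar>h w - p w\<bar> < \<epsilon>"
    using Stone_Weierstrass_real_polynomial_function[OF compact_sphere assms] by blast
  obtain L q where q: "\<And>w. cmod w = 1 \<Longrightarrow> of_real (p w) * w ^ L = poly q w"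
    using real_polynomial_laurent[OF p(1)] by blast
  define f where "f w = (\<Sum>k\<le>degree q. if L \<le> k then coeff q k * w ^ (k - L) else cnj (coeff q k) * w ^ (L - k))" for w
  show ?thesis
  proof (rule that[of f])
    have "(\<lambda>w. if L \<le> k then coeff q k * w ^ (k - L) else cnj (coeff q k) * w ^ (L - k)) holomorphic_on UNIV" for k
      by (cases "L \<le> k") (auto intro!: holomorphic_intros)
    then show "f holomorphic_on UNIV" unfolding f_def by (intro holomorphic_intros)
    fix w :: complex assume w: "cmod w = 1"
    then have w0: "w \<noteq> 0" by auto
    have "of_real (p w) = poly q w / w ^ L" using q[OF w] w0 by (auto simp: field_simps)
    also have "\<dots> = (\<Sum>k\<le>degree q. coeff q k * (w ^ k / w ^ L))" by (simp add: poly_altdef sum_divide_distrib)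
    finally have "Re (of_real (p w)) = Re (\<Sum>k\<le>degree q. coeff q k * (w ^ k / w ^ L))" by (rule arg_cong)
    then have "p w = (\<Sum>k\<le>degree q. Re (coeff q k * (w ^ k / w ^ L)))" by simp
    also have "\<dots> = (\<Sum>k\<le>degree q. Re (if L \<le> k then coeff q k * w ^ (k - L) else cnj (coeff q k) * w ^ (L - k)))"
    proof (rule sum.cong[OF refl])
      fix k
      show "Re (coeff q k * (w ^ k / w ^ L)) = Re (if L \<le> k then coeff q k * w ^ (k - L) else cnj (coeff q k) * w ^ (L - k))"
      proof (cases "L \<le> k")
        case True
        then show ?thesis using w0 by (simp add: power_diff)
      next
        case False
        then have "coeff q k * (w ^ k / w ^ L) = cnj (cnj (coeff q k) * w ^ (L - k))"
          using circle_inverse_power[OF w, of k L] by simp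
        then show ?thesis using False by (simp only: complex_cnj(1) cnj.simps if_False)
      qed
    qed
    finally have "p w = Re (f w)" by (simp add: f_def)
    then show "\<bar>Re (f w) - h w\<bar> < \<epsilon>" using p(2)[of w] w by (simp add: abs_minus_commute)
  qed
qed

section \<open>Orthogonal projection and duality\<close>

text \<open>
  The space of all matrices of finite support is not complete, but a finite-dimensional subspace always admits an
  orthogonal projection.
\<close>

lemma orthogonal_decomposition:
  fixes y :: "'a :: real_inner"
  assumes "finite B"
  obtains s where "s \<in> span B" "\<And>b. b \<in> span B \<Longrightarrow> inner (y - s) b = 0"
proof -
  obtain C where C: "finite C" "span C = span B" "pairwise orthogonal C"
    using basis_orthogonal[OF assms] by blast
  define s where "s = (\<Sum>c\<in>C. (inner c y / inner c c) *\<^sub>R c)"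
  have s: "s \<in> span B" unfolding s_def C(2)[symmetric] by (intro span_sum span_scale span_base)
  have "inner (y - s) c = 0" if "c \<in> C" for c
  proof -
    have "inner s c = (\<Sum>c'\<in>C. (inner c' y / inner c' c') * inner c' c)"
      by (simp add: s_def inner_sum_left)
    also have "\<dots> = (\<Sum>c'\<in>C. if c' = c then inner c y else 0)"
      using C(3) that by (intro sum.cong refl) (auto simp: pairwise_def orthogonal_def)
    also have "\<dots> = inner c y" using C(1) that by simp
    finally show ?thesis by (simp add: inner_diff_left inner_commute[of c y])
  qed
  then have "inner (y - s) b = 0" if "b \<in> span C" for b
    using that orthogonal_to_span[of b C "y - s"] unfolding orthogonal_def by (simp add: inner_commute)
  then show ?thesis using that s C(2) by blast
qed

lemma fmat_expansion:
  assumes "M \<in> mats m n"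
  shows "M = (\<Sum>a<m. \<Sum>b<n. Re (entry M a b) *\<^sub>R elem a b + Im (entry M a b) *\<^sub>R cscale \<i> (elem a b))"
proof (rule mats_eqI[OF assms])
  show "(\<Sum>a<m. \<Sum>b<n. Re (entry M a b) *\<^sub>R elem a b + Im (entry M a b) *\<^sub>R cscale \<i> (elem a b)) \<in> mats m n"
    by (intro mats_intro mats_elem) auto
  fix i j assume ij: "i < m" "j < n"
  have "entry (\<Sum>a<m. \<Sum>b<n. Re (entry M a b) *\<^sub>R elem a b + Im (entry M a b) *\<^sub>R cscale \<i> (elem a b)) i j
    = (\<Sum>a<m. \<Sum>b<n. if a = i \<and> b = j then entry M i j else 0)"
    unfolding entry_sum by (intro sum.cong refl) (auto simp: complex_eq_iff)
  also have "\<dots> = (\<Sum>a<m. if a = i then entry M i j else 0)"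
    using ij by (intro sum.cong refl) (auto simp: if_distrib cong: if_cong)
  also have "\<dots> = entry M i j" using ij by simp
  finally show "entry M i j = entry (\<Sum>a<m. \<Sum>b<n. Re (entry M a b) *\<^sub>R elem a b + Im (entry M a b) *\<^sub>R cscale \<i> (elem a b)) i j" ..
qed

lemma complex_expansion:
  assumes "M \<in> mats m n"
  shows "M = (\<Sum>a<m. \<Sum>b<n. cscale (entry M a b) (elem a b))"
proof -
  have "Re z *\<^sub>R M + Im z *\<^sub>R cscale \<i> M = cscale z M" for z M
    by (rule fmat_eqI) (simp add: complex_eq_iff algebra_simps)
  then show ?thesis using fmat_expansion[OF assms] by simp
qed

lemma inner_times_left: "inner (A * X) Y = inner X (adj A * Y)"
  unfolding inner_tr by (simp add: adj_times mult.assoc)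

lemma inner_times_right: "inner (X * A) Y = inner X (Y * adj A)"
  unfolding inner_tr adj_times by (metis mult.assoc tr_times_commute)

text \<open>
  The tuples \<open>R i * X * p i\<close> exhaust all tuples of this shape, because the adjoint of this linear
  map is the sum of the components of a tuple, which is injective by assumption. The isometries
  \<open>J i\<close> stack a tuple into one tall matrix, so that tuples have an inner product.
\<close>

lemma duality:
  fixes R p :: "nat \<Rightarrow> fmat"
  assumes R: "\<And>i. i < N \<Longrightarrow> projector d (R i)" and p: "\<And>i. i < N \<Longrightarrow> projector d (p i)"
    and inj: "\<And>X. (\<And>i. i < N \<Longrightarrow> X i \<in> mats d d \<and> R i * X i * p i = X i) \<Longrightarrow> (\<Sum>i<N. X i) = 0 \<Longrightarrow> \<forall>i<N. X i = 0"
    and i0: "i0 < N" and Y0: "Y0 \<in> mats d d"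
  obtains M where "M \<in> mats d d" "\<And>i. i < N \<Longrightarrow> R i * M * p i = (if i = i0 then R i * Y0 * p i else 0)"
proof -
  have Rm: "R i \<in> mats d d" "adj (R i) = R i" "R i * R i = R i" if "i < N" for i
    using R[OF that] by (auto simp: projector_def)
  have pm: "p i \<in> mats d d" "adj (p i) = p i" "p i * p i = p i" if "i < N" for i
    using p[OF that] by (auto simp: projector_def)
  define J where "J i = Fmat (\<lambda>a b. if b < d \<and> a = i * d + b then 1 else 0)" for i
  have eJ: "entry (J i) a b = (if b < d \<and> a = i * d + b then 1 else 0)" for i a b
    unfolding J_def by (subst entry_Fmat[of "i * d + d"]) auto
  have index: "i * d + a = j * d + b \<longleftrightarrow> i = j \<and> a = b" if "a < d" "b < d" for i j a b :: nat
  proof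
    assume *: "i * d + a = j * d + b"
    have "(i * d + a) div d = i" "(j * d + b) div d = j" using that by auto
    with * show "i = j \<and> a = b" by auto
  qed auto
  have JJ: "adj (J i) * J j = (if i = j then Id d else 0)" for i j
  proof (rule fmat_eqI)
    fix a b
    have "entry (adj (J i) * J j) a b = (\<Sum>l<i * d + d + j * d + d. cnj (entry (J i) l a) * entry (J j) l b)"
      by (subst entry_times[of "i * d + d + j * d + d"]) (auto simp: eJ)
    also have "\<dots> = (\<Sum>l<i * d + d + j * d + d. if l = i * d + a then (if a < d \<and> b < d \<and> i * d + a = j * d + b then 1 else 0) else 0)"
      by (intro sum.cong refl) (auto simp: eJ)
    also have "\<dots> = (if a < d \<and> b < d \<and> i * d + a = j * d + b then 1 else 0)" by simp
    also have "\<dots> = entry (if i = j then Id d else 0) a b" using index[of a b i j] by auto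
    finally show "entry (adj (J i) * J j) a b = entry (if i = j then Id d else 0) a b" .
  qed
  define L where "L M = (\<Sum>i<N. J i * (R i * M * p i))" for M
  have Llin: "linear L"
    unfolding L_def by (intro linearI) (simp_all add: algebra_simps sum.distrib scaleR_sum_right)
  \<comment> \<open>A finite real spanning set of the range of \<open>L\<close>, to project \<open>y\<close> onto this range.\<close>
  define B where "B = (\<lambda>(a, b). L (elem a b)) ` ({..<d} \<times> {..<d}) \<union> (\<lambda>(a, b). L (cscale \<i> (elem a b))) ` ({..<d} \<times> {..<d})"
  have finB: "finite B" unfolding B_def by auto
  have LB: "L M \<in> span B" if "M \<in> mats d d" for M
  proof -
    have "L M = (\<Sum>a<d. \<Sum>b<d. Re (entry M a b) *\<^sub>R L (elem a b) + Im (entry M a b) *\<^sub>R L (cscale \<i> (elem a b)))"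
      by (subst fmat_expansion[OF that]) (simp add: linear_sum[OF Llin] linear_add[OF Llin] linear_cmul[OF Llin])
    also have "\<dots> \<in> span B"
      by (intro span_sum span_add span_scale span_base) (auto simp: B_def)
    finally show ?thesis .
  qed
  have BL: "\<exists>M\<in>mats d d. b = L M" if "b \<in> span B" for b
    using that
  proof (induction rule: span_induct_alt)
    case base
    then show ?case by (intro bexI[of _ 0]) (auto simp: linear_0[OF Llin])
  next
    case (step c x y)
    obtain M where M: "M \<in> mats d d" "y = L M" using step by blast
    obtain M' where M': "M' \<in> mats d d" "x = L M'" using step(1) by (auto simp: B_def intro: mats_elem mats_cscale)
    show ?case using M M'
      by (intro bexI[of _ "c *\<^sub>R M' + M"]) (auto simp: linear_add[OF Llin] linear_cmul[OF Llin] intro: mats_intro)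
  qed
  define y where "y = J i0 * (R i0 * Y0 * p i0)"
  obtain s where s: "s \<in> span B" "\<And>b. b \<in> span B \<Longrightarrow> inner (y - s) b = 0"
    using orthogonal_decomposition[OF finB] by blast
  define z where "z = y - s"
  \<comment> \<open>The components of the part of \<open>y\<close> orthogonal to the range of \<open>L\<close>: a tuple in the kernel of the
    adjoint of \<open>L\<close>, hence zero.\<close>
  define X where "X i = R i * (adj (J i) * z) * p i" for i
  obtain Ms where Ms: "Ms \<in> mats d d" "s = L Ms" using BL[OF s(1)] by blast
  have JL: "adj (J i) * L M = R i * M * p i" if "i < N" "M \<in> mats d d" for i M
  proof -
    have "adj (J i) * L M = (\<Sum>j<N. (if i = j then R j * M * p j else 0))"
      unfolding L_def sum_distrib_left
    proof (intro sum.cong refl)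
      fix j assume "j \<in> {..<N}"
      then have "R j * M * p j \<in> mats d d" using that Rm pm by (auto intro!: mats_intro)
      then have "Id d * (R j * M * p j) = R j * M * p j" by (rule Id_times)
      then show "adj (J i) * (J j * (R j * M * p j)) = (if i = j then R j * M * p j else 0)"
        unfolding mult.assoc[symmetric, of "adj (J i)" "J j"] JJ by simp
    qed
    then show ?thesis using that by simp
  qed
  have Jy: "adj (J i) * y = (if i = i0 then R i * Y0 * p i else 0)" for i
  proof -
    have "R i0 * Y0 * p i0 \<in> mats d d" using i0 Y0 Rm pm by (auto intro!: mats_intro)
    then show ?thesis unfolding y_def mult.assoc[symmetric, of "adj (J i)"] JJ by auto
  qed
  have Xm: "X i \<in> mats d d \<and> R i * X i * p i = X i" if "i < N" for i
  proof
    have zm: "adj (J i) * z \<in> mats d d"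
      unfolding z_def right_diff_distrib Ms(2) JL[OF that Ms(1)] Jy
      using that Rm pm Ms Y0 by (auto intro!: mats_intro)
    show "X i \<in> mats d d"
      unfolding X_def by (rule mats_times_same[OF mats_times_same[OF Rm(1)[OF that] zm] pm(1)[OF that]])
    have "R i * X i * p i = (R i * R i) * (adj (J i) * z) * (p i * p i)" unfolding X_def by (simp add: mult.assoc)
    then show "R i * X i * p i = X i" using that Rm pm by (simp add: X_def)
  qed
  have zL: "inner z (J i * (R i * M * p i)) = inner (X i) M" if "i < N" for i M
  proof -
    have "inner z (J i * (R i * M * p i)) = inner (J i * (R i * M * p i)) z" by (rule inner_commute)
    also have "\<dots> = inner (R i * M * p i) (adj (J i) * z)" by (rule inner_times_left)
    also have "\<dots> = inner (R i * M) (adj (J i) * z * p i)" by (simp only: inner_times_right pm(2)[OF that])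
    also have "\<dots> = inner M (R i * (adj (J i) * z * p i))" by (simp only: inner_times_left Rm(2)[OF that])
    also have "\<dots> = inner M (X i)" by (simp only: X_def mult.assoc)
    finally show ?thesis by (simp add: inner_commute)
  qed
  have "inner (\<Sum>i<N. X i) M = 0" if "M \<in> mats d d" for M
  proof -
    have "inner (\<Sum>i<N. X i) M = inner z (L M)"
      unfolding L_def inner_sum_right inner_sum_left using zL by (intro sum.cong) auto
    also have "\<dots> = 0" using s(2)[OF LB[OF that]] by (simp add: z_def)
    finally show ?thesis .
  qed
  moreover have "(\<Sum>i<N. X i) \<in> mats d d" using Xm by (intro mats_intro) auto
  ultimately have "(\<Sum>i<N. X i) = 0" by (metis inner_eq_zero_iff)
  then have X0: "X i = 0" if "i < N" for i using inj[OF Xm] that by blast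
  have "inner z y = 0" unfolding y_def zL[OF i0] X0[OF i0] by simp
  moreover have "inner z s = 0" using s(2)[OF s(1)] by (simp add: z_def)
  moreover have "inner z z = inner z y - inner z s" unfolding z_def by (rule inner_diff_right)
  ultimately have "inner z z = 0" by simp
  then have "y = s" by (simp add: z_def)
  then have "R i * Ms * p i = (if i = i0 then R i * Y0 * p i else 0)" if "i < N" for i
    using JL[OF that Ms(1)] Jy[of i] Ms(2) by simp
  then show ?thesis using that Ms(1) by blast
qed

section \<open>Persistence of the destabilising subspace\<close>

text \<open>
  Let \<open>E\<close> and \<open>V\<^sub>i\<close> be the ranges of \<open>pr\<close> and \<open>P i\<close>. As the two projectors commute, \<open>V\<^sub>i\<close> is the direct sum
  of the ranges of \<open>p i = P i * pr\<close> and \<open>q i = P i * (Id - pr)\<close>. A perturbation of the frame turns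
  \<open>P i\<close> into a map \<open>P i + (w - 1) Z i\<close>. The sought moving subspaces are graphs: of
  \<open>\<phi> : E \<Rightarrow> E\<^sup>\<bottom>\<close>, for the deformation of \<open>E\<close>, and of \<open>\<eta>\<^sub>i\<close> from the range of \<open>p i\<close> to that of \<open>q i\<close>,
  for the part of the deformed \<open>V\<^sub>i\<close> that it contains. The containment reads
  \<open>(Id - pr - \<phi>) (P i + (w - 1) Z i) (p i + \<eta>\<^sub>i) = 0\<close>, since \<open>Id - pr - \<phi>\<close> vanishes exactly on the graph
  of \<open>\<phi>\<close>. Its linearisation is \<open>\<eta>\<^sub>i - \<phi> p\<^sub>i\<close>; the \<open>\<eta>\<^sub>i\<close> are free, so it can be solved if the
  components of \<open>\<phi> p\<^sub>i\<close> outside of the range of \<open>q i\<close> can be prescribed. The matrices \<open>Phi j a b\<close>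
  solve this problem for the elementary matrices in position \<open>j\<close>; they give a right inverse that is
  complex linear in the data, so that the iteration preserves holomorphy.
\<close>

locale splitting =
  fixes d N :: nat and pr :: fmat and P Z :: "nat \<Rightarrow> fmat" and Phi :: "nat \<Rightarrow> nat \<Rightarrow> nat \<Rightarrow> fmat"
  assumes proj: "projector d pr"
    and projP: "\<And>i. i < N \<Longrightarrow> projector d (P i)"
    and commute: "\<And>i. i < N \<Longrightarrow> P i * pr = pr * P i"
    and Zm: "\<And>i. i < N \<Longrightarrow> Z i \<in> mats d d"
    and Phi_mats: "\<And>i a b. Phi i a b \<in> mats d d"
    and Phi_corner: "\<And>i a b. (Id d - pr) * Phi i a b * pr = Phi i a b"
    and Phi_inverse: "\<And>i Y. i < N \<Longrightarrow> (\<And>j. j < N \<Longrightarrow> Y j \<in> mats d d) \<Longrightarrow>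
      (Id d - pr) * (Id d - P i) * (\<Sum>j<N. \<Sum>a<d. \<Sum>b<d. cscale (entry (Y j) a b) (Phi j a b)) * (P i * pr)
      = (Id d - pr) * (Id d - P i) * Y i * (P i * pr)"
begin

definition pc :: fmat where "pc = Id d - pr"
definition p :: "nat \<Rightarrow> fmat" where "p i = P i * pr"
definition q :: "nat \<Rightarrow> fmat" where "q i = P i * pc"

lemma pr_simps: "pr \<in> mats d d" "adj pr = pr" "pr * pr = pr"
  using proj unfolding projector_def by auto

lemma P_simps:
  assumes "i < N"
  shows "P i \<in> mats d d" "adj (P i) = P i" "P i * P i = P i"
  using projP[OF assms] unfolding projector_def by auto

lemma pc_simps: "pc \<in> mats d d" "pc * pc = pc" "pc * pr = 0" "pr * pc = 0" "pr + pc = Id d"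
  using pr_simps by (auto simp: pc_def algebra_simps Id_times[OF mats_Diag] Id_times[of _ d d] times_Id[of _ d d] intro: mats_intro)

lemma P_pc: "i < N \<Longrightarrow> P i * pc = pc * P i"
  using commute[of i] P_simps[of i] by (simp add: pc_def algebra_simps)

lemma p_simps:
  assumes i: "i < N"
  shows "p i \<in> mats d d" "P i * p i = p i" "p i * p i = p i" "pc * p i = 0" "pr * p i = p i" "p i * pr = p i"
proof -
  note s = pr_simps P_simps[OF i] pc_simps commute[OF i] P_pc[OF i]
  show "p i \<in> mats d d" unfolding p_def using s by (auto intro: mats_intro)
  show "P i * p i = p i" unfolding p_def by (metis mult.assoc s(6))
  show "pr * p i = p i" unfolding p_def by (metis mult.assoc s(3) s(12))
  show "p i * pr = p i" unfolding p_def by (metis mult.assoc s(3))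
  then show "p i * p i = p i" unfolding p_def by (metis mult.assoc s(3,6,12))
  show "pc * p i = 0" unfolding p_def by (metis mult.assoc s(9,13) mult_zero_right)
qed

lemma q_simps:
  assumes i: "i < N"
  shows "q i \<in> mats d d" "P i * q i = q i" "q i * q i = q i" "pr * q i = 0" "pc * q i = q i" "q i * pc = q i"
proof -
  note s = pr_simps P_simps[OF i] pc_simps commute[OF i] P_pc[OF i]
  show "q i \<in> mats d d" unfolding q_def using s by (auto intro: mats_intro)
  show "P i * q i = q i" unfolding q_def by (metis mult.assoc s(6))
  show "pc * q i = q i" unfolding q_def by (metis mult.assoc s(8,13))
  show "q i * pc = q i" unfolding q_def by (metis mult.assoc s(8))
  then show "q i * q i = q i" unfolding q_def by (metis mult.assoc s(8,6,13))
  show "pr * q i = 0" unfolding q_def by (metis mult.assoc s(10,12) mult_zero_right)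
qed

definition Theta :: "(nat \<Rightarrow> fmat) \<Rightarrow> fmat" where
  "Theta Y = (\<Sum>j<N. \<Sum>a<d. \<Sum>b<d. cscale (entry (Y j) a b) (Phi j a b))"

lemma Theta_mats: "Theta Y \<in> mats d d"
  unfolding Theta_def using Phi_mats by (intro mats_intro)

lemma Theta_corner: "pc * Theta Y * pr = Theta Y"
  unfolding Theta_def pc_def by (simp add: sum_distrib_left sum_distrib_right Phi_corner)

lemma Theta_inverse:
  assumes "i < N" "\<And>j. j < N \<Longrightarrow> Y j \<in> mats d d"
  shows "pc * Theta Y * p i - q i * Theta Y * p i = (pc - q i) * Y i * p i"
proof -
  have r: "(Id d - pr) * (Id d - P i) = pc - q i"
    using P_simps[OF assms(1)] pc_simps P_pc[OF assms(1)] unfolding q_def pc_def[symmetric]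
    by (simp add: right_diff_distrib times_Id[of _ d d])
  show ?thesis
    using Phi_inverse[OF assms] unfolding r Theta_def[symmetric] p_def[symmetric] by (simp add: left_diff_distrib)
qed

lemma Theta_diff: "Theta Y - Theta Y' = Theta (\<lambda>i. Y i - Y' i)"
  unfolding Theta_def by (simp add: sum_subtractf cscale_diff_left)

text \<open>
  The nonlinear part of the equation. An iteration step solves the linearised equation with the
  nonlinear part \<open>nterm\<close> of the previous iterate as right-hand side; \<open>ph\<close>, \<open>et\<close> and \<open>nt\<close> are the
  iterates of \<open>\<phi>\<close>, of the \<open>\<eta>\<^sub>i\<close> and of the nonlinear part.
\<close>

definition nterm :: "fmat \<Rightarrow> (nat \<Rightarrow> fmat) \<Rightarrow> complex \<Rightarrow> nat \<Rightarrow> fmat" where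
  "nterm \<phi> \<eta> w i = (pc - \<phi>) * cscale (w - 1) (Z i) * (p i + \<eta> i)"

primrec it :: "nat \<Rightarrow> complex \<Rightarrow> fmat \<times> (nat \<Rightarrow> fmat)" where
  "it 0 w = (0, \<lambda>i. 0)"
| "it (Suc j) w = (let n = nterm (fst (it j w)) (snd (it j w)) w
     in (Theta n, \<lambda>i. q i * Theta n * p i - q i * n i * p i))"

definition ph :: "nat \<Rightarrow> complex \<Rightarrow> fmat" where "ph j w = fst (it j w)"
definition et :: "nat \<Rightarrow> complex \<Rightarrow> nat \<Rightarrow> fmat" where "et j w = snd (it j w)"
definition nt :: "nat \<Rightarrow> complex \<Rightarrow> nat \<Rightarrow> fmat" where "nt j w = nterm (ph j w) (et j w) w"

lemma it_simps:
  "ph 0 w = 0" "et 0 w i = 0" "ph (Suc j) w = Theta (nt j w)"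
  "et (Suc j) w i = q i * Theta (nt j w) * p i - q i * nt j w i * p i"
  by (simp_all add: ph_def et_def nt_def Let_def)

lemma ph_corner: "ph j w \<in> mats d d" "pc * ph j w * pr = ph j w"
  by (cases j; simp add: it_simps Theta_mats Theta_corner)+

lemma et_corner:
  assumes "i < N"
  shows "q i * et j w i * p i = et j w i"
proof (cases j)
  case (Suc j')
  have "q i * (q i * X * p i) * p i = q i * X * p i" for X
    using p_simps(3)[OF assms] q_simps(3)[OF assms] by (metis mult.assoc)
  then show ?thesis
    unfolding Suc it_simps right_diff_distrib left_diff_distrib by simp
qed (simp add: it_simps)

lemma entire_iteration:
  "entire d d (ph j)" "\<And>i. i < N \<Longrightarrow> entire d d (\<lambda>w. et j w i)" "\<And>i. i < N \<Longrightarrow> entire d d (\<lambda>w. nt j w i)"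
proof -
  have n: "entire d d (\<lambda>w. nt j w i)"
    if "entire d d (ph j)" "i < N" "entire d d (\<lambda>w. et j w i)" for i j
    unfolding nt_def nterm_def using that p_simps[OF that(2)] pc_simps Zm[OF that(2)]
    by (intro entire_intros) (auto intro!: holomorphic_intros)
  have "entire d d (ph j) \<and> (\<forall>i<N. entire d d (\<lambda>w. et j w i))"
  proof (induction j)
    case 0
    then show ?case by (simp add: it_simps entire_const)
  next
    case (Suc j)
    have nj: "entire d d (\<lambda>w. nt j w i)" if "i < N" for i using n Suc that by blast
    have T: "entire d d (\<lambda>w. Theta (nt j w))"
      unfolding Theta_def using nj Phi_mats by (intro entire_intros) (auto simp: entire_def)
    show ?case
      unfolding it_simps using T nj p_simps(1) q_simps(1) by (auto intro!: entire_minus entire_times[of d d _ d] entire_const)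
  qed
  then show "entire d d (ph j)" "\<And>i. i < N \<Longrightarrow> entire d d (\<lambda>w. et j w i)" by auto
  then show "\<And>i. i < N \<Longrightarrow> entire d d (\<lambda>w. nt j w i)" using n by blast
qed

text \<open>
  The linear part of the equation at an iterate equals minus the nonlinear part of its
  predecessor, which was the right-hand side of the step.
\<close>

lemma residual:
  assumes i: "i < N"
  shows "(pc - ph (Suc j) w) * (P i + cscale (w - 1) (Z i)) * (p i + et (Suc j) w i) = nt (Suc j) w i - nt j w i"
proof -
  define \<phi> \<eta> n where "\<phi> = ph (Suc j) w" and "\<eta> = et (Suc j) w i" and "n = nt j w i"
  note ps = p_simps[OF i] and qs = q_simps[OF i] and Ps = P_simps[OF i]
  have \<phi>: "pc * \<phi> * pr = \<phi>" using ph_corner(2) by (simp add: \<phi>_def)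
  have pc\<phi>: "pc * \<phi> = \<phi>" by (metis \<phi> mult.assoc pc_simps(2))
  have \<phi>pr: "\<phi> * pr = \<phi>" by (metis \<phi> mult.assoc pr_simps(3))
  have \<eta>: "q i * \<eta> * p i = \<eta>" using et_corner[OF i] by (simp add: \<eta>_def)
  have P\<eta>: "P i * \<eta> = \<eta>" by (metis \<eta> mult.assoc qs(2))
  have pc\<eta>: "pc * \<eta> = \<eta>" by (metis \<eta> mult.assoc qs(5))
  have pr\<eta>: "pr * \<eta> = 0" by (metis \<eta> mult.assoc qs(4) mult_zero_left)
  have \<phi>\<eta>: "\<phi> * \<eta> = 0" by (metis \<phi>pr mult.assoc pr\<eta> mult_zero_right)
  have np: "n * p i = n"
  proof -
    have "et j w i * p i = et j w i" by (metis et_corner[OF i] mult.assoc ps(3))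
    then have "(p i + et j w i) * p i = p i + et j w i" using ps by (simp add: distrib_right)
    then show ?thesis unfolding n_def nt_def nterm_def by (simp only: mult.assoc)
  qed
  have pcn: "pc * n = n"
  proof -
    have "pc * ph j w = ph j w" by (metis ph_corner(2) mult.assoc pc_simps(2))
    then have "pc * (pc - ph j w) = pc - ph j w" using pc_simps by (simp add: right_diff_distrib)
    then show ?thesis unfolding n_def nt_def nterm_def by (simp only: mult.assoc[symmetric])
  qed
  have "(pc - \<phi>) * P i * (p i + \<eta>) = (pc - \<phi>) * (P i * p i + P i * \<eta>)" by (simp only: mult.assoc distrib_left)
  also have "\<dots> = (pc - \<phi>) * (p i + \<eta>)" by (simp add: ps(2) P\<eta>)
  also have "\<dots> = \<eta> - \<phi> * p i"
    by (simp add: left_diff_distrib distrib_left ps(4) pc\<eta> \<phi>\<eta>)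
  finally have 1: "(pc - \<phi>) * P i * (p i + \<eta>) = \<eta> - \<phi> * p i" .
  have qnp: "q i * n * p i = q i * n" by (simp add: mult.assoc np)
  have 2: "pc * \<phi> * p i - q i * \<phi> * p i = (pc - q i) * n * p i"
    using Theta_inverse[OF i, of "nt j w"] entire_mats[OF entire_iteration(3)]
    by (simp add: \<phi>_def n_def it_simps)
  have 3: "(pc - q i) * n * p i = n - q i * n" by (simp add: mult.assoc np left_diff_distrib pcn)
  have "\<eta> - \<phi> * p i = - (pc * \<phi> * p i - q i * \<phi> * p i) - q i * n"
    unfolding pc\<phi> by (simp add: \<eta>_def \<phi>_def n_def it_simps qnp[unfolded n_def])
  then have "(pc - \<phi>) * P i * (p i + \<eta>) = - n" unfolding 1 2 3 by simp
  moreover have "(pc - \<phi>) * (P i + cscale (w - 1) (Z i)) * (p i + \<eta>)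
    = (pc - \<phi>) * P i * (p i + \<eta>) + nt (Suc j) w i"
    unfolding nt_def nterm_def \<phi>_def \<eta>_def by (simp only: distrib_left distrib_right add_ac)
  ultimately show ?thesis by (simp add: \<phi>_def \<eta>_def n_def)
qed

text \<open>
  The nonlinear part carries the factor \<open>w - 1\<close>, so for small \<open>|w - 1|\<close> the iteration is a
  contraction by \<open>1 / 2\<close> and the residuals tend to zero. Each iterate is entire, though its bounds
  hold near \<open>1\<close> only; the limit is known to be holomorphic only there, which is
  why the approximate solutions are kept.
\<close>

lemma approximate_graphs:
  obtains \<delta> where "\<delta> > 0"
    "\<And>\<epsilon>. \<epsilon> > 0 \<Longrightarrow> \<exists>\<phi> \<eta>. entire d d \<phi> \<and> (\<forall>i<N. entire d d (\<lambda>w. \<eta> w i)) \<and>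
      (\<forall>w. pc * \<phi> w * pr = \<phi> w) \<and> (\<forall>w. \<forall>i<N. q i * \<eta> w i * p i = \<eta> w i) \<and>
      (\<forall>w. cmod (w - 1) \<le> \<delta> \<longrightarrow> norm (\<phi> w) \<le> 1 \<and> (\<forall>i<N. norm (\<eta> w i) \<le> 1 \<and>
        norm ((pc - \<phi> w) * (P i + cscale (w - 1) (Z i)) * (p i + \<eta> w i)) \<le> \<epsilon>))"
proof -
  define CP where "CP = (\<Sum>j<N. \<Sum>a<d. \<Sum>b<d. norm (Phi j a b))"
  \<comment> \<open>A common bound for the norms of all the data.\<close>
  define C where "C = 1 + norm pc + (\<Sum>i<N. norm (p i) + norm (q i) + norm (Z i)) + CP"
  have CP0: "CP \<ge> 0" unfolding CP_def by (intro sum_nonneg) auto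
  have S0: "(\<Sum>i<N. norm (p i) + norm (q i) + norm (Z i)) \<ge> 0" by (intro sum_nonneg) auto
  have C1: "C \<ge> 1" "norm pc \<le> C" "CP \<le> C" using CP0 S0 by (auto simp: C_def)
  have Ci: "norm (p i) \<le> C" "norm (q i) \<le> C" "norm (Z i) \<le> C" if "i < N" for i
  proof -
    have "norm (p i) + norm (q i) + norm (Z i) \<le> (\<Sum>i<N. norm (p i) + norm (q i) + norm (Z i))"
      using that by (intro member_le_sum) auto
    then have *: "norm (p i) + norm (q i) + norm (Z i) \<le> C"
      unfolding C_def using CP0 norm_ge_zero[of pc] by linarith
    show "norm (p i) \<le> C" "norm (q i) \<le> C" "norm (Z i) \<le> C"
      using * norm_ge_zero[of "p i"] norm_ge_zero[of "q i"] norm_ge_zero[of "Z i"] by linarith+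
  qed
  have mult_le: "norm (A * B) \<le> a * b" if "norm A \<le> a" "norm B \<le> b" for A B :: fmat and a b
    using norm_mult_ineq[of A B] mult_mono[OF that] order_trans[OF norm_ge_zero that(1)] by fastforce
  have ring_id: "(c - x) * D * (b + e) - (c - y) * D * (b + e') = (c - x) * D * (e - e') - (x - y) * D * (b + e')"
    for c x y D b e e' :: fmat
    by (simp add: algebra_simps)
  have diff_le: "norm (A - B) \<le> a + b" if "norm A \<le> a" "norm B \<le> b" for A B :: fmat and a b
    using norm_triangle_ineq4[of A B] that by linarith
  have Theta_le: "norm (Theta Y) \<le> C * m" if "\<And>i. i < N \<Longrightarrow> norm (Y i) \<le> m" "m \<ge> 0" for Y m
  proof -
    have "norm (Theta Y) \<le> (\<Sum>j<N. \<Sum>a<d. \<Sum>b<d. norm (Phi j a b) * m)"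
      unfolding Theta_def
    proof (intro sum_norm_le)
      fix j a b assume "j \<in> {..<N}"
      then have "cmod (entry (Y j) a b) \<le> m" using that(1)[of j] norm_entry_le[of "Y j" a b] by auto
      then show "norm (cscale (entry (Y j) a b) (Phi j a b)) \<le> norm (Phi j a b) * m"
        unfolding norm_cscale by (subst mult.commute) (rule mult_left_mono, auto)
    qed
    also have "\<dots> = CP * m" by (simp add: CP_def sum_distrib_right)
    also have "\<dots> \<le> C * m" using C1 that(2) by (intro mult_right_mono) auto
    finally show ?thesis .
  qed
  define C2 where "C2 = C + C * C * C * C + C * C * C"
  define C3 where "C3 = 2 * ((C + 1) * C * (C + 1))"
  have C2: "C2 \<ge> 1" "C2 \<ge> C" "C2 \<ge> C * C * C * C + C * C * C"
  proof -
    have "0 \<le> C * C * C * C" "0 \<le> C * C * C" using C1 by auto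
    then show "C2 \<ge> 1" "C2 \<ge> C" "C2 \<ge> C * C * C * C + C * C * C" using C1 unfolding C2_def by linarith+
  qed
  have "(C + 1) * C * (C + 1) \<ge> 1 * 1 * 1" using C1 by (intro mult_mono) auto
  then have C3: "C3 \<ge> 1" by (simp add: C3_def)
  \<comment> \<open>A step enlarges differences by at most \<open>C2\<close>, and passing to the nonlinear part multiplies them by
    at most \<open>\<delta> * C3\<close>.\<close>
  define \<delta> where "\<delta> = 1 / (2 * C2 * C3)"
  have C3half: "(C + 1) * (\<delta> * C) * (C + 1) = \<delta> * C3 / 2" unfolding C3_def by simp
  have \<delta>: "\<delta> > 0" using C2 C3 by (simp add: \<delta>_def)
  have \<delta>1: "\<delta> * C3 * C2 = 1 / 2" using C2 C3 by (simp add: \<delta>_def)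
  have \<delta>2: "\<delta> * C3 \<le> 1"
  proof -
    have "\<delta> * C3 * 1 \<le> \<delta> * C3 * C2" using C2 C3 \<delta> by (intro mult_left_mono) auto
    then show ?thesis using \<delta>1 by simp
  qed
  show ?thesis
  proof (rule that[OF \<delta>])
    fix \<epsilon> :: real assume "\<epsilon> > 0"
    have step: "norm (ph (Suc j) w - ph (Suc j') w) \<le> C2 * m \<and> (\<forall>i<N. norm (et (Suc j) w i - et (Suc j') w i) \<le> C2 * m)"
      if "\<And>i. i < N \<Longrightarrow> norm (nt j w i - nt j' w i) \<le> m" "m \<ge> 0" for j j' w m
    proof -
      have T: "norm (Theta (nt j w) - Theta (nt j' w)) \<le> C * m"
        unfolding Theta_diff using that by (intro Theta_le)
      have "C * m \<le> C2 * m" using C2 that by (intro mult_right_mono) auto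
      moreover have "norm (et (Suc j) w i - et (Suc j') w i) \<le> C2 * m" if i: "i < N" for i
      proof -
        have "et (Suc j) w i - et (Suc j') w i
          = q i * (Theta (nt j w) - Theta (nt j' w)) * p i - q i * (nt j w i - nt j' w i) * p i"
          unfolding it_simps by (simp add: algebra_simps)
        also have "norm \<dots> \<le> C * (C * m) * C + C * m * C"
          using T Ci[OF i] \<open>\<And>i. i < N \<Longrightarrow> norm (nt j w i - nt j' w i) \<le> m\<close>[OF i]
          by (intro diff_le[of "_ * _" _ "_ * _"] mult_le)
        also have "\<dots> \<le> (C * C * C * C + C * C * C) * m"
        proof -
          have "1 * (C * C * C * m) \<le> C * (C * C * C * m)" using C1 \<open>m \<ge> 0\<close> by (intro mult_right_mono) auto
          moreover have "1 * (C * C * m) \<le> C * (C * C * m)" using C1 \<open>m \<ge> 0\<close> by (intro mult_right_mono) auto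
          ultimately show ?thesis by (simp add: algebra_simps)
        qed
        also have "\<dots> \<le> C2 * m" using C2 \<open>m \<ge> 0\<close> by (intro mult_right_mono) auto
        finally show ?thesis .
      qed
      ultimately show ?thesis using T by (auto simp: it_simps)
    qed
    have bounds: "norm (ph j w) \<le> 1 \<and> (\<forall>i<N. norm (et j w i) \<le> 1 \<and> norm (nt j w i) \<le> \<delta> * C3 / 2)"
      if w: "cmod (w - 1) \<le> \<delta>" for j w
    proof (induction j)
      case 0
      have "norm (nt 0 w i) \<le> \<delta> * C3 / 2" if "i < N" for i
      proof -
        have "norm (nt 0 w i) \<le> (C + 1) * (\<delta> * C) * (C + 1)"
          unfolding nt_def nterm_def using C1 Ci[OF that] w \<delta>
          by (intro mult_le) (auto simp: it_simps norm_cscale intro!: mult_mono)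
        then show ?thesis unfolding C3half .
      qed
      then show ?case by (simp add: it_simps)
    next
      case (Suc j)
      have nj: "norm (nt j w i) \<le> \<delta> * C3 / 2" if "i < N" for i using Suc that by blast
      have m0: "\<delta> * C3 / 2 \<ge> 0" using \<delta> C3 by simp
      have T: "norm (Theta (nt j w)) \<le> C * (\<delta> * C3 / 2)" using nj m0 by (intro Theta_le)
      have "C * (\<delta> * C3 / 2) \<le> C2 * (\<delta> * C3 / 2)" using C2 m0 by (intro mult_right_mono) auto
      also have C2b: "C2 * (\<delta> * C3 / 2) \<le> 1" using \<delta>1 by (simp add: mult_ac)
      finally have 1: "norm (ph (Suc j) w) \<le> 1" using T by (simp add: it_simps)
      have 2: "norm (et (Suc j) w i) \<le> 1" if i: "i < N" for i
      proof -
        have "norm (et (Suc j) w i) \<le> C * (C * (\<delta> * C3 / 2)) * C + C * (\<delta> * C3 / 2) * C"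
          unfolding it_simps using T Ci[OF i] nj[OF i]
          by (intro diff_le[of "_ * _" _ "_ * _"] mult_le)
        also have "\<dots> \<le> (C * C * C * C + C * C * C) * (\<delta> * C3 / 2)"
        proof -
          define m where "m = \<delta> * C3 / 2"
          have "1 * (C * C * C * m) \<le> C * (C * C * C * m)" using C1 m0 by (intro mult_right_mono) (auto simp: m_def)
          moreover have "1 * (C * C * m) \<le> C * (C * C * m)" using C1 m0 by (intro mult_right_mono) (auto simp: m_def)
          ultimately show ?thesis unfolding m_def[symmetric] by (simp add: algebra_simps)
        qed
        also have "\<dots> \<le> C2 * (\<delta> * C3 / 2)" using C2 m0 by (intro mult_right_mono) auto
        also note C2b
        finally show ?thesis .
      qed
      have 3: "norm (nt (Suc j) w i) \<le> \<delta> * C3 / 2" if i: "i < N" for i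
      proof -
        have "norm (pc - ph (Suc j) w) \<le> C + 1" "norm (p i + et (Suc j) w i) \<le> C + 1"
          using 1 2[OF i] C1 Ci[OF i] by (auto intro!: order_trans[OF norm_triangle_ineq4] order_trans[OF norm_triangle_ineq])
        then have "norm (nt (Suc j) w i) \<le> (C + 1) * (\<delta> * C) * (C + 1)"
          unfolding nt_def nterm_def using C1 Ci[OF i] w \<delta>
          by (intro mult_le) (auto simp: norm_cscale intro!: mult_mono)
        then show ?thesis unfolding C3half .
      qed
      show ?case using 1 2 3 by blast
    qed
    have diff: "norm (nt (Suc j) w i - nt j w i) \<le> (1 / 2) ^ j" if w: "cmod (w - 1) \<le> \<delta>" and i: "i < N" for j w i
      using i
    proof (induction j arbitrary: i)
      case 0
      have "norm (nt (Suc 0) w i - nt 0 w i) \<le> \<delta> * C3 / 2 + \<delta> * C3 / 2"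
        using bounds[OF w, of "Suc 0"] bounds[OF w, of 0] 0 by (intro order_trans[OF norm_triangle_ineq4] add_mono) auto
      then show ?case using \<delta>2 by (simp add: mult.commute)
    next
      case (Suc j)
      define m where "m = C2 * (1 / 2) ^ j"
      have m0: "m \<ge> 0" using C2 by (simp add: m_def)
      have s: "norm (ph (Suc (Suc j)) w - ph (Suc j) w) \<le> m" "norm (et (Suc (Suc j)) w i - et (Suc j) w i) \<le> m"
        using step[of "Suc j" w j "(1 / 2) ^ j"] Suc unfolding m_def by auto
      have b: "norm (ph j w) \<le> 1" "norm (et j w i) \<le> 1" for j using bounds[OF w, of j] Suc(2) by auto
      have z: "norm (cscale (w - 1) (Z i)) \<le> \<delta> * C"
        using w Ci[OF Suc(2)] by (auto simp: norm_cscale intro!: mult_mono order_trans[OF norm_ge_zero w])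
      have "nt (Suc (Suc j)) w i - nt (Suc j) w i
        = (pc - ph (Suc (Suc j)) w) * cscale (w - 1) (Z i) * (et (Suc (Suc j)) w i - et (Suc j) w i)
        - (ph (Suc (Suc j)) w - ph (Suc j) w) * cscale (w - 1) (Z i) * (p i + et (Suc j) w i)"
        unfolding nt_def nterm_def by (rule ring_id)
      also have "norm \<dots> \<le> (C + 1) * (\<delta> * C) * m + m * (\<delta> * C) * (C + 1)"
      proof -
        have "norm (pc - ph (Suc (Suc j)) w) \<le> C + 1" using C1 b by (intro diff_le) auto
        moreover have "norm (p i + et (Suc j) w i) \<le> C + 1"
          using Ci[OF Suc(2)] b by (intro order_trans[OF norm_triangle_ineq] add_mono) auto
        ultimately show ?thesis using s z by (intro diff_le[of "_ * _" _ "_ * _"] mult_le)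
      qed
      also have "\<dots> = (2 * \<delta> * C * m * (C + 1)) * 1" by (simp add: algebra_simps)
      also have "\<dots> \<le> (2 * \<delta> * C * m * (C + 1)) * (C + 1)"
        using C1 \<delta> m0 by (intro mult_left_mono mult_nonneg_nonneg) auto
      also have "\<dots> = \<delta> * C3 * m" by (simp add: C3_def)
      also have "\<dots> = (\<delta> * C3 * C2) * (1 / 2) ^ j" by (simp add: m_def)
      also have "\<dots> = (1 / 2) ^ Suc j" unfolding \<delta>1 by simp
      finally show ?case .
    qed
    obtain j where j: "(1 / 2 :: real) ^ j < \<epsilon>" using real_arch_pow_inv[OF \<open>\<epsilon> > 0\<close>, of "1 / 2"] by auto
    show "\<exists>\<phi> \<eta>. entire d d \<phi> \<and> (\<forall>i<N. entire d d (\<lambda>w. \<eta> w i)) \<and>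
      (\<forall>w. pc * \<phi> w * pr = \<phi> w) \<and> (\<forall>w. \<forall>i<N. q i * \<eta> w i * p i = \<eta> w i) \<and>
      (\<forall>w. cmod (w - 1) \<le> \<delta> \<longrightarrow> norm (\<phi> w) \<le> 1 \<and> (\<forall>i<N. norm (\<eta> w i) \<le> 1 \<and>
        norm ((pc - \<phi> w) * (P i + cscale (w - 1) (Z i)) * (p i + \<eta> w i)) \<le> \<epsilon>))"
    proof (rule exI[of _ "ph (Suc j)"], rule exI[of _ "et (Suc j)"], intro conjI allI impI)
      fix w i assume w: "cmod (w - 1) \<le> \<delta>" and i: "i < N"
      show "norm ((pc - ph (Suc j) w) * (P i + cscale (w - 1) (Z i)) * (p i + et (Suc j) w i)) \<le> \<epsilon>"
        unfolding residual[OF i] using diff[OF w i, of j] j by linarith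
    qed (use entire_iteration ph_corner et_corner bounds in auto)
  qed
qed

end

section \<open>A destabilised splitting that persists excludes tight frames\<close>

text \<open>
  Finitely many rotations of the arc cover the circle. The product of the correspondingly rotated
  copies of \<open>Q\<close> has a small factor at every point of the circle, so it is at most \<open>1 / 2\<close> there,
  whereas its modulus at the origin is at least \<open>1\<close>.
\<close>

lemma two_constants:
  fixes K \<rho> :: real
  assumes \<rho>: "\<rho> > 0" and K: "K \<ge> 1"
    and Q: "\<And>\<epsilon>. 0 < \<epsilon> \<Longrightarrow> \<epsilon> < 1 \<Longrightarrow> \<exists>Q. Q holomorphic_on UNIV \<and> 1 \<le> cmod (Q 0) \<and>
      (\<forall>w. cmod w = 1 \<longrightarrow> cmod (Q w) \<le> K) \<and> (\<forall>w. cmod w = 1 \<longrightarrow> cmod (w - 1) < \<rho> \<longrightarrow> cmod (Q w) \<le> K * \<epsilon>)"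
  shows False
proof -
  have "\<exists>Z\<subseteq>sphere 0 1. finite Z \<and> sphere 0 1 \<subseteq> (\<Union>\<zeta>\<in>Z. {w. cmod (\<zeta> * w - 1) < \<rho>})"
  proof (rule compactE_image[OF compact_sphere])
    show "open {w. cmod (\<zeta> * w - 1) < \<rho>}" for \<zeta> by (intro open_Collect_less continuous_intros)
    show "sphere 0 1 \<subseteq> (\<Union>\<zeta>\<in>sphere 0 1. {w. cmod (\<zeta> * w - 1) < \<rho>})"
    proof
      fix w :: complex assume w: "w \<in> sphere 0 1"
      then have "cnj w * w = 1" by (simp add: mult.commute complex_norm_square[symmetric])
      then have "w \<in> {u. cmod (cnj w * u - 1) < \<rho>}" "cnj w \<in> sphere 0 1" using \<rho> w by auto
      then show "w \<in> (\<Union>\<zeta>\<in>sphere 0 1. {w. cmod (\<zeta> * w - 1) < \<rho>})" by blast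
    qed
  qed (blast+)
  then obtain Z where Z: "Z \<subseteq> sphere 0 1" "finite Z" "sphere 0 1 \<subseteq> (\<Union>\<zeta>\<in>Z. {w. cmod (\<zeta> * w - 1) < \<rho>})"
    by blast
  define \<epsilon> where "\<epsilon> = 1 / (2 * K ^ card Z)"
  have K1: "K ^ card Z \<ge> 1" using K by (simp add: one_le_power)
  then have \<epsilon>: "0 < \<epsilon>" "\<epsilon> < 1" by (auto simp: \<epsilon>_def divide_simps)
  obtain Q where Q: "Q holomorphic_on UNIV" "1 \<le> cmod (Q 0)" "\<And>w. cmod w = 1 \<Longrightarrow> cmod (Q w) \<le> K"
    "\<And>w. cmod w = 1 \<Longrightarrow> cmod (w - 1) < \<rho> \<Longrightarrow> cmod (Q w) \<le> K * \<epsilon>"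
    using assms(3)[OF \<epsilon>] by blast
  define h where "h w = (\<Prod>\<zeta>\<in>Z. Q (\<zeta> * w))" for w
  have "(\<lambda>w. Q (\<zeta> * w)) holomorphic_on UNIV" for \<zeta>
    using holomorphic_on_compose[of "\<lambda>w. \<zeta> * w" UNIV Q] Q(1)
    by (auto simp: o_def intro!: holomorphic_intros intro: holomorphic_on_subset)
  then have h: "h holomorphic_on UNIV" unfolding h_def by (intro holomorphic_intros)
  have "cmod (h w) \<le> 1 / 2" if w: "cmod w = 1" for w
  proof -
    obtain \<zeta>0 where \<zeta>0: "\<zeta>0 \<in> Z" "cmod (\<zeta>0 * w - 1) < \<rho>" using Z(3) w by auto
    have n: "cmod (\<zeta> * w) = 1" if "\<zeta> \<in> Z" for \<zeta> using that Z(1) w by (auto simp: norm_mult)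
    have "cmod (h w) = cmod (Q (\<zeta>0 * w)) * (\<Prod>\<zeta>\<in>Z - {\<zeta>0}. cmod (Q (\<zeta> * w)))"
      unfolding h_def using \<zeta>0 Z(2) by (simp add: prod_norm[symmetric] prod.remove[of Z \<zeta>0] norm_mult)
    also have "\<dots> \<le> (K * \<epsilon>) * (\<Prod>\<zeta>\<in>Z - {\<zeta>0}. K)"
      using Q(3,4) n \<zeta>0 K \<epsilon> by (intro mult_mono prod_mono prod_nonneg) auto
    also have "\<dots> = K ^ card Z * \<epsilon>"
      using \<zeta>0 Z(2) by (simp add: card_Diff_singleton power_eq_if card_gt_0_iff) (metis card_gt_0_iff empty_iff less_not_refl)
    also have "\<dots> = 1 / 2" using K by (simp add: \<epsilon>_def)
    finally show ?thesis .
  qed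
  note hle = this
  have "cmod (h 0) \<le> 1 / 2"
  proof (rule maximum_modulus_frontier[of h "cball 0 1"])
    show "h holomorphic_on interior (cball 0 1)" by (rule holomorphic_on_subset[OF h]) simp
    show "continuous_on (closure (cball 0 1)) h"
      by (rule continuous_on_subset[OF holomorphic_on_imp_continuous_on[OF h]]) simp
    show "cmod (h z) \<le> 1 / 2" if "z \<in> frontier (cball 0 1)" for z
      using that by (intro hle) simp
  qed simp_all
  moreover have "cmod (h 0) = cmod (Q 0) ^ card Z" by (simp add: h_def norm_power)
  moreover have "1 \<le> cmod (Q 0) ^ card Z" using Q(2) by (rule one_le_power)
  ultimately show False by linarith
qed

text \<open>
  The perturbation \<open>Z i\<close> is chosen such that \<open>(P i + (w - 1) Z i) * adj (A i)\<close> is the value \<open>B i w\<close> of the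
  affine function with \<open>B i 0 = adj (T i)\<close> and \<open>B i 1 = adj (A i)\<close>.
\<close>

locale frame_pair = splitting d N pr P Z Phi
  for d N :: nat and pr :: fmat and P Z :: "nat \<Rightarrow> fmat" and Phi +
  fixes k :: "nat \<Rightarrow> nat" and A T :: "nat \<Rightarrow> fmat"
  assumes d_pos: "d > 0"
    and Am: "\<And>i. i < N \<Longrightarrow> A i \<in> mats (k i) d" and AA: "\<And>i. i < N \<Longrightarrow> A i * adj (A i) = Id (k i)"
    and Tm: "\<And>i. i < N \<Longrightarrow> T i \<in> mats (k i) d" and TT: "\<And>i. i < N \<Longrightarrow> T i * adj (T i) = Id (k i)"
    and PA: "\<And>i. i < N \<Longrightarrow> P i = adj (A i) * A i"
    and ZA: "\<And>i. i < N \<Longrightarrow> Z i = (adj (A i) - adj (T i)) * A i"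
begin

definition B :: "nat \<Rightarrow> complex \<Rightarrow> fmat" where
  "B i w = adj (T i) + cscale w (adj (A i) - adj (T i))"

lemma B_entire: "i < N \<Longrightarrow> entire d (k i) (B i)"
  unfolding B_def using Am Tm by (intro entire_intros mats_intro) (auto intro: holomorphic_intros)

lemma B_eq:
  assumes "i < N"
  shows "B i w = (P i + cscale (w - 1) (Z i)) * adj (A i)"
proof -
  have a: "adj (A i) * Id (k i) = adj (A i)" "adj (T i) * Id (k i) = adj (T i)"
    using times_Id[OF mats_adj[OF Am[OF assms]]] times_Id[OF mats_adj[OF Tm[OF assms]]] by auto
  have "(P i + cscale (w - 1) (Z i)) * adj (A i)
    = adj (A i) * (A i * adj (A i)) + cscale (w - 1) ((adj (A i) - adj (T i)) * (A i * adj (A i)))"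
    unfolding PA[OF assms] ZA[OF assms] by (simp add: distrib_right mult.assoc)
  also have "\<dots> = B i w"
    unfolding AA[OF assms] B_def left_diff_distrib a by (simp add: cscale_diff_left)
  finally show ?thesis ..
qed

text \<open>
  The dimensions of \<open>V\<^sub>i \<inter> E\<close> and of \<open>E\<close>. In the coordinates that the rows of \<open>A i\<close> give to \<open>V\<^sub>i\<close>, the
  projector onto \<open>V\<^sub>i \<inter> E\<close> is \<open>a i\<close>.
\<close>

definition r :: "nat \<Rightarrow> nat" where "r i = (SOME m. tr (p i) = of_nat m)"
definition r0 :: nat where "r0 = (SOME m. tr pr = of_nat m)"

lemma r0: "tr pr = of_nat r0" "dt d (pc + cscale s pr) = s ^ r0"
proof -
  obtain m :: nat where m: "tr pr = of_nat m" "\<And>s. dt d (Id d - pr + cscale s pr) = s ^ m"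
    using projector_dt[OF proj] by blast
  have "r0 = m" unfolding r0_def using m(1) by auto
  with m show "tr pr = of_nat r0" "dt d (pc + cscale s pr) = s ^ r0" by (auto simp: pc_def)
qed

definition a :: "nat \<Rightarrow> fmat" where "a i = A i * pr * adj (A i)"

lemma a_simps:
  assumes i: "i < N"
  shows "projector (k i) (a i)" "a i \<in> mats (k i) (k i)" "a i * a i = a i" "adj (A i) * a i = p i * adj (A i)"
    "tr (p i) = of_nat (r i)" "dt (k i) (Id (k i) - a i + cscale s (a i)) = s ^ r i"
proof -
  have AP: "A i * P i = A i"
    unfolding PA[OF i] mult.assoc[symmetric] AA[OF i] by (rule Id_times[OF Am[OF i]])
  show am: "a i \<in> mats (k i) (k i)" unfolding a_def using Am[OF i] pr_simps by (auto intro!: mats_intro)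
  have "adj (A i) * a i = P i * pr * adj (A i)" unfolding a_def PA[OF i] by (simp add: mult.assoc)
  then show Aa: "adj (A i) * a i = p i * adj (A i)" by (simp add: p_def)
  have "a i * a i = A i * pr * (adj (A i) * a i)" by (simp add: a_def mult.assoc)
  also have "\<dots> = A i * (pr * p i) * adj (A i)" by (simp add: Aa mult.assoc)
  also have "\<dots> = A i * P i * pr * adj (A i)" unfolding p_simps(5)[OF i] by (simp add: p_def mult.assoc)
  finally show aa: "a i * a i = a i" by (simp add: AP a_def)
  have "adj (a i) = a i" by (simp add: a_def adj_times mult.assoc pr_simps)
  with am aa show pa: "projector (k i) (a i)" by (simp add: projector_def)
  have "tr (a i) = tr (adj (A i) * A i * pr)" unfolding a_def
    by (metis mult.assoc tr_times_commute)
  then have tra: "tr (a i) = tr (p i)" by (simp add: p_def PA[OF i])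
  obtain m :: nat where m: "tr (a i) = of_nat m" "\<And>s. dt (k i) (Id (k i) - a i + cscale s (a i)) = s ^ m"
    using projector_dt[OF pa] by blast
  have "r i = m" unfolding r_def using m(1) tra by auto
  with m tra show "tr (p i) = of_nat (r i)" "dt (k i) (Id (k i) - a i + cscale s (a i)) = s ^ r i" by auto
qed

text \<open>
  For \<open>\<kappa> = 1\<close>, the second factor straightens the graph of \<open>\<phi>\<close> to \<open>E\<close>, and the first one scales \<open>E\<close> by \<open>e\<close>.
  The parameter \<open>\<kappa>\<close> switches \<open>\<phi>\<close> off where it is not controlled.
\<close>

definition H :: "complex \<Rightarrow> complex \<Rightarrow> fmat \<Rightarrow> fmat" where
  "H e \<kappa> \<phi> = (pc + cscale e pr) * (Id d - cscale \<kappa> \<phi>)"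

text \<open>
  One number \<open>S\<close> dominates all the data, so that the constants in the estimates depend on \<open>S\<close> only, and
  not on the approximation error \<open>\<epsilon>\<close>.
\<close>

definition big :: "real \<Rightarrow> real \<Rightarrow> bool" where
  "big \<delta> S \<longleftrightarrow> 3 \<le> S \<and> \<delta> \<le> S \<and> norm pr \<le> S \<and> norm pc \<le> S \<and> norm (Id d) \<le> S \<and>
    (\<forall>i<N. norm (P i) \<le> S \<and> norm (Z i) \<le> S \<and> norm (p i) \<le> S \<and> norm (q i) \<le> S \<and> norm (A i) \<le> S \<and>
      norm (a i) \<le> S \<and> norm (Id (k i) - a i) \<le> S \<and> norm (Id (k i)) \<le> S \<and>
      (\<forall>w. cmod w = 1 \<longrightarrow> norm (B i w) \<le> S))"

lemma big_exists: "\<exists>S. big \<delta> S"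
proof -
  have "\<exists>K. \<forall>w. cmod w = 1 \<longrightarrow> norm (B i w) \<le> K" if "i < N" for i
    using entire_bounded[OF B_entire[OF that], of 1] by (metis order_refl)
  then obtain K where K: "\<And>i w. i < N \<Longrightarrow> cmod w = 1 \<Longrightarrow> norm (B i w) \<le> K i" by metis
  define s where "s i = norm (P i) + norm (Z i) + norm (p i) + norm (q i) + norm (A i) + norm (a i)
    + norm (Id (k i) - a i) + norm (Id (k i)) + \<bar>K i\<bar>" for i
  have s0: "s i \<ge> 0" for i by (simp add: s_def)
  define S where "S = 3 + \<bar>\<delta>\<bar> + norm pr + norm pc + norm (Id d) + sum s {..<N}"
  have ss: "sum s {..<N} \<ge> 0" using s0 by (intro sum_nonneg)
  have sS: "s i \<le> S" if "i < N" for i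
  proof -
    have "s i \<le> sum s {..<N}" using that s0 by (intro member_le_sum) auto
    then show ?thesis unfolding S_def using norm_ge_zero[of pr] norm_ge_zero[of pc] norm_ge_zero[of "Id d"] by linarith
  qed
  have parts: "norm (P i) \<le> S" "norm (Z i) \<le> S" "norm (p i) \<le> S" "norm (q i) \<le> S" "norm (A i) \<le> S"
      "norm (a i) \<le> S" "norm (Id (k i) - a i) \<le> S" "norm (Id (k i)) \<le> S" "K i \<le> S" if "i < N" for i
    using sS[OF that] unfolding s_def
    using norm_ge_zero[of "P i"] norm_ge_zero[of "Z i"] norm_ge_zero[of "p i"] norm_ge_zero[of "q i"] norm_ge_zero[of "A i"]
      norm_ge_zero[of "a i"] norm_ge_zero[of "Id (k i) - a i"] norm_ge_zero[of "Id (k i)"] abs_ge_self[of "K i"] abs_ge_zero[of "K i"]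
    by linarith+
  have "3 \<le> S" "\<delta> \<le> S" "norm pr \<le> S" "norm pc \<le> S" "norm (Id d) \<le> S"
    unfolding S_def using ss norm_ge_zero[of pr] norm_ge_zero[of pc] norm_ge_zero[of "Id d"] abs_ge_self[of \<delta>] abs_ge_zero[of \<delta>]
    by linarith+
  moreover have "norm (B i w) \<le> S" if "i < N" "cmod w = 1" for i w
    using K[OF that] parts(9)[OF that(1)] by linarith
  ultimately have "big \<delta> S" unfolding big_def using parts by blast
  then show ?thesis ..
qed

lemma norm_mult_le: "norm X \<le> x \<Longrightarrow> norm Y \<le> y \<Longrightarrow> norm (X * Y :: fmat) \<le> x * y"
  by (meson mult_mono norm_ge_zero norm_mult_ineq order_trans)

lemma norm_add_le: "norm X \<le> x \<Longrightarrow> norm Y \<le> y \<Longrightarrow> norm (X + Y :: fmat) \<le> x + y"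
  by (meson add_mono norm_triangle_ineq order_trans)

lemma norm_diff_le: "norm X \<le> x \<Longrightarrow> norm Y \<le> y \<Longrightarrow> norm (X - Y :: fmat) \<le> x + y"
  by (meson add_mono norm_triangle_ineq4 order_trans)

lemma norm_cscale_le: "cmod c \<le> x \<Longrightarrow> norm Y \<le> y \<Longrightarrow> norm (cscale c Y) \<le> x * y"
  unfolding norm_cscale by (meson mult_mono norm_ge_zero order_trans)

abbreviation circle_bound :: "real \<Rightarrow> real" where
  "circle_bound S \<equiv> S * ((S + 3 * S) * (S + 2)) * S"

abbreviation arc_bound :: "real \<Rightarrow> real" where
  "arc_bound S \<equiv> S * ((S * ((S + S * S) * (S + 1)) + 3 * (1 + 1 * ((S + S * S) * (S + 1)))) * S * S
    + (S + 3 * S) * (S + 2) * ((S + S * S) * S) * S * S)"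

lemma H_bound:
  assumes "big \<delta> S" "cmod e \<le> 3" "norm (cscale \<kappa> \<phi>) \<le> 2"
  shows "norm (H e \<kappa> \<phi>) \<le> (S + 3 * S) * (S + 2)"
  unfolding H_def using assms unfolding big_def
  by (intro norm_mult_le norm_add_le norm_diff_le norm_cscale_le) auto

text \<open>
  Multiplication from the right by the unipotent matrix \<open>g\<close> is a change of basis of \<open>V\<^sub>i\<close> that moves
  \<open>V\<^sub>i \<inter> E\<close> to the graph of \<open>\<eta>\<close>. There \<open>B i w\<close> takes values in the graph of \<open>\<phi>\<close>, up to the residual, and
  \<open>H\<close> multiplies these values by \<open>e\<close>. As the residual is at most comparable to \<open>e\<close>, the factor \<open>e\<close> splits
  off from \<open>r i\<close> columns of the matrix in a basis adapted to \<open>a i\<close>.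
\<close>

lemma det_on_arc:
  assumes big: "big \<delta> S" and i: "i < N" and \<phi>: "pc * \<phi> * pr = \<phi>" and \<eta>: "q i * \<eta> * p i = \<eta>" "\<eta> \<in> mats d d"
    and small: "norm \<phi> \<le> 1" "norm \<eta> \<le> 1" and w: "cmod (w - 1) \<le> \<delta>"
    and res: "norm ((pc - \<phi>) * (P i + cscale (w - 1) (Z i)) * (p i + \<eta>)) \<le> \<epsilon>"
    and e: "\<epsilon> / 3 \<le> cmod e" "cmod e \<le> 3" "\<epsilon> > 0" "\<epsilon> \<le> 1" and \<kappa>: "cmod (\<kappa> - 1) \<le> \<epsilon>"
    and C: "C \<in> mats (k i) d" "norm C \<le> S"
  shows "cmod (dt (k i) (C * H e \<kappa> \<phi> * B i w))
    \<le> fact (k i) * arc_bound S ^ k i * cmod e ^ r i"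
proof -
  note ps = p_simps[OF i] and qs = q_simps[OF i] and Ps = P_simps[OF i] and as = a_simps[OF i] and A = Am[OF i]
  have S: "S \<ge> 3" "norm pr \<le> S" "norm pc \<le> S" "norm (P i) \<le> S" "norm (Z i) \<le> S" "norm (p i) \<le> S" "norm (q i) \<le> S"
    "norm (A i) \<le> S" "norm (a i) \<le> S" "norm (Id (k i) - a i) \<le> S" "\<delta> \<le> S"
    using big i unfolding big_def by auto
  have e0: "e \<noteq> 0" using e by auto
  have pc\<phi>: "pc * \<phi> = \<phi>" by (metis \<phi> mult.assoc pc_simps(2))
  have pr\<phi>: "pr * \<phi> = 0" by (metis pc\<phi> mult.assoc pc_simps(4) mult_zero_left)
  have P\<eta>: "P i * \<eta> = \<eta>" by (metis \<eta>(1) mult.assoc qs(2))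
  have \<eta>p: "\<eta> * p i = \<eta>" by (metis \<eta>(1) mult.assoc ps(3))
  have pr\<eta>: "pr * \<eta> = 0" by (metis \<eta>(1) mult.assoc qs(4) mult_zero_left)
  have PAd: "P i * adj (A i) = adj (A i)"
    unfolding PA[OF i] mult.assoc AA[OF i] using A by (intro times_Id mats_adj)
  have PD: "P i = p i + q i"
    unfolding p_def q_def distrib_left[symmetric] pc_simps(5) using Ps by simp
  define D where "D = P i + cscale (w - 1) (Z i)"
  define F1 where "F1 = D * (p i + \<eta>)"
  define F2 where "F2 = D * q i"
  have Dn: "norm D \<le> S + S * S" unfolding D_def
    using S w by (intro norm_add_le norm_cscale_le) auto
  have F1n: "norm F1 \<le> (S + S * S) * (S + 1)" unfolding F1_def using Dn S small by (intro norm_mult_le norm_add_le)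
  have F2n: "norm F2 \<le> (S + S * S) * S" unfolding F2_def using Dn S by (intro norm_mult_le)
  define g where "g = Id (k i) + A i * \<eta> * adj (A i)"
  have \<nu>m: "A i * \<eta> * adj (A i) \<in> mats (k i) (k i)" using A \<eta>(2) by (intro mats_times_same mats_adj)
  have "a i * (A i * \<eta> * adj (A i)) = A i * (pr * (P i * \<eta>)) * adj (A i)"
    unfolding a_def PA[OF i] by (simp add: mult.assoc)
  then have \<nu>1: "a i * (A i * \<eta> * adj (A i)) = 0" by (simp add: P\<eta> pr\<eta>)
  have "A i * \<eta> * adj (A i) * a i = A i * (\<eta> * p i) * adj (A i)" by (simp add: mult.assoc as(4))
  then have \<nu>2: "A i * \<eta> * adj (A i) * a i = A i * \<eta> * adj (A i)" by (simp add: \<eta>p)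
  have dtg: "dt (k i) g = 1" unfolding g_def by (rule dt_unipotent[OF as(1) \<nu>m \<nu>1 \<nu>2])
  have "B i w * g = D * (adj (A i) * g)" unfolding B_eq[OF i] D_def by (simp add: mult.assoc)
  also have "adj (A i) * g = (P i + \<eta>) * adj (A i)"
  proof -
    have "adj (A i) * (A i * \<eta> * adj (A i)) = P i * \<eta> * adj (A i)" by (simp add: PA[OF i] mult.assoc)
    then show ?thesis
      unfolding g_def distrib_left distrib_right P\<eta> PAd by (simp add: times_Id[OF mats_adj[OF A]])
  qed
  also have "D * ((P i + \<eta>) * adj (A i)) = F1 * adj (A i) + F2 * adj (A i)"
    unfolding F1_def F2_def PD by (simp add: algebra_simps)
  finally have Bg: "B i w * g = F1 * adj (A i) + F2 * adj (A i)" .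
  have F1a: "F1 * adj (A i) = F1 * adj (A i) * a i"
  proof -
    have "F1 * adj (A i) * a i = D * ((p i + \<eta>) * p i) * adj (A i)" by (simp add: F1_def mult.assoc as(4))
    also have "(p i + \<eta>) * p i = p i + \<eta>" by (simp add: distrib_right ps(3) \<eta>p)
    finally show ?thesis by (simp add: F1_def)
  qed
  have F2a: "F2 * adj (A i) = F2 * adj (A i) * (Id (k i) - a i)"
  proof -
    have "q i * (adj (A i) * a i) = 0" unfolding as(4) by (metis mult.assoc ps(4) q_def mult_zero_left mult_zero_right)
    then have "F2 * adj (A i) * a i = 0" by (simp add: F2_def mult.assoc)
    then show ?thesis using A by (simp add: right_diff_distrib mult.assoc times_Id[OF mats_adj[OF A]])
  qed
  \<comment> \<open>The error: the residual, and the discrepancy between \<open>\<kappa>\<close> and \<open>1\<close>.\<close>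
  define R where "R = (pc - \<phi>) * F1 + cscale (1 - \<kappa>) (\<phi> * F1)"
  define X where "X = pr * F1 + cscale (1 / e) R"
  have HF1: "H e \<kappa> \<phi> * F1 = cscale e X"
  proof -
    have F1m: "F1 \<in> mats d d" unfolding F1_def D_def using Ps ps \<eta>(2) Zm[OF i] by (auto intro!: mats_intro)
    have "H e \<kappa> \<phi> * F1 = (pc + cscale e pr) * F1 - cscale \<kappa> ((pc * \<phi> + cscale e (pr * \<phi>)) * F1)"
      unfolding H_def by (simp add: mult.assoc left_diff_distrib right_diff_distrib Id_times[OF F1m] distrib_right cscale_plus)
    also have "\<dots> = cscale e (pr * F1) + (pc - cscale \<kappa> \<phi>) * F1"
      unfolding pc\<phi> pr\<phi> by (simp add: left_diff_distrib distrib_right)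
    also have "(pc - cscale \<kappa> \<phi>) * F1 = R"
      unfolding R_def by (simp add: left_diff_distrib cscale_diff_left)
    finally show ?thesis unfolding X_def using e0 by (simp add: cscale_plus)
  qed
  have Rn: "norm R \<le> \<epsilon> + \<epsilon> * (1 * ((S + S * S) * (S + 1)))"
    unfolding R_def
  proof (intro norm_add_le norm_cscale_le norm_mult_le[of \<phi>])
    show "norm ((pc - \<phi>) * F1) \<le> \<epsilon>" using res unfolding F1_def D_def by (simp add: mult.assoc)
    show "cmod (1 - \<kappa>) \<le> \<epsilon>" using \<kappa> by (simp add: norm_minus_commute)
  qed (use small F1n in auto)
  have Xn: "norm X \<le> S * ((S + S * S) * (S + 1)) + 3 * (1 + 1 * ((S + S * S) * (S + 1)))"
  proof -
    have "cmod (1 / e) \<le> 3 / \<epsilon>" using e e0 by (simp add: norm_divide field_simps)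
    then have "norm (cscale (1 / e) R) \<le> 3 / \<epsilon> * (\<epsilon> + \<epsilon> * (1 * ((S + S * S) * (S + 1))))"
      using Rn by (intro norm_cscale_le)
    also have "\<dots> = 3 * (1 + 1 * ((S + S * S) * (S + 1)))" using e(3) by (simp add: field_simps)
    finally show ?thesis unfolding X_def using S F1n by (intro norm_add_le norm_mult_le)
  qed
  have Hn: "norm (H e \<kappa> \<phi>) \<le> (S + 3 * S) * (S + 2)"
  proof (rule H_bound[OF big e(2)])
    have "cmod \<kappa> \<le> 1 + cmod (\<kappa> - 1)" by (metis add.commute diff_add_cancel norm_one norm_triangle_ineq)
    then have "cmod \<kappa> \<le> 2" using \<kappa> e(4) by linarith
    then show "norm (cscale \<kappa> \<phi>) \<le> 2" using small norm_cscale_le[of \<kappa> 2 \<phi> 1] by simp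
  qed
  define Y where "Y = C * (X * adj (A i) * a i + H e \<kappa> \<phi> * F2 * adj (A i) * (Id (k i) - a i))"
  have Yn: "norm Y \<le> arc_bound S"
    unfolding Y_def using C(2) Xn Hn F2n S by (intro norm_mult_le norm_add_le) auto
  have aid: "a i * (Id (k i) - a i) = 0" "(Id (k i) - a i) * a i = 0" "(Id (k i) - a i) * (Id (k i) - a i) = Id (k i) - a i"
    using as(2,3) by (simp_all add: algebra_simps Id_times[OF mats_Diag] Id_times[OF as(2)] times_Id[OF as(2)])
  have "C * H e \<kappa> \<phi> * B i w * g = C * (H e \<kappa> \<phi> * F1 * adj (A i) * a i + H e \<kappa> \<phi> * F2 * adj (A i) * (Id (k i) - a i))"
    by (subst mult.assoc, subst Bg, subst F1a, subst F2a) (simp add: distrib_left mult.assoc)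
  also have "\<dots> = Y * (Id (k i) - a i + cscale e (a i))"
    unfolding HF1 Y_def
    by (simp add: distrib_left distrib_right mult.assoc aid as(3) cscale_plus)
  finally have *: "C * H e \<kappa> \<phi> * B i w * g = Y * (Id (k i) - a i + cscale e (a i))" .
  have "dt (k i) (C * H e \<kappa> \<phi> * B i w) = dt (k i) (C * H e \<kappa> \<phi> * B i w * g)"
    using dtg by (subst dt_times) (auto simp: g_def intro!: mats_plus \<nu>m)
  also have "\<dots> = dt (k i) Y * e ^ r i"
    unfolding * as(6)[symmetric, of e] using as(2) by (intro dt_times disjI2) (auto intro!: mats_intro)
  finally have "cmod (dt (k i) (C * H e \<kappa> \<phi> * B i w)) = cmod (dt (k i) Y) * cmod e ^ r i"
    by (simp add: norm_mult norm_power)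
  also have "\<dots> \<le> fact (k i) * norm Y ^ k i * cmod e ^ r i"
    by (intro mult_right_mono norm_dt_le) auto
  also have "\<dots> \<le> fact (k i) * arc_bound S ^ k i * cmod e ^ r i"
    by (intro mult_right_mono mult_left_mono power_mono Yn) auto
  finally show ?thesis .
qed

lemma pr_corner: "pc * \<phi> * pr = \<phi> \<Longrightarrow> pr * \<phi> = 0 \<and> \<phi> * pr = \<phi>"
  by (metis mult.assoc pc_simps(4) pr_simps(3) mult_zero_left)

lemma dt_H:
  assumes "\<phi> \<in> mats d d" "pc * \<phi> * pr = \<phi>"
  shows "dt d (H e \<kappa> \<phi>) = e ^ r0"
proof -
  have "dt d (Id d + cscale (- \<kappa>) \<phi>) = 1"
    using assms pr_corner[OF assms(2)] by (intro dt_unipotent[OF proj]) (auto intro: mats_intro)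
  moreover have "Id d + cscale (- \<kappa>) \<phi> = Id d - cscale \<kappa> \<phi>" by (rule fmat_eqI) simp
  moreover have "pc + cscale e pr \<in> mats d d" using pc_simps pr_simps by (intro mats_intro)
  ultimately show ?thesis unfolding H_def by (simp add: dt_times r0)
qed

text \<open>
  The exponential of \<open>ln \<epsilon>\<close> times a function with real part close to \<open>\<psi>\<close> has modulus
  \<open>\<epsilon>\<close> to the power \<open>\<psi>\<close> on the circle, up to a factor in \<open>[1 / 3, 3]\<close>, and no zeros.
\<close>

lemma outer_function:
  fixes \<psi> :: "complex \<Rightarrow> real"
  assumes "continuous_on (sphere 0 1) \<psi>" "\<And>w. 0 \<le> \<psi> w \<and> \<psi> w \<le> 1" "0 < \<epsilon>" "\<epsilon> < 1"
  obtains e where "e holomorphic_on UNIV" "\<And>w. e w \<noteq> 0"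
    "\<And>w. cmod w = 1 \<Longrightarrow> \<epsilon> / 3 \<le> cmod (e w) \<and> cmod (e w) \<le> 3"
    "\<And>w. cmod w = 1 \<Longrightarrow> \<psi> w = 0 \<Longrightarrow> 1 / 3 \<le> cmod (e w)"
    "\<And>w. cmod w = 1 \<Longrightarrow> \<psi> w = 1 \<Longrightarrow> cmod (e w) \<le> 3 * \<epsilon>"
proof -
  define M where "M = - ln \<epsilon>"
  have M: "M > 0" "exp (- M) = \<epsilon>" using assms by (auto simp: M_def)
  obtain f where f: "f holomorphic_on UNIV" "\<And>w. cmod w = 1 \<Longrightarrow> \<bar>Re (f w) - \<psi> w\<bar> < 1 / M"
    using real_part_approximation[OF assms(1), of "1 / M"] M by auto
  define e where "e w = exp (- of_real M * f w)" for w
  have ce: "cmod (e w) = exp (- (M * Re (f w)))" for w by (simp add: e_def norm_exp_eq_Re)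
  have e3: "exp 1 \<le> (3 :: real)" by (rule exp_le)
  then have e3': "1 / 3 \<le> exp (- 1 :: real)" by (simp add: exp_minus field_simps)
  have b: "exp (- (M * \<psi> w)) * (1 / 3) \<le> cmod (e w)" "cmod (e w) \<le> exp (- (M * \<psi> w)) * 3" if w: "cmod w = 1" for w
  proof -
    have "M * \<bar>Re (f w) - \<psi> w\<bar> \<le> 1" using f(2)[OF w] M by (simp add: field_simps)
    then have "\<bar>M * Re (f w) - M * \<psi> w\<bar> \<le> 1" using M by (simp add: abs_mult flip: right_diff_distrib)
    then have 1: "- (M * \<psi> w) - 1 \<le> - (M * Re (f w))" "- (M * Re (f w)) \<le> - (M * \<psi> w) + 1" by linarith+
    have "exp (- (M * \<psi> w)) * (1 / 3) \<le> exp (- (M * \<psi> w)) * exp (- 1)" using e3' by (intro mult_left_mono) auto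
    also have "\<dots> = exp (- (M * \<psi> w) - 1)" by (simp flip: exp_add)
    also have "\<dots> \<le> cmod (e w)" unfolding ce using 1 by simp
    finally show "exp (- (M * \<psi> w)) * (1 / 3) \<le> cmod (e w)" .
    have "cmod (e w) \<le> exp (- (M * \<psi> w) + 1)" unfolding ce using 1 by simp
    also have "\<dots> = exp (- (M * \<psi> w)) * exp 1" by (rule exp_add)
    also have "\<dots> \<le> exp (- (M * \<psi> w)) * 3" using e3 by (intro mult_left_mono) auto
    finally show "cmod (e w) \<le> exp (- (M * \<psi> w)) * 3" .
  qed
  show ?thesis
  proof (rule that[of e])
    show "e holomorphic_on UNIV" unfolding e_def using f(1) by (intro holomorphic_intros)
    show "e w \<noteq> 0" for w by (simp add: e_def)
    fix w :: complex assume w: "cmod w = 1"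
    have "M * \<psi> w \<le> M * 1" using assms(2) M by (intro mult_left_mono) auto
    then have "\<epsilon> \<le> exp (- (M * \<psi> w))" unfolding M(2)[symmetric] by simp
    moreover have "M * \<psi> w \<ge> 0" using assms(2) M by (intro mult_nonneg_nonneg) auto
    then have "exp (- (M * \<psi> w)) \<le> 1" by simp
    ultimately show "\<epsilon> / 3 \<le> cmod (e w) \<and> cmod (e w) \<le> 3" using b[OF w] by linarith
    show "1 / 3 \<le> cmod (e w)" if "\<psi> w = 0" using b[OF w] that by simp
    show "cmod (e w) \<le> 3 * \<epsilon>" if "\<psi> w = 1" using b[OF w] that M(2) by simp
  qed
qed

text \<open>
  The function \<open>H (e w) (\<kappa> w) (\<phi> w)\<close> has the required sizes on the circle if \<open>\<kappa>\<close> is close to a cutoff that is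
  \<open>1\<close> on the arc and \<open>0\<close> where \<open>\<phi>\<close> is not controlled. Such a \<open>\<kappa>\<close> is a Laurent polynomial; clearing its
  denominator \<open>w ^ L\<close> makes the function entire, at the price of a zero of the determinant at the origin,
  which \<open>blaschke_potapov\<close> removes. The changes have modulus one or are unitary on the circle, so they
  do not affect the estimates there.
\<close>

lemma destabilising_factor:
  assumes \<delta>: "\<delta> > 0" and big: "big \<delta> S" and \<epsilon>: "0 < \<epsilon>" "\<epsilon> < 1"
    and graph: "entire d d \<phi>" "\<And>i. i < N \<Longrightarrow> entire d d (\<lambda>w. \<eta> w i)" "\<And>w. pc * \<phi> w * pr = \<phi> w"
      "\<And>w i. i < N \<Longrightarrow> q i * \<eta> w i * p i = \<eta> w i"
      "\<And>w. cmod (w - 1) \<le> \<delta> \<Longrightarrow> norm (\<phi> w) \<le> 1"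
      "\<And>w i. i < N \<Longrightarrow> cmod (w - 1) \<le> \<delta> \<Longrightarrow> norm (\<eta> w i) \<le> 1"
      "\<And>w i. i < N \<Longrightarrow> cmod (w - 1) \<le> \<delta> \<Longrightarrow>
        norm ((pc - \<phi> w) * (P i + cscale (w - 1) (Z i)) * (p i + \<eta> w i)) \<le> \<epsilon>"
  obtains G e where "entire d d G" "e holomorphic_on UNIV" "\<And>w. e w \<noteq> 0" "\<And>w. dt d (G w) = e w ^ r0"
    "\<And>w i C. cmod w = 1 \<Longrightarrow> i < N \<Longrightarrow> C \<in> mats (k i) d \<Longrightarrow> C * adj C = Id (k i) \<Longrightarrow>
      cmod (dt (k i) (C * G w * B i w)) \<le> fact (k i) * circle_bound S ^ k i"
    "\<And>w i C. cmod w = 1 \<Longrightarrow> cmod (w - 1) \<le> 2 * \<delta> / 3 \<Longrightarrow> i < N \<Longrightarrow> C \<in> mats (k i) d \<Longrightarrow> C * adj C = Id (k i) \<Longrightarrow>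
      cmod (dt (k i) (C * G w * B i w)) \<le> fact (k i) * arc_bound S ^ k i * cmod (e w) ^ r i"
    "\<And>w. cmod w = 1 \<Longrightarrow> cmod (e w) \<le> 3"
    "\<And>w. cmod w = 1 \<Longrightarrow> 2 * \<delta> / 3 \<le> cmod (w - 1) \<Longrightarrow> 1 / 3 \<le> cmod (e w)"
    "\<And>w. cmod w = 1 \<Longrightarrow> cmod (w - 1) < \<delta> / 3 \<Longrightarrow> cmod (e w) \<le> 3 * \<epsilon>"
proof -
  \<comment> \<open>The factor \<open>e\<close> is small for \<open>|w - 1| \<le> \<delta> / 3\<close> and of order \<open>1\<close> for \<open>|w - 1| \<ge> 2 * \<delta> / 3\<close>; the cutoff \<open>\<kappa>0\<close>
    stays at \<open>1\<close> up to \<open>2 * \<delta> / 3\<close> and vanishes beyond \<open>\<delta>\<close>. Hence \<open>\<phi>\<close> is fully switched on wherever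
    \<open>e\<close> may be small.\<close>
  define \<psi> where "\<psi> w = max 0 (min 1 (2 - 3 * cmod (w - 1) / \<delta>))" for w :: complex
  have \<psi>c: "continuous_on (sphere 0 1) \<psi>" unfolding \<psi>_def using \<delta> by (intro continuous_intros) auto
  have \<psi>01: "0 \<le> \<psi> w \<and> \<psi> w \<le> 1" for w by (auto simp: \<psi>_def)
  obtain e where e: "e holomorphic_on UNIV" "\<And>w. e w \<noteq> 0"
    "\<And>w. cmod w = 1 \<Longrightarrow> \<epsilon> / 3 \<le> cmod (e w) \<and> cmod (e w) \<le> 3"
    "\<And>w. cmod w = 1 \<Longrightarrow> \<psi> w = 0 \<Longrightarrow> 1 / 3 \<le> cmod (e w)"
    "\<And>w. cmod w = 1 \<Longrightarrow> \<psi> w = 1 \<Longrightarrow> cmod (e w) \<le> 3 * \<epsilon>"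
    using outer_function[OF \<psi>c \<psi>01 \<epsilon>] by blast
  define \<kappa>0 where "\<kappa>0 w = max 0 (min 1 (3 - 3 * cmod (w - 1) / \<delta>))" for w :: complex
  have \<kappa>0c: "continuous_on (sphere 0 1) \<kappa>0" unfolding \<kappa>0_def using \<delta> by (intro continuous_intros) auto
  obtain K\<phi> where K\<phi>: "K\<phi> > 0" "\<And>w. cmod w \<le> 1 \<Longrightarrow> norm (\<phi> w) \<le> K\<phi>"
    using entire_bounded[OF graph(1), of 1] by blast
  \<comment> \<open>The accuracy compensates for the size of \<open>\<phi>\<close> away from the arc.\<close>
  have "\<epsilon> / (1 + K\<phi>) > 0" using \<epsilon> K\<phi> by simp
  then obtain L c where c: "c holomorphic_on UNIV"
    "\<And>w. cmod w = 1 \<Longrightarrow> cmod (c w / w ^ L - of_real (\<kappa>0 w)) < \<epsilon> / (1 + K\<phi>)"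
    using laurent_approximation[OF \<kappa>0c] by metis
  define \<kappa> where "\<kappa> w = c w / w ^ L" for w
  have c\<epsilon>: "cmod (\<kappa> w - of_real (\<kappa>0 w)) \<le> \<epsilon>" if "cmod w = 1" for w
  proof -
    have "\<epsilon> / (1 + K\<phi>) \<le> \<epsilon> / 1" using \<epsilon> K\<phi> by (intro divide_left_mono) auto
    then show ?thesis using c(2)[OF that] unfolding \<kappa>_def by simp
  qed
  have \<kappa>\<phi>: "norm (cscale (\<kappa> w) (\<phi> w)) \<le> 2" if w: "cmod w = 1" for w
  proof (cases "cmod (w - 1) \<le> \<delta>")
    case True
    have "cmod (of_real (\<kappa>0 w)) \<le> 1" by (simp add: \<kappa>0_def)
    then have "cmod (\<kappa> w) \<le> 2" using c\<epsilon>[OF w] \<epsilon> norm_triangle_sub[of "\<kappa> w" "of_real (\<kappa>0 w)"] by linarith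
    then show ?thesis using norm_cscale_le[of "\<kappa> w" 2 "\<phi> w" 1] graph(5)[OF True] by simp
  next
    case False
    then have "\<kappa>0 w = 0" using \<delta> by (simp add: \<kappa>0_def field_simps)
    then have "cmod (\<kappa> w) \<le> 1 / (1 + K\<phi>)"
      using c(2)[OF w] \<epsilon> K\<phi> unfolding \<kappa>_def by (auto intro: order_trans[OF less_imp_le] simp: divide_right_mono)
    then have "norm (cscale (\<kappa> w) (\<phi> w)) \<le> 1 / (1 + K\<phi>) * K\<phi>"
      using K\<phi>(2)[of w] w by (intro norm_cscale_le) auto
    also have "\<dots> \<le> 2" using K\<phi>(1) by (simp add: field_simps)
    finally show ?thesis .
  qed
  define G0 where "G0 w = (pc + cscale (e w) pr) * (cscale (w ^ L) (Id d) - cscale (c w) (\<phi> w))" for w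
  have G0: "entire d d G0" unfolding G0_def
    using graph(1) e(1) c(1) pc_simps pr_simps by (intro entire_intros) (auto intro!: holomorphic_intros)
  have G0H: "G0 w = cscale (w ^ L) (H (e w) (\<kappa> w) (\<phi> w))" if "w \<noteq> 0" for w
  proof -
    have "cscale (w ^ L) (Id d) - cscale (c w) (\<phi> w) = cscale (w ^ L) (Id d - cscale (\<kappa> w) (\<phi> w))"
      using that by (simp add: \<kappa>_def cscale_minus)
    then show ?thesis unfolding G0_def H_def by simp
  qed
  have dtG0: "dt d (G0 w) = w ^ (L * d) * e w ^ r0" for w
  proof (rule holomorphic_eq_at_0[where f = "\<lambda>w. dt d (G0 w)" and g = "\<lambda>w. w ^ (L * d) * e w ^ r0"])
    show "(\<lambda>w. dt d (G0 w)) holomorphic_on UNIV" by (rule entire_dt[OF G0])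
    show "(\<lambda>w. w ^ (L * d) * e w ^ r0) holomorphic_on UNIV" using e(1) by (intro holomorphic_intros)
    show "dt d (G0 w) = w ^ (L * d) * e w ^ r0" if "w \<noteq> 0" for w
      unfolding G0H[OF that] dt_cscale dt_H[OF entire_mats[OF graph(1)] graph(3)] by (simp add: power_mult)
  qed
  have er: "(\<lambda>w. e w ^ r0) holomorphic_on UNIV" using e(1) by (intro holomorphic_intros)
  obtain G where G: "entire d d G" "\<And>w. dt d (G w) = e w ^ r0"
    "\<And>w. cmod w = 1 \<Longrightarrow> \<exists>U. unitary d U \<and> G w = U * G0 w"
    using blaschke_potapov[OF G0 er dtG0] by blast
  have key: "\<exists>C'. C' \<in> mats (k i) d \<and> norm C' \<le> S \<and>
      cmod (dt (k i) (C * G w * B i w)) = cmod (dt (k i) (C' * H (e w) (\<kappa> w) (\<phi> w) * B i w))"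
    if w: "cmod w = 1" and i: "i < N" and C: "C \<in> mats (k i) d" "C * adj C = Id (k i)" for w i C
  proof -
    obtain U where U: "unitary d U" "G w = U * G0 w" using G(3)[OF w] by blast
    have w0: "w \<noteq> 0" using w by auto
    have "C * G w * B i w = cscale (w ^ L) (C * U * H (e w) (\<kappa> w) (\<phi> w) * B i w)"
      unfolding U(2) G0H[OF w0] by (simp add: mult.assoc)
    then have "cmod (dt (k i) (C * G w * B i w)) = cmod (dt (k i) (C * U * H (e w) (\<kappa> w) (\<phi> w) * B i w))"
      using w by (simp add: dt_cscale norm_mult norm_power)
    moreover have "norm (C * U) \<le> S"
      using norm_times_unitary[OF U(1) C(1)] coisometry_norm[OF C(2)] big i by (simp add: big_def)
    moreover have "C * U \<in> mats (k i) d" using C U by (auto simp: unitary_def intro: mats_intro)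
    ultimately show ?thesis by blast
  qed
  show ?thesis
  proof (rule that[OF G(1) e(1,2) G(2)])
    fix w i C assume *: "cmod w = 1" "i < N" "C \<in> mats (k i) d" "C * adj C = Id (k i)"
    obtain C' where C': "C' \<in> mats (k i) d" "norm C' \<le> S"
      "cmod (dt (k i) (C * G w * B i w)) = cmod (dt (k i) (C' * H (e w) (\<kappa> w) (\<phi> w) * B i w))"
      using key[OF *] by blast
    have "norm (C' * H (e w) (\<kappa> w) (\<phi> w) * B i w) \<le> circle_bound S"
      using C'(2) H_bound[OF big conjunct2[OF e(3)[OF *(1)]] \<kappa>\<phi>[OF *(1)]] big *
      by (intro norm_mult_le) (auto simp: big_def)
    then have "norm (C' * H (e w) (\<kappa> w) (\<phi> w) * B i w) ^ k i \<le> circle_bound S ^ k i"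
      by (intro power_mono) auto
    then show "cmod (dt (k i) (C * G w * B i w)) \<le> fact (k i) * circle_bound S ^ k i"
      unfolding C'(3) by (intro order_trans[OF norm_dt_le] mult_left_mono) auto
  next
    fix w i C assume w: "cmod w = 1" "cmod (w - 1) \<le> 2 * \<delta> / 3" and i: "i < N"
      and C: "C \<in> mats (k i) d" "C * adj C = Id (k i)"
    obtain C' where C': "C' \<in> mats (k i) d" "norm C' \<le> S"
      "cmod (dt (k i) (C * G w * B i w)) = cmod (dt (k i) (C' * H (e w) (\<kappa> w) (\<phi> w) * B i w))"
      using key[OF w(1) i C] by blast
    have w\<delta>: "cmod (w - 1) \<le> \<delta>" using w \<delta> by linarith
    have "\<kappa>0 w = 1" using w \<delta> by (simp add: \<kappa>0_def field_simps)
    then have "cmod (\<kappa> w - 1) \<le> \<epsilon>" using c\<epsilon>[OF w(1)] by simp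
    then show "cmod (dt (k i) (C * G w * B i w)) \<le> fact (k i) * arc_bound S ^ k i * cmod (e w) ^ r i"
      unfolding C'(3) using w w\<delta> e(3)[OF w(1)] \<epsilon>
      by (intro det_on_arc[OF big i graph(3) graph(4)[OF i] entire_mats[OF graph(2)[OF i]] graph(5)[OF w\<delta>]
            graph(6)[OF i w\<delta>] w\<delta> graph(7)[OF i w\<delta>] _ _ _ _ _ C'(1,2)]) auto
  next
    fix w :: complex assume w: "cmod w = 1"
    show "cmod (e w) \<le> 3" using e(3)[OF w] by blast
    show "1 / 3 \<le> cmod (e w)" if "2 * \<delta> / 3 \<le> cmod (w - 1)"
      using that \<delta> by (intro e(4)[OF w]) (simp add: \<psi>_def field_simps)
    show "cmod (e w) \<le> 3 * \<epsilon>" if "cmod (w - 1) < \<delta> / 3"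
      using that \<delta> by (intro e(5)[OF w]) (simp add: \<psi>_def field_simps)
  qed
qed

text \<open>
  The quotient \<open>Q\<close> satisfies the hypotheses of \<open>two_constants\<close>: it is at least \<open>1\<close> at the origin by
  \<open>tight_frame_capacity\<close>, it is bounded on the circle independently of \<open>\<epsilon>\<close>, and near \<open>1\<close> it is of order \<open>\<epsilon>\<close>,
  because the assumption \<open>unstable\<close> leaves at least one factor \<open>e\<close> in the numerator.
\<close>

theorem not_tight:
  assumes tight: "(\<Sum>i<N. adj (T i) * T i) = c *\<^sub>R Id d" and c: "c * real d = real (sum k {..<N})"
    and unstable: "sum k {..<N} * r0 < d * (\<Sum>i<N. r i)"
  shows False
proof -
  obtain \<delta> where \<delta>: "\<delta> > 0" and graphs:
    "\<And>\<epsilon>. \<epsilon> > 0 \<Longrightarrow> \<exists>\<phi> \<eta>. entire d d \<phi> \<and> (\<forall>i<N. entire d d (\<lambda>w. \<eta> w i)) \<and>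
      (\<forall>w. pc * \<phi> w * pr = \<phi> w) \<and> (\<forall>w. \<forall>i<N. q i * \<eta> w i * p i = \<eta> w i) \<and>
      (\<forall>w. cmod (w - 1) \<le> \<delta> \<longrightarrow> norm (\<phi> w) \<le> 1 \<and> (\<forall>i<N. norm (\<eta> w i) \<le> 1 \<and>
        norm ((pc - \<phi> w) * (P i + cscale (w - 1) (Z i)) * (p i + \<eta> w i)) \<le> \<epsilon>))"
    using approximate_graphs by blast
  obtain S where big: "big \<delta> S" using big_exists by blast
  define n where "n = sum k {..<N}"
  define s where "s = d * (\<Sum>i<N. r i) - n * r0"
  have s: "s \<ge> 1" "d * (\<Sum>i<N. r i) = s + n * r0" using unstable by (auto simp: s_def n_def)
  define K1 where "K1 i = fact (k i) * circle_bound S ^ k i" for i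
  define K2 where "K2 i = fact (k i) * arc_bound S ^ k i" for i
  define KK where "KK = (\<Prod>i<N. (1 + \<bar>K1 i\<bar> + \<bar>K2 i\<bar>) ^ d)"
  have KK: "KK \<ge> 1" unfolding KK_def by (intro prod_ge_1 one_le_power) auto
  define K where "K = KK * 3 ^ (s + n * r0)"
  have K: "K \<ge> 1"
  proof -
    have "1 * 1 \<le> KK * 3 ^ (s + n * r0)" using KK by (intro mult_mono) auto
    then show ?thesis by (simp add: K_def)
  qed
  show False
  proof (rule two_constants[of "\<delta> / 3" K])
    fix \<epsilon> :: real assume \<epsilon>: "0 < \<epsilon>" "\<epsilon> < 1"
    obtain \<phi> \<eta> where g0: "entire d d \<phi> \<and> (\<forall>i<N. entire d d (\<lambda>w. \<eta> w i)) \<and>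
      (\<forall>w. pc * \<phi> w * pr = \<phi> w) \<and> (\<forall>w. \<forall>i<N. q i * \<eta> w i * p i = \<eta> w i) \<and>
      (\<forall>w. cmod (w - 1) \<le> \<delta> \<longrightarrow> norm (\<phi> w) \<le> 1 \<and> (\<forall>i<N. norm (\<eta> w i) \<le> 1 \<and>
        norm ((pc - \<phi> w) * (P i + cscale (w - 1) (Z i)) * (p i + \<eta> w i)) \<le> \<epsilon>))"
      using graphs[OF \<epsilon>(1)] by (elim exE) (rule that)
    have g: "entire d d \<phi>" "\<And>i. i < N \<Longrightarrow> entire d d (\<lambda>w. \<eta> w i)" "\<And>w. pc * \<phi> w * pr = \<phi> w"
      "\<And>w i. i < N \<Longrightarrow> q i * \<eta> w i * p i = \<eta> w i"
      "\<And>w. cmod (w - 1) \<le> \<delta> \<Longrightarrow> norm (\<phi> w) \<le> 1"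
      "\<And>w i. i < N \<Longrightarrow> cmod (w - 1) \<le> \<delta> \<Longrightarrow> norm (\<eta> w i) \<le> 1"
      "\<And>w i. i < N \<Longrightarrow> cmod (w - 1) \<le> \<delta> \<Longrightarrow>
        norm ((pc - \<phi> w) * (P i + cscale (w - 1) (Z i)) * (p i + \<eta> w i)) \<le> \<epsilon>"
      using g0 by auto
    obtain G e where G: "entire d d G" "e holomorphic_on UNIV" "\<And>w. e w \<noteq> 0" "\<And>w. dt d (G w) = e w ^ r0"
      "\<And>w i C. cmod w = 1 \<Longrightarrow> i < N \<Longrightarrow> C \<in> mats (k i) d \<Longrightarrow> C * adj C = Id (k i) \<Longrightarrow>
        cmod (dt (k i) (C * G w * B i w)) \<le> K1 i"
      "\<And>w i C. cmod w = 1 \<Longrightarrow> cmod (w - 1) \<le> 2 * \<delta> / 3 \<Longrightarrow> i < N \<Longrightarrow> C \<in> mats (k i) d \<Longrightarrow> C * adj C = Id (k i) \<Longrightarrow>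
        cmod (dt (k i) (C * G w * B i w)) \<le> K2 i * cmod (e w) ^ r i"
      "\<And>w. cmod w = 1 \<Longrightarrow> cmod (e w) \<le> 3"
      "\<And>w. cmod w = 1 \<Longrightarrow> 2 * \<delta> / 3 \<le> cmod (w - 1) \<Longrightarrow> 1 / 3 \<le> cmod (e w)"
      "\<And>w. cmod w = 1 \<Longrightarrow> cmod (w - 1) < \<delta> / 3 \<Longrightarrow> cmod (e w) \<le> 3 * \<epsilon>"
    proof (rule destabilising_factor[OF \<delta> big \<epsilon>, where \<phi> = \<phi> and \<eta> = \<eta>, folded K1_def K2_def])
      show "entire d d (\<lambda>w. \<eta> w i)" if "i < N" for i using g(2) that .
      show "q i * \<eta> w i * p i = \<eta> w i" if "i < N" for w i using g(4) that .
      show "norm (\<phi> w) \<le> 1" if "cmod (w - 1) \<le> \<delta>" for w using g(5) that .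
      show "norm (\<eta> w i) \<le> 1" if "i < N" "cmod (w - 1) \<le> \<delta>" for w i using g(6) that .
      show "norm ((pc - \<phi> w) * (P i + cscale (w - 1) (Z i)) * (p i + \<eta> w i)) \<le> \<epsilon>"
        if "i < N" "cmod (w - 1) \<le> \<delta>" for w i using g(7) that .
    qed (use g(1,3) that in blast)+
    have dtG0: "dt d (G 0) \<noteq> 0" using G(3,4) by simp
    obtain C where C: "\<And>i. i < N \<Longrightarrow> C i \<in> mats (k i) d" "\<And>i. i < N \<Longrightarrow> C i * adj (C i) = Id (k i)"
      "\<And>i. i < N \<Longrightarrow> dt (k i) (C i * G 0 * adj (T i)) \<noteq> 0"
      "c * ln (cmod (dt d (G 0))) \<le> (\<Sum>i<N. ln (cmod (dt (k i) (C i * G 0 * adj (T i)))))"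
      using tight_frame_capacity[OF Tm TT tight entire_mats[OF G(1)] dtG0] by blast
    define D where "D i w = dt (k i) (C i * G w * B i w)" for i w
    define Q where "Q w = (\<Prod>i<N. D i w ^ d) / e w ^ (n * r0)" for w
    have Dh: "D i holomorphic_on UNIV" if "i < N" for i
      unfolding D_def using entire_times[OF entire_times[OF entire_const[OF C(1)[OF that]] G(1)] B_entire[OF that]]
      by (rule entire_dt)
    have Qn: "cmod (Q w) = (\<Prod>i<N. cmod (D i w) ^ d) / cmod (e w) ^ (n * r0)" for w
      by (simp add: Q_def norm_divide prod_norm[symmetric] norm_power)
    have "Q holomorphic_on UNIV"
      unfolding Q_def using Dh G(2,3) by (intro holomorphic_intros) auto
    moreover have "1 \<le> cmod (Q 0)"
    proof -
      have D0: "D i 0 = dt (k i) (C i * G 0 * adj (T i))" for i by (simp add: D_def B_def)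
      define x where "x = (\<Prod>i<N. cmod (D i 0))"
      define y where "y = cmod (dt d (G 0))"
      have x0: "x > 0" unfolding x_def using C(3) by (intro prod_pos) (auto simp: D0)
      have y0: "y > 0" using dtG0 by (simp add: y_def)
      have "ln x = (\<Sum>i<N. ln (cmod (D i 0)))" unfolding x_def using C(3) by (subst ln_prod) (auto simp: D0)
      then have "c * ln y \<le> ln x" using C(4) by (simp add: D0 y_def)
      then have "real d * (c * ln y) \<le> real d * ln x" by (intro mult_left_mono) auto
      moreover have "real d * (c * ln y) = real n * ln y" using c by (simp add: n_def mult_ac)
      ultimately have "ln (y ^ n) \<le> ln (x ^ d)" using x0 y0 by (simp add: ln_realpow)
      then have "y ^ n \<le> x ^ d" using x0 y0 by (subst (asm) ln_le_cancel_iff) auto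
      moreover have "y ^ n = cmod (e 0) ^ (n * r0)"
        unfolding y_def G(4) by (simp add: norm_power mult.commute flip: power_mult)
      ultimately show ?thesis unfolding Qn x_def using G(3)[of 0] by (simp add: prod_power_distrib)
    qed
    moreover have arc: "cmod (Q w) \<le> KK * cmod (e w) ^ s" if w: "cmod w = 1" "cmod (w - 1) \<le> 2 * \<delta> / 3" for w
    proof -
      have "(\<Prod>i<N. cmod (D i w) ^ d) \<le> (\<Prod>i<N. ((1 + \<bar>K1 i\<bar> + \<bar>K2 i\<bar>) * cmod (e w) ^ r i) ^ d)"
      proof (intro prod_mono conjI power_mono)
        fix i assume "i \<in> {..<N}"
        then have i: "i < N" by simp
        have "cmod (D i w) \<le> K2 i * cmod (e w) ^ r i" unfolding D_def using w C i by (intro G(6))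
        also have "\<dots> \<le> (1 + \<bar>K1 i\<bar> + \<bar>K2 i\<bar>) * cmod (e w) ^ r i" by (intro mult_right_mono) auto
        finally show "cmod (D i w) \<le> (1 + \<bar>K1 i\<bar> + \<bar>K2 i\<bar>) * cmod (e w) ^ r i" .
      qed auto
      also have "\<dots> = KK * cmod (e w) ^ (d * (\<Sum>i<N. r i))"
        unfolding KK_def by (simp add: power_mult_distrib prod.distrib power_sum sum_distrib_left mult.commute flip: power_mult)
      finally have "(\<Prod>i<N. cmod (D i w) ^ d) \<le> KK * cmod (e w) ^ s * cmod (e w) ^ (n * r0)"
        unfolding s(2) by (simp add: power_add mult.assoc)
      then show ?thesis unfolding Qn using G(3)[of w] by (simp add: divide_le_eq)
    qed
    moreover have "cmod (Q w) \<le> K" if w: "cmod w = 1" for w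
    proof (cases "cmod (w - 1) \<le> 2 * \<delta> / 3")
      case True
      have "KK * cmod (e w) ^ s \<le> KK * 3 ^ s" using KK G(7)[OF w] by (intro mult_left_mono power_mono) auto
      also have "\<dots> \<le> KK * 3 ^ (s + n * r0)" using KK by (intro mult_left_mono power_increasing) auto
      finally show ?thesis using arc[OF w True] by (simp add: K_def)
    next
      case False
      then have e3: "1 / 3 \<le> cmod (e w)" by (intro G(8)[OF w]) simp
      have "(\<Prod>i<N. cmod (D i w) ^ d) \<le> KK"
        unfolding KK_def
      proof (intro prod_mono conjI power_mono)
        fix i assume "i \<in> {..<N}"
        then have i: "i < N" by simp
        have "cmod (D i w) \<le> K1 i" unfolding D_def using w C i by (intro G(5))
        then show "cmod (D i w) \<le> 1 + \<bar>K1 i\<bar> + \<bar>K2 i\<bar>" by linarith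
      qed auto
      moreover have "(1 / 3) ^ (n * r0) \<le> cmod (e w) ^ (n * r0)" using e3 by (intro power_mono) auto
      ultimately have "cmod (Q w) \<le> KK / (1 / 3) ^ (n * r0)" unfolding Qn using KK by (intro frac_le) auto
      also have "\<dots> = KK * 3 ^ (n * r0)" by (simp add: power_one_over)
      also have "\<dots> \<le> KK * 3 ^ (s + n * r0)" using KK by (intro mult_left_mono power_increasing) auto
      finally show ?thesis by (simp add: K_def)
    qed
    moreover have "cmod (Q w) \<le> K * \<epsilon>" if w: "cmod w = 1" "cmod (w - 1) < \<delta> / 3" for w
    proof -
      have "cmod (e w) ^ s \<le> (3 * \<epsilon>) ^ s" using G(9)[OF w] by (intro power_mono) auto
      also have "\<dots> = 3 ^ s * \<epsilon> ^ s" by (rule power_mult_distrib)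
      also have "\<dots> \<le> 3 ^ s * \<epsilon> ^ 1" using s(1) \<epsilon> by (intro mult_left_mono power_decreasing) auto
      finally have "KK * cmod (e w) ^ s \<le> KK * (3 ^ s * \<epsilon>)" using KK by (intro mult_left_mono) auto
      also have "\<dots> \<le> KK * (3 ^ (s + n * r0) * \<epsilon>)"
        using KK \<epsilon> by (intro mult_left_mono mult_right_mono power_increasing) auto
      finally show ?thesis using arc[of w] w \<delta> by (simp add: K_def mult.assoc)
    qed
    ultimately show "\<exists>Q. Q holomorphic_on UNIV \<and> 1 \<le> cmod (Q 0) \<and>
      (\<forall>w. cmod w = 1 \<longrightarrow> cmod (Q w) \<le> K) \<and> (\<forall>w. cmod w = 1 \<longrightarrow> cmod (w - 1) < \<delta> / 3 \<longrightarrow> cmod (Q w) \<le> K * \<epsilon>)"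
      by blast
  qed (use \<delta> K in auto)
qed

end

section \<open>First and second variation\<close>

text \<open>
  Real frames are regarded as complex frames with real entries. The flag \<open>re\<close> selects whether this
  reality condition is imposed, so that the real and the complex case have a common proof.
\<close>

definition rl :: "bool \<Rightarrow> fmat \<Rightarrow> bool" where
  "rl re M \<longleftrightarrow> (re \<longrightarrow> cconj M = M)"

text \<open>
  The function \<open>(norm (S + t S1 + ...))\<^sup>2\<close> is \<open>(norm S)\<^sup>2 + b t + c t\<^sup>2\<close> up to a cubic error. At a minimum at
  \<open>0\<close>, the coefficient \<open>b\<close> vanishes and \<open>c\<close> is nonnegative.
\<close>

lemma second_order_test:
  fixes S S1 S2 :: "'a :: real_inner"
  assumes \<tau>: "\<tau> > 0" and R: "\<And>t. \<bar>t\<bar> < \<tau> \<Longrightarrow> norm (R t) \<le> K"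
    and min: "\<And>t. \<bar>t\<bar> < \<tau> \<Longrightarrow> norm S \<le> norm (S + t *\<^sub>R S1 + t\<^sup>2 *\<^sub>R S2 + t ^ 3 *\<^sub>R R t)"
  shows "inner S S1 = 0" "0 \<le> (norm S1)\<^sup>2 + 2 * inner S S2"
proof -
  define b where "b = 2 * inner S S1"
  define c where "c = (norm S1)\<^sup>2 + 2 * inner S S2"
  define \<rho> where "\<rho> t = 2 * inner S (R t) + 2 * inner S1 S2 + t * ((norm S2)\<^sup>2 + 2 * inner S1 (R t))
    + t\<^sup>2 * (2 * inner S2 (R t)) + t ^ 3 * (norm (R t))\<^sup>2" for t
  define L where "L = 2 * (norm S * K) + 2 * (norm S1 * norm S2) + ((norm S2)\<^sup>2 + 2 * (norm S1 * K)) + 2 * (norm S2 * K) + K\<^sup>2"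
  have K0: "K \<ge> 0" using order_trans[OF norm_ge_zero R[of 0]] \<tau> by simp
  have L: "\<bar>\<rho> t\<bar> \<le> L" if t: "\<bar>t\<bar> < \<tau>" "\<bar>t\<bar> \<le> 1" for t
  proof -
    have cs: "\<bar>inner x (R t)\<bar> \<le> norm x * K" for x
      by (rule order_trans[OF Cauchy_Schwarz_ineq2]) (intro mult_left_mono R t norm_ge_zero)
    have 1: "\<bar>2 * inner S (R t)\<bar> \<le> 2 * (norm S * K)" using cs[of S] by simp
    have 2: "\<bar>2 * inner S1 S2\<bar> \<le> 2 * (norm S1 * norm S2)" using Cauchy_Schwarz_ineq2[of S1 S2] by simp
    have "\<bar>t\<bar> * \<bar>(norm S2)\<^sup>2 + 2 * inner S1 (R t)\<bar> \<le> 1 * ((norm S2)\<^sup>2 + 2 * (norm S1 * K))"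
      using cs[of S1] t(2) by (intro mult_mono order_trans[OF abs_triangle_ineq] add_mono) auto
    then have 3: "\<bar>t * ((norm S2)\<^sup>2 + 2 * inner S1 (R t))\<bar> \<le> (norm S2)\<^sup>2 + 2 * (norm S1 * K)" by (simp add: abs_mult)
    have "\<bar>t\<bar> ^ 2 * \<bar>2 * inner S2 (R t)\<bar> \<le> 1 * (2 * (norm S2 * K))"
      using cs[of S2] t(2) by (intro mult_mono power_le_one) auto
    then have 4: "\<bar>t\<^sup>2 * (2 * inner S2 (R t))\<bar> \<le> 2 * (norm S2 * K)" by (simp add: abs_mult)
    have "\<bar>t\<bar> ^ 3 * (norm (R t))\<^sup>2 \<le> 1 * K\<^sup>2"
      using R[OF t(1)] t(2) by (intro mult_mono power_le_one power_mono) auto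
    then have 5: "\<bar>t ^ 3 * (norm (R t))\<^sup>2\<bar> \<le> K\<^sup>2" by (simp add: abs_mult power_abs)
    show ?thesis unfolding \<rho>_def L_def using 1 2 3 4 5 by linarith
  qed
  have L0: "L \<ge> 0" using order_trans[OF abs_ge_zero L[of 0]] \<tau> by simp
  have ge: "0 \<le> t * b + t\<^sup>2 * c + t ^ 3 * \<rho> t" if t: "\<bar>t\<bar> < \<tau>" for t
  proof -
    have "(norm (S + t *\<^sub>R S1 + t\<^sup>2 *\<^sub>R S2 + t ^ 3 *\<^sub>R R t))\<^sup>2 = (norm S)\<^sup>2 + (t * b + t\<^sup>2 * c + t ^ 3 * \<rho> t)"
      unfolding b_def c_def \<rho>_def power2_norm_eq_inner
      by (simp add: inner_add_left inner_add_right inner_commute[of S1 S] inner_commute[of S2 S] inner_commute[of "R t" S]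
          inner_commute[of "R t" S1] inner_commute[of "R t" S2] inner_commute[of S2 S1] algebra_simps power2_eq_square power3_eq_cube)
    moreover have "(norm S)\<^sup>2 \<le> (norm (S + t *\<^sub>R S1 + t\<^sup>2 *\<^sub>R S2 + t ^ 3 *\<^sub>R R t))\<^sup>2"
      using min[OF t] by (intro power_mono) auto
    ultimately show ?thesis by linarith
  qed
  define \<sigma> where "\<sigma> = min \<tau> 1"
  have \<sigma>: "\<sigma> > 0" "\<sigma> \<le> 1" "\<sigma> \<le> \<tau>" using \<tau> by (auto simp: \<sigma>_def)
  have ev: "\<forall>\<^sub>F t in at_right 0. 0 < t \<and> t < \<sigma>"
    using eventually_at_right_less[of 0] eventually_at_right_field[of _ "0 :: real"] \<sigma> by (auto simp: eventually_at_right_field)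
  have div: "x \<ge> 0" if "0 \<le> t * x" "t > 0" for t x :: real using that by (simp add: zero_le_mult_iff)
  have e1: "0 \<le> b + t * (\<bar>c\<bar> + L)" "0 \<le> - b + t * (\<bar>c\<bar> + L)" if t: "0 < t" "t < \<sigma>" for t
  proof -
    have ttL: "t * t * L \<le> t * 1 * L" using t \<sigma> L0 by (intro mult_mono) auto
    have tL: "t\<^sup>2 * \<bar>\<rho> s\<bar> \<le> t * L" if "\<bar>s\<bar> = t" for s
    proof -
      have "t\<^sup>2 * \<bar>\<rho> s\<bar> \<le> t\<^sup>2 * L" using that t \<sigma> by (intro mult_left_mono L) auto
      also have "\<dots> \<le> t * L" using ttL by (simp only: power2_eq_square mult_1_right)
      finally show ?thesis .
    qed
    have tc: "t * c \<le> t * \<bar>c\<bar>" using t by (intro mult_left_mono) auto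
    have "0 \<le> t * (b + t * c + t\<^sup>2 * \<rho> t)"
      using ge[of t] t \<sigma> by (simp add: algebra_simps power2_eq_square power3_eq_cube)
    then have "0 \<le> b + t * c + t\<^sup>2 * \<rho> t" using t(1) by (rule div)
    moreover have "t\<^sup>2 * \<rho> t \<le> t\<^sup>2 * \<bar>\<rho> t\<bar>" by (intro mult_left_mono) auto
    moreover have "t\<^sup>2 * \<bar>\<rho> t\<bar> \<le> t * L" using t by (intro tL) simp
    ultimately show "0 \<le> b + t * (\<bar>c\<bar> + L)" using tc unfolding distrib_left by linarith
    have "0 \<le> t * (- b + t * c - t\<^sup>2 * \<rho> (- t))"
      using ge[of "- t"] t \<sigma> by (simp add: algebra_simps power2_eq_square power3_eq_cube)
    then have "0 \<le> - b + t * c - t\<^sup>2 * \<rho> (- t)" using t(1) by (rule div)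
    moreover have "- (t\<^sup>2 * \<rho> (- t)) \<le> t\<^sup>2 * \<bar>\<rho> (- t)\<bar>"
      unfolding mult_minus_right[symmetric] by (intro mult_left_mono) auto
    moreover have "t\<^sup>2 * \<bar>\<rho> (- t)\<bar> \<le> t * L" using t by (intro tL) simp
    ultimately show "0 \<le> - b + t * (\<bar>c\<bar> + L)" using tc unfolding distrib_left by linarith
  qed
  have lim: "((\<lambda>t. x + t * y) \<longlongrightarrow> x + 0 * y) (at_right 0)" for x y :: real by (intro tendsto_intros)
  have "0 \<le> b + 0 * (\<bar>c\<bar> + L)"
    by (rule tendsto_lowerbound[OF lim]) (use e1 in \<open>auto intro: eventually_mono[OF ev]\<close>)
  moreover have "0 \<le> - b + 0 * (\<bar>c\<bar> + L)"
    by (rule tendsto_lowerbound[OF lim]) (use e1 in \<open>auto intro: eventually_mono[OF ev]\<close>)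
  ultimately have b0: "b = 0" by simp
  then show "inner S S1 = 0" by (simp add: b_def)
  have e2: "0 \<le> c + t * L" if t: "0 < t" "t < \<sigma>" for t
  proof -
    have "0 \<le> t\<^sup>2 * (c + t * \<rho> t)"
      using ge[of t] t \<sigma> b0 by (simp add: algebra_simps power2_eq_square power3_eq_cube)
    then have "0 \<le> c + t * \<rho> t" using zero_less_power[OF t(1)] by (rule div)
    moreover have "t * \<rho> t \<le> t * L" using L[of t] t \<sigma> by (intro mult_left_mono) auto
    ultimately show ?thesis by linarith
  qed
  have "0 \<le> c + 0 * L"
    by (rule tendsto_lowerbound[OF lim]) (use e2 in \<open>auto intro: eventually_mono[OF ev]\<close>)
  then show "0 \<le> (norm S1)\<^sup>2 + 2 * inner S S2" by (simp add: c_def)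
qed

text \<open>
  For skew-Hermitian \<open>Y\<close>, the norm of \<open>(Id - t Y) v\<close> is at least that of \<open>v\<close>, because the cross terms
  cancel.
\<close>

lemma cayley_inverse:
  assumes Y: "Y \<in> mats d d" "adj Y = - Y" "rl re Y"
  obtains W where "W \<in> mats d d" "(Id d - t *\<^sub>R Y) * W = Id d" "W * (Id d - t *\<^sub>R Y) = Id d" "rl re W"
    "norm W \<le> norm (Id d)"
proof -
  define M where "M = Id d - t *\<^sub>R Y"
  have M: "M \<in> mats d d" unfolding M_def using Y by (intro mats_intro)
  have "dt d M \<noteq> 0"
  proof
    assume "dt d M = 0"
    then obtain v where v: "v \<in> mats d 1" "v \<noteq> 0" "M * v = 0" using dt_zero_kernel[OF M] by blast
    have v1: "v = t *\<^sub>R (Y * v)" using v by (simp add: M_def left_diff_distrib)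
    have "adj v * v = t *\<^sub>R (adj v * Y * v)" by (subst (2) v1) (simp add: mult.assoc)
    moreover have "adj v * v = - (t *\<^sub>R (adj v * Y * v))"
      using arg_cong[OF calculation, of adj] by (simp add: adj_simps Y mult.assoc)
    ultimately have "adj v * v = - (adj v * v)" by simp
    then have "2 *\<^sub>R (adj v * v) = 0" by (metis add.right_inverse scaleR_2)
    then have "adj v * v = 0" by simp
    then show False using v by simp
  qed
  then obtain W where W: "W \<in> mats d d" "M * W = Id d" "W * M = Id d" using dt_nonzero_inverse[OF M] by blast
  have "rl re W"
    unfolding rl_def
  proof
    assume "re"
    then have cM: "cconj M = M" using Y(3) by (simp add: M_def rl_def cconj_simps)
    have "M * cconj W = Id d" using arg_cong[OF W(2), of cconj] by (simp add: cconj_simps cM)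
    then have "W * (M * cconj W) = W" using W by simp
    then show "cconj W = W" unfolding mult.assoc[symmetric] W(3) using mats_cconj[OF W(1)] by simp
  qed
  moreover have "norm W \<le> norm (Id d)"
  proof (rule power2_le_imp_le)
    have "adj (M * W) * (M * W) = adj W * W + (t * t) *\<^sub>R (adj (Y * W) * (Y * W))"
      unfolding M_def using Y W
      by (simp add: adj_simps algebra_simps Id_times[OF W(1)] times_Id[OF mats_adj[OF W(1)]] Id_times[of _ d d] mats_times_same)
    then have "adj (Id d) * Id d = adj W * W + (t * t) *\<^sub>R (adj (Y * W) * (Y * W))" unfolding W(2) .
    then have "Re (tr (adj (Id d) * Id d)) = Re (tr (adj W * W + (t * t) *\<^sub>R (adj (Y * W) * (Y * W))))" by simp
    then have "(norm (Id d))\<^sup>2 = (norm W)\<^sup>2 + (t * t) * (norm (Y * W))\<^sup>2"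
      unfolding norm_sq_tr tr_plus tr_scaleR by simp
    then show "(norm W)\<^sup>2 \<le> (norm (Id d))\<^sup>2" by simp
  qed simp
  ultimately show ?thesis using that[of W] W by (simp add: M_def)
qed

text \<open>
  The Cayley transform \<open>U t = (Id + t Y) (Id - t Y)\<^sup>-\<^sup>1\<close> of \<open>Y = X - adj X\<close> is a curve of unitary matrices that
  is real if \<open>X\<close> is, and it agrees with \<open>Id + 2 t Y + 2 t\<^sup>2 Y\<^sup>2\<close> to second order. It moves \<open>P\<close> by conjugation.
\<close>

lemma cayley_curve:
  assumes A: "A \<in> mats k d" "A * adj A = Id k" "rl re A" and P: "P = adj A * A"
    and X: "X \<in> mats d d" "P * X = 0" "X * P = X" "rl re X"
  obtains b R K where
    "\<And>t. b t \<in> mats k d" "\<And>t. b t * adj (b t) = Id k" "\<And>t. rl re (b t)"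
    "\<And>t. norm (b t - A) \<le> \<bar>t\<bar> * K" "\<And>t. \<bar>t\<bar> \<le> 1 \<Longrightarrow> norm (R t) \<le> K"
    "\<And>t. adj (b t) * b t = P + t *\<^sub>R (2 *\<^sub>R (X + adj X)) + t\<^sup>2 *\<^sub>R (4 *\<^sub>R (X * adj X - adj X * X)) + t ^ 3 *\<^sub>R R t"
proof -
  define Y where "Y = X - adj X"
  have Y: "Y \<in> mats d d" "adj Y = - Y" "rl re Y"
    using X by (auto simp: Y_def adj_minus rl_def cconj_simps intro: mats_intro)
  have "\<exists>W. W \<in> mats d d \<and> (Id d - t *\<^sub>R Y) * W = Id d \<and> rl re W \<and> norm W \<le> norm (Id d)" for t
    using cayley_inverse[OF Y, of t] by metis
  then obtain W where W: "\<And>t. W t \<in> mats d d" "\<And>t. (Id d - t *\<^sub>R Y) * W t = Id d" "\<And>t. rl re (W t)"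
    "\<And>t. norm (W t) \<le> norm (Id d)" by metis
  have Pm: "P \<in> mats d d" unfolding P using A by (intro mats_intro)
  have Pa: "adj P = P" by (simp add: P adj_times)
  have PP: "P * P = P"
  proof -
    have "P * P = adj A * (A * adj A) * A" by (simp add: P mult.assoc)
    then show ?thesis unfolding A(2) using A(1) by (simp add: P mult.assoc)
  qed
  have Wexp: "W t = Id d + t *\<^sub>R (Y * W t)" for t
    using W(2)[of t] W(1)[of t] by (simp add: left_diff_distrib algebra_simps)
  define U where "U t = Id d + (2 * t) *\<^sub>R (Y * W t)" for t
  have Um: "U t \<in> mats d d" for t unfolding U_def using Y W by (intro mats_intro)
  have U2: "U t = (Id d + t *\<^sub>R Y) * W t" for t
  proof -
    have "(Id d + t *\<^sub>R Y) * W t = W t + t *\<^sub>R (Y * W t)" using W(1)[of t] by (simp add: distrib_right)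
    also have "\<dots> = U t" unfolding U_def by (subst Wexp) (simp flip: scaleR_add_left)
    finally show ?thesis ..
  qed
  have UU: "adj (U t) * U t = Id d" for t
  proof -
    have c: "(Id d - t *\<^sub>R Y) * (Id d + t *\<^sub>R Y) = (Id d + t *\<^sub>R Y) * (Id d - t *\<^sub>R Y)"
      using Y(1) by (simp add: algebra_simps Id_times[OF Y(1)] times_Id[OF Y(1)])
    have "adj (U t) * U t = adj (W t) * ((Id d - t *\<^sub>R Y) * (Id d + t *\<^sub>R Y)) * W t"
      unfolding U2 by (simp add: adj_simps Y mult.assoc)
    also have "\<dots> = adj ((Id d - t *\<^sub>R Y) * W t) * ((Id d - t *\<^sub>R Y) * W t)"
      unfolding c by (simp add: adj_simps Y mult.assoc)
    also have "\<dots> = Id d" unfolding W(2) by (simp add: Id_times[OF mats_Diag])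
    finally show ?thesis .
  qed
  define E where "E t = 2 *\<^sub>R (Y * Y * Y * W t)" for t
  define V where "V t = Id d + t *\<^sub>R (2 *\<^sub>R Y) + t\<^sup>2 *\<^sub>R (2 *\<^sub>R (Y * Y))" for t
  have UVE: "U t = V t + t ^ 3 *\<^sub>R E t" for t
  proof -
    have yw: "Y * W t = Y + t *\<^sub>R (Y * (Y * W t))" for t
      by (subst Wexp) (simp add: distrib_left times_Id[OF Y(1)])
    have "Y * W t = Y + t *\<^sub>R (Y * (Y + t *\<^sub>R (Y * (Y * W t))))" by (subst yw, subst yw, rule refl)
    then have "U t = Id d + (2 * t) *\<^sub>R (Y + t *\<^sub>R (Y * (Y + t *\<^sub>R (Y * (Y * W t)))))" unfolding U_def by simp
    then show ?thesis unfolding V_def E_def by (simp add: algebra_simps power2_eq_square power3_eq_cube)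
  qed
  define K1 where "K1 = norm (2 *\<^sub>R (Y * Y * Y)) * norm (Id d)"
  have E: "norm (E t) \<le> K1" for t
  proof -
    have "norm (E t) \<le> norm (2 *\<^sub>R (Y * Y * Y)) * norm (W t)"
      unfolding E_def by (metis norm_mult_ineq mult_scaleR_left)
    also have "\<dots> \<le> K1" unfolding K1_def using W(4)[of t] by (intro mult_left_mono) auto
    finally show ?thesis .
  qed
  define K2 where "K2 = norm (Id d) + norm (2 *\<^sub>R Y) + norm (2 *\<^sub>R (Y * Y))"
  have V: "norm (V t) \<le> K2" if "\<bar>t\<bar> \<le> 1" for t
  proof -
    have "norm (V t) \<le> norm (Id d) + norm (t *\<^sub>R (2 *\<^sub>R Y)) + norm (t\<^sup>2 *\<^sub>R (2 *\<^sub>R (Y * Y)))"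
      unfolding V_def by (intro order_trans[OF norm_triangle_ineq] add_right_mono norm_triangle_ineq)
    moreover have "norm (t *\<^sub>R (2 *\<^sub>R Y)) \<le> 1 * norm (2 *\<^sub>R Y)"
      unfolding norm_scaleR[of t] using that by (intro mult_right_mono) auto
    moreover have "norm (t\<^sup>2 *\<^sub>R (2 *\<^sub>R (Y * Y))) \<le> 1 * norm (2 *\<^sub>R (Y * Y))"
      unfolding norm_scaleR[of "t\<^sup>2"] using that by (intro mult_right_mono) (auto simp: abs_square_le_1)
    ultimately show ?thesis unfolding K2_def by linarith
  qed
  define X2 where "X2 = 2 *\<^sub>R (Y * Y)"
  define G where "G = (2 *\<^sub>R Y) * P * adj X2 + X2 * P * adj (2 *\<^sub>R Y)"
  define R where "R t = E t * P * adj (V t) + V t * P * adj (E t) + t ^ 3 *\<^sub>R (E t * P * adj (E t))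
    + (G + t *\<^sub>R (X2 * P * adj X2))" for t
  define b where "b t = A * adj (U t)" for t
  define K3 where "K3 = K1 * norm P * K2 + K2 * norm P * K1 + K1 * norm P * K1 + (norm G + norm (X2 * P * adj X2))"
  define K where "K = K3 + norm A * (2 * (norm Y * norm (Id d)))"
  have m: "norm (C * P * adj D) \<le> c * norm P * e" if "norm C \<le> c" "norm D \<le> e" for C D c e
  proof -
    have "norm (C * P * adj D) \<le> norm C * norm P * norm D"
      using norm_mult_ineq[of "C * P" "adj D"] mult_right_mono[OF norm_mult_ineq[of C P], of "norm D"] by simp
    also have "\<dots> \<le> c * norm P * e"
      using order_trans[OF norm_ge_zero that(1)] by (intro mult_mono that mult_nonneg_nonneg) auto
    finally show ?thesis .
  qed
  have Rn: "norm (R t) \<le> K3" if t: "\<bar>t\<bar> \<le> 1" for t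
  proof -
    have "norm (t ^ 3 *\<^sub>R (E t * P * adj (E t))) \<le> 1 * (K1 * norm P * K1)"
      unfolding norm_scaleR using t m[OF E E] by (intro mult_mono) (auto simp: power_abs power_le_one)
    moreover have "norm (t *\<^sub>R (X2 * P * adj X2)) \<le> 1 * norm (X2 * P * adj X2)"
      unfolding norm_scaleR using t by (intro mult_right_mono) auto
    moreover have "norm (R t) \<le> norm (E t * P * adj (V t)) + norm (V t * P * adj (E t)) + norm (t ^ 3 *\<^sub>R (E t * P * adj (E t)))
      + (norm G + norm (t *\<^sub>R (X2 * P * adj X2)))"
      unfolding R_def by (intro order_trans[OF norm_triangle_ineq] add_mono norm_triangle_ineq order_refl)
    ultimately show ?thesis unfolding K3_def using m[OF E V[OF t], of t] m[OF V[OF t] E, of t] by linarith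
  qed
  have K30: "K3 \<ge> 0" using order_trans[OF norm_ge_zero Rn[of 0]] by simp
  have YP: "Y * P = X"
  proof -
    have "adj X * P = adj (P * X)" by (simp add: adj_times Pa)
    then show ?thesis using X by (simp add: Y_def left_diff_distrib)
  qed
  have PY: "P * adj Y = adj X" using arg_cong[OF YP, of adj] by (simp add: adj_times Pa)
  have XX: "X * X = 0" by (metis X(2,3) mult.assoc mult_zero_right)
  have X2P: "X2 * P = - (2 *\<^sub>R (adj X * X))"
    unfolding X2_def by (simp add: mult.assoc YP) (simp add: Y_def left_diff_distrib XX)
  have PX2: "P * adj X2 = - (2 *\<^sub>R (adj X * X))"
    using arg_cong[OF X2P, of adj] by (simp add: adj_simps Pa)
  have YPY: "Y * P * adj Y = X * adj X"
  proof -
    have "Y * P * adj Y = (Y * P) * (P * adj Y)" by (metis PP mult.assoc)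
    then show ?thesis by (simp add: YP PY)
  qed
  show ?thesis
  proof (rule that[of b K R])
    fix t
    show "b t \<in> mats k d" unfolding b_def using A Um by (intro mats_intro)
    have "b t * adj (b t) = A * (adj (U t) * U t) * adj A" unfolding b_def by (simp add: adj_times mult.assoc)
    then show "b t * adj (b t) = Id k" unfolding UU using A by simp
    show "rl re (b t)" using A(3) Y(3) W(3)[of t] unfolding b_def U_def rl_def by (auto simp: cconj_simps)
    have "b t - A = A * adj ((2 * t) *\<^sub>R (Y * W t))" unfolding b_def U_def using A by (simp add: adj_plus distrib_left)
    also have "norm \<dots> \<le> norm A * norm ((2 * t) *\<^sub>R (Y * W t))" by (metis norm_adj norm_mult_ineq)
    also have "\<dots> \<le> norm A * (\<bar>2 * t\<bar> * (norm Y * norm (Id d)))"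
      unfolding norm_scaleR using W(4)[of t]
      by (intro mult_left_mono order_trans[OF norm_mult_ineq] mult_mono) auto
    also have "\<dots> = \<bar>t\<bar> * (norm A * (2 * (norm Y * norm (Id d))))" by (simp add: abs_mult)
    also have "\<dots> \<le> \<bar>t\<bar> * K" unfolding K_def using K30 by (intro mult_left_mono) auto
    finally show "norm (b t - A) \<le> \<bar>t\<bar> * K" .
    show "norm (R t) \<le> K" if "\<bar>t\<bar> \<le> 1"
      using Rn[OF that] unfolding K_def by (smt (verit) mult_nonneg_nonneg norm_ge_zero)
    have "adj (b t) * b t = U t * P * adj (U t)" unfolding b_def P by (simp add: adj_times mult.assoc)
    also have "\<dots> = V t * P * adj (V t) + t ^ 3 *\<^sub>R (E t * P * adj (V t) + V t * P * adj (E t) + t ^ 3 *\<^sub>R (E t * P * adj (E t)))"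
      unfolding UVE by (simp add: adj_simps algebra_simps)
    also have "V t * P * adj (V t) = P + t *\<^sub>R (2 *\<^sub>R (Y * P + P * adj Y)) + t\<^sup>2 *\<^sub>R (X2 * P + P * adj X2 + 4 *\<^sub>R (Y * P * adj Y))
        + t ^ 3 *\<^sub>R (G + t *\<^sub>R (X2 * P * adj X2))"
    proof -
      have V': "V t = Id d + t *\<^sub>R (2 *\<^sub>R Y) + t\<^sup>2 *\<^sub>R X2" by (simp add: V_def X2_def)
      have X2m: "X2 \<in> mats d d" unfolding X2_def using Y by (intro mats_intro)
      have id: "Id d * P = P" "P * Id d = P" using Pm by auto
      have ids: "Id d * (P * Z) = P * Z" for Z by (metis id(1) mult.assoc)
      show ?thesis
        unfolding V' G_def by (simp add: adj_simps algebra_simps id ids power2_eq_square power3_eq_cube flip: scaleR_add_left)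
    qed
    also have "X2 * P + P * adj X2 + 4 *\<^sub>R (Y * P * adj Y) = 4 *\<^sub>R (X * adj X - adj X * X)"
      unfolding X2P PX2 YPY by (simp add: algebra_simps flip: scaleR_add_left)
    finally show "adj (b t) * b t = P + t *\<^sub>R (2 *\<^sub>R (X + adj X)) + t\<^sup>2 *\<^sub>R (4 *\<^sub>R (X * adj X - adj X * X)) + t ^ 3 *\<^sub>R R t"
      unfolding YP PY R_def by (simp add: algebra_simps)
  qed
qed

text \<open>
  The frame operators along the curves of \<open>cayley_curve\<close> add up to a curve with a quadratic expansion, to
  which \<open>second_order_test\<close> applies.
\<close>

lemma variation:
  fixes A X :: "nat \<Rightarrow> fmat"
  assumes A: "\<And>i. i < N \<Longrightarrow> A i \<in> mats (k i) d" "\<And>i. i < N \<Longrightarrow> A i * adj (A i) = Id (k i)" "\<And>i. i < N \<Longrightarrow> rl re (A i)"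
    and X: "\<And>i. i < N \<Longrightarrow> X i \<in> mats d d" "\<And>i. i < N \<Longrightarrow> adj (A i) * A i * X i = 0"
      "\<And>i. i < N \<Longrightarrow> X i * (adj (A i) * A i) = X i" "\<And>i. i < N \<Longrightarrow> rl re (X i)"
    and \<rho>: "\<rho> > 0" and min: "\<And>b. (\<And>i. i < N \<Longrightarrow> b i \<in> mats (k i) d \<and> b i * adj (b i) = Id (k i) \<and> rl re (b i) \<and> norm (b i - A i) < \<rho>)
      \<Longrightarrow> norm (\<Sum>i<N. adj (A i) * A i) \<le> norm (\<Sum>i<N. adj (b i) * b i)"
  shows "inner (\<Sum>i<N. adj (A i) * A i) (\<Sum>i<N. 2 *\<^sub>R (X i + adj (X i))) = 0"
    "0 \<le> (norm (\<Sum>i<N. 2 *\<^sub>R (X i + adj (X i))))\<^sup>2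
      + 2 * inner (\<Sum>i<N. adj (A i) * A i) (\<Sum>i<N. 4 *\<^sub>R (X i * adj (X i) - adj (X i) * X i))"
proof -
  define C where "C i b R K \<longleftrightarrow> (\<forall>t. b t \<in> mats (k i) d \<and> b t * adj (b t) = Id (k i) \<and> rl re (b t) \<and>
      norm (b t - A i) \<le> \<bar>t\<bar> * K \<and> (\<bar>t\<bar> \<le> 1 \<longrightarrow> norm (R t) \<le> K) \<and>
      adj (b t) * b t = adj (A i) * A i + t *\<^sub>R (2 *\<^sub>R (X i + adj (X i))) + t\<^sup>2 *\<^sub>R (4 *\<^sub>R (X i * adj (X i) - adj (X i) * X i)) + t ^ 3 *\<^sub>R R t)"
    for i and b R :: "real \<Rightarrow> fmat" and K :: real
  have "\<exists>b R K. C i b R K" if i: "i < N" for i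
  proof (rule cayley_curve[OF A(1)[OF i] A(2)[OF i] A(3)[OF i] refl X(1)[OF i] X(2)[OF i] X(3)[OF i] X(4)[OF i]])
    fix b R K
    assume "\<And>t. b t \<in> mats (k i) d" "\<And>t. b t * adj (b t) = Id (k i)" "\<And>t. rl re (b t)"
      "\<And>t. norm (b t - A i) \<le> \<bar>t\<bar> * K" "\<And>t. \<bar>t\<bar> \<le> 1 \<Longrightarrow> norm (R t) \<le> K"
      "\<And>t. adj (b t) * b t = adj (A i) * A i + t *\<^sub>R (2 *\<^sub>R (X i + adj (X i))) + t\<^sup>2 *\<^sub>R (4 *\<^sub>R (X i * adj (X i) - adj (X i) * X i)) + t ^ 3 *\<^sub>R R t"
    then have "C i b R K" unfolding C_def by simp
    then show ?thesis by blast
  qed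
  then obtain b R K where "\<And>i. i < N \<Longrightarrow> C i (b i) (R i) (K i)" by metis
  then have C: "b i t \<in> mats (k i) d" "b i t * adj (b i t) = Id (k i)" "rl re (b i t)"
      "norm (b i t - A i) \<le> \<bar>t\<bar> * K i" "\<bar>t\<bar> \<le> 1 \<Longrightarrow> norm (R i t) \<le> K i"
      "adj (b i t) * b i t = adj (A i) * A i + t *\<^sub>R (2 *\<^sub>R (X i + adj (X i))) + t\<^sup>2 *\<^sub>R (4 *\<^sub>R (X i * adj (X i) - adj (X i) * X i)) + t ^ 3 *\<^sub>R R i t"
    if "i < N" for i t using that unfolding C_def by blast+
  have K0: "K i \<ge> 0" if "i < N" for i using order_trans[OF norm_ge_zero C(5)[OF that, of 0]] by simp
  define L where "L = (\<Sum>i<N. K i)"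
  have L0: "L \<ge> 0" unfolding L_def using K0 by (intro sum_nonneg) auto
  have KL: "K i \<le> L" if "i < N" for i unfolding L_def using that K0 by (intro member_le_sum) auto
  define \<tau> where "\<tau> = min 1 (\<rho> / (1 + L))"
  have \<tau>: "\<tau> > 0" "\<tau> \<le> 1" "\<tau> \<le> \<rho> / (1 + L)" using \<rho> L0 by (auto simp: \<tau>_def)
  have RL: "norm (\<Sum>i<N. R i t) \<le> L" if t: "\<bar>t\<bar> < \<tau>" for t
    unfolding L_def using C(5) t \<tau>(2) by (intro sum_norm_le) auto
  have "norm (\<Sum>i<N. adj (A i) * A i) \<le> norm ((\<Sum>i<N. adj (A i) * A i) + t *\<^sub>R (\<Sum>i<N. 2 *\<^sub>R (X i + adj (X i)))
      + t\<^sup>2 *\<^sub>R (\<Sum>i<N. 4 *\<^sub>R (X i * adj (X i) - adj (X i) * X i)) + t ^ 3 *\<^sub>R (\<Sum>i<N. R i t))" if t: "\<bar>t\<bar> < \<tau>" for t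
  proof -
    have "norm (\<Sum>i<N. adj (A i) * A i) \<le> norm (\<Sum>i<N. adj (b i t) * b i t)"
    proof (rule min)
      fix i assume i: "i < N"
      have "\<bar>t\<bar> * K i \<le> \<bar>t\<bar> * L" using KL[OF i] by (intro mult_left_mono) auto
      also have "\<dots> \<le> \<tau> * L" using t L0 by (intro mult_right_mono) auto
      also have "\<dots> < \<tau> * (1 + L)" using \<tau>(1) by (simp add: distrib_left)
      also have "\<dots> \<le> \<rho>" using \<tau>(3) L0 by (simp add: field_simps)
      finally have "norm (b i t - A i) < \<rho>" using C(4)[OF i, of t] by linarith
      then show "b i t \<in> mats (k i) d \<and> b i t * adj (b i t) = Id (k i) \<and> rl re (b i t) \<and> norm (b i t - A i) < \<rho>"
        using C(1,2,3)[OF i] by blast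
    qed
    also have "(\<Sum>i<N. adj (b i t) * b i t) = (\<Sum>i<N. adj (A i) * A i + t *\<^sub>R (2 *\<^sub>R (X i + adj (X i)))
      + t\<^sup>2 *\<^sub>R (4 *\<^sub>R (X i * adj (X i) - adj (X i) * X i)) + t ^ 3 *\<^sub>R R i t)"
      using C(6) by (intro sum.cong) auto
    finally show ?thesis by (simp only: sum.distrib scaleR_sum_right)
  qed
  from second_order_test[OF \<tau>(1) RL this]
  show "inner (\<Sum>i<N. adj (A i) * A i) (\<Sum>i<N. 2 *\<^sub>R (X i + adj (X i))) = 0"
    "0 \<le> (norm (\<Sum>i<N. 2 *\<^sub>R (X i + adj (X i))))\<^sup>2
      + 2 * inner (\<Sum>i<N. adj (A i) * A i) (\<Sum>i<N. 4 *\<^sub>R (X i * adj (X i) - adj (X i) * X i))"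
    by blast+
qed

lemma top_eigenprojector:
  assumes S: "S \<in> mats d d" "adj S = S" and d: "d > 0"
  obtains pr \<Lambda> where "projector d pr" "pr \<noteq> 0" "S * pr = \<Lambda> *\<^sub>R pr"
    "\<And>M. M \<in> mats d d \<Longrightarrow> S * M = \<Lambda> *\<^sub>R M \<Longrightarrow> pr * M = M"
    "\<And>M. M \<in> mats d d \<Longrightarrow> pr * M = 0 \<Longrightarrow> M \<noteq> 0 \<Longrightarrow> inner M (S * M) < \<Lambda> * (norm M)\<^sup>2"
proof -
  obtain Q x where Q: "unitary d Q" and SQ: "S = Q * Diag d (\<lambda>i. complex_of_real (x i)) * adj Q"
    using spectral_theorem[OF S] by metis
  have Qm: "Q \<in> mats d d" "adj Q * Q = Id d" "Q * adj Q = Id d" using Q by (auto simp: unitary_def)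
  define D where "D = Diag d (\<lambda>i. complex_of_real (x i))"
  define \<Lambda> where "\<Lambda> = Max (x ` {..<d})"
  have le: "x j \<le> \<Lambda>" if "j < d" for j unfolding \<Lambda>_def using that by (intro Max_ge) auto
  have "\<Lambda> \<in> x ` {..<d}" unfolding \<Lambda>_def using d by (intro Max_in) auto
  then obtain j0 where j0: "j0 < d" "x j0 = \<Lambda>" by auto
  define E where "E = Diag d (\<lambda>j. if x j = \<Lambda> then 1 else 0)"
  have Em: "E \<in> mats d d" "adj E = E" "E * E = E" "D * E = \<Lambda> *\<^sub>R E"
    by (auto simp: E_def D_def adj_Diag entry_Diag_times intro!: fmat_eqI)
  define pr where "pr = Q * E * adj Q"
  have conj: "(Q * F * adj Q) * (Q * F' * adj Q) = Q * (F * F') * adj Q" if "F' \<in> mats d d" for F F'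
  proof -
    have "(Q * F * adj Q) * (Q * F' * adj Q) = Q * F * (adj Q * Q) * F' * adj Q" by (simp add: mult.assoc)
    then show ?thesis unfolding Qm using that by (simp add: mult.assoc Id_times[OF that] flip: mult.assoc[of "Id d"])
  qed
  have Sp: "S * pr = \<Lambda> *\<^sub>R pr" unfolding SQ D_def[symmetric] pr_def conj[OF Em(1)] Em(4) by simp
  have proj: "projector d pr"
    unfolding projector_def
  proof (intro conjI)
    show "pr \<in> mats d d" unfolding pr_def using Qm Em by (intro mats_intro)
    show "adj pr = pr" unfolding pr_def by (simp add: adj_times Em mult.assoc)
    show "pr * pr = pr" unfolding pr_def conj[OF Em(1)] Em ..
  qed
  have recon: "M = Q * (adj Q * M)" if "M \<in> mats d d" for M
    using that Qm by (metis Id_times mult.assoc)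
  have D1: "adj Q * (S * M) = D * (adj Q * M)" if "M \<in> mats d d" for M
  proof -
    have "adj Q * (S * M) = (adj Q * Q) * D * (adj Q * M)" unfolding SQ D_def by (simp add: mult.assoc)
    then show ?thesis unfolding Qm D_def by (simp add: Id_times[OF mats_Diag])
  qed
  show ?thesis
  proof (rule that[OF proj _ Sp])
    show "pr \<noteq> 0"
    proof
      assume "pr = 0"
      then have "adj Q * pr * Q = 0" by simp
      moreover have "adj Q * pr * Q = (adj Q * Q) * E * (adj Q * Q)" by (simp add: pr_def mult.assoc)
      ultimately have "E = 0" unfolding Qm using Em by simp
      then have "entry E j0 j0 = 0" by simp
      then show False using j0 by (simp add: E_def)
    qed
    fix M assume M: "M \<in> mats d d"
    define V where "V = adj Q * M"
    have Vm: "V \<in> mats d d" unfolding V_def using M Qm by (intro mats_intro)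
    have prM: "pr * M = Q * (E * V)" by (simp add: pr_def V_def mult.assoc)
    show "pr * M = M" if SM: "S * M = \<Lambda> *\<^sub>R M"
    proof -
      have DV: "D * V = \<Lambda> *\<^sub>R V" using D1[OF M] unfolding SM by (simp add: V_def)
      have "E * V = V"
      proof (rule fmat_eqI)
        fix i j
        have "entry (D * V) i j = entry (\<Lambda> *\<^sub>R V) i j" unfolding DV ..
        then have "i < d \<Longrightarrow> of_real (x i) * entry V i j = of_real \<Lambda> * entry V i j"
          by (simp add: D_def entry_Diag_times)
        then show "entry (E * V) i j = entry V i j"
          using entry_mats[OF Vm, of i j] by (auto simp: E_def entry_Diag_times)
      qed
      then show ?thesis unfolding prM using recon[OF M] by (simp add: V_def)
    qed
    assume "pr * M = 0" "M \<noteq> 0"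
    then have EV0: "E * V = 0"
    proof -
      have "adj Q * (pr * M) = (adj Q * Q) * (E * V)" unfolding prM by (simp add: mult.assoc)
      then show ?thesis using \<open>pr * M = 0\<close> unfolding Qm using Id_times[OF mats_times_same[OF Em(1) Vm]] by simp
    qed
    then have V0: "entry V i j = 0" if "i < d" "x i = \<Lambda>" for i j
    proof -
      have "entry (E * V) i j = 0" by (simp only: EV0 entry_zero)
      then show ?thesis using that by (simp add: E_def entry_Diag_times)
    qed
    have "V \<noteq> 0" using \<open>M \<noteq> 0\<close> recon[OF M] by (auto simp: V_def)
    then obtain i1 j1 where ij: "entry V i1 j1 \<noteq> 0" by (metis fmat_eqI entry_zero)
    then have i1: "i1 < d" "j1 < d" using entry_mats[OF Vm] by (meson not_le)+
    have "inner M (S * M) = Re (tr (adj V * (D * V)))"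
    proof -
      have "inner M (S * M) = Re (tr (adj (Q * V) * (S * M)))" unfolding inner_tr V_def recon[OF M, symmetric] ..
      then show ?thesis by (simp add: adj_times mult.assoc D1[OF M] V_def)
    qed
    also have "\<dots> = inner V (D * V)" by (simp add: inner_tr)
    also have "\<dots> = (\<Sum>i<d. \<Sum>j<d. x i * (cmod (entry V i j))\<^sup>2)"
    proof -
      have re: "Re (cnj v * (of_real y * v)) = y * (cmod v)\<^sup>2" for v y
        unfolding cmod_power2 by (simp add: algebra_simps power2_eq_square)
      show ?thesis
        using Vm by (subst inner_fmat_bound[of d]) (auto simp: entry_mats D_def entry_Diag_times re simp del: Re_complex_of_real times_complex.sel intro!: sum.cong)
    qed
    also have "\<dots> < (\<Sum>i<d. \<Sum>j<d. \<Lambda> * (cmod (entry V i j))\<^sup>2)"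
    proof (rule sum_strict_mono_ex1)
      show "\<forall>i\<in>{..<d}. (\<Sum>j<d. x i * (cmod (entry V i j))\<^sup>2) \<le> (\<Sum>j<d. \<Lambda> * (cmod (entry V i j))\<^sup>2)"
        using le by (auto intro!: sum_mono mult_right_mono)
      have "x i1 < \<Lambda>" using V0[of i1 j1] ij i1 le[of i1] by force
      then have "(\<Sum>j<d. x i1 * (cmod (entry V i1 j))\<^sup>2) < (\<Sum>j<d. \<Lambda> * (cmod (entry V i1 j))\<^sup>2)"
        using ij i1 by (intro sum_strict_mono_ex1) (auto intro!: mult_right_mono bexI[of _ j1])
      then show "\<exists>i\<in>{..<d}. (\<Sum>j<d. x i * (cmod (entry V i j))\<^sup>2) < (\<Sum>j<d. \<Lambda> * (cmod (entry V i j))\<^sup>2)"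
        using i1 by blast
    qed simp
    also have "\<dots> = \<Lambda> * (norm V)\<^sup>2"
      using Vm by (subst norm_fmat_sq[of d d]) (auto simp: entry_mats sum_distrib_left)
    also have "norm V = norm M" unfolding V_def by (rule norm_unitary_times[OF unitary_adj[OF Q] M])
    finally show "inner M (S * M) < \<Lambda> * (norm M)\<^sup>2" .
  qed
qed

section \<open>Local minima are tight\<close>

text \<open>
  The variations give the commutation of \<open>P i\<close> with \<open>S\<close> and the injectivity that \<open>duality\<close> turns into
  the data of the locale \<open>frame_pair\<close>; trace identities give the instability, which contradicts
  \<open>not_tight\<close>.
\<close>

theorem local_minimum_tight:
  fixes A T :: "nat \<Rightarrow> fmat"
  assumes d: "d > 0"
    and A: "\<And>i. i < N \<Longrightarrow> A i \<in> mats (k i) d" "\<And>i. i < N \<Longrightarrow> A i * adj (A i) = Id (k i)" "\<And>i. i < N \<Longrightarrow> rl re (A i)"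
    and T: "\<And>i. i < N \<Longrightarrow> T i \<in> mats (k i) d" "\<And>i. i < N \<Longrightarrow> T i * adj (T i) = Id (k i)"
    and tight: "(\<Sum>i<N. adj (T i) * T i) = c *\<^sub>R Id d"
    and \<rho>: "\<rho> > 0" and min: "\<And>b. (\<And>i. i < N \<Longrightarrow> b i \<in> mats (k i) d \<and> b i * adj (b i) = Id (k i) \<and> rl re (b i) \<and> norm (b i - A i) < \<rho>)
      \<Longrightarrow> norm (\<Sum>i<N. adj (A i) * A i) \<le> norm (\<Sum>i<N. adj (b i) * b i)"
  obtains \<Lambda> where "(\<Sum>i<N. adj (A i) * A i) = \<Lambda> *\<^sub>R Id d"
proof (rule ccontr)
  assume not_scalar: "\<not> thesis"
  define P where "P i = adj (A i) * A i" for i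
  define S where "S = (\<Sum>i<N. P i)"
  have Pm: "P i \<in> mats d d" "adj (P i) = P i" "rl re (P i)" if "i < N" for i
    using A(1,3)[OF that] by (auto simp: P_def adj_times rl_def cconj_simps intro: mats_intro)
  have PP: "P i * P i = P i" if "i < N" for i
  proof -
    have "P i * P i = adj (A i) * (A i * adj (A i)) * A i" by (simp add: P_def mult.assoc)
    then show ?thesis unfolding A(2)[OF that] using Id_times[OF A(1)[OF that]] by (simp add: P_def mult.assoc)
  qed
  have projP: "projector d (P i)" if "i < N" for i using Pm[OF that] PP[OF that] by (simp add: projector_def)
  have Sm: "S \<in> mats d d" "adj S = S" "rl re S"
    unfolding S_def using Pm by (auto simp: adj_sum cconj_sum rl_def intro!: mats_intro sum.cong)
  note PId = Id_times[OF Pm(1)] times_Id[OF Pm(1)]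
  \<comment> \<open>The direction \<open>X i = (Id d - P i) * S * P i\<close> is the gradient of the potential: the first variation
    along it is a multiple of its squared norm.\<close>
  have PS0: "(Id d - P i) * S * P i = 0" if "i < N" for i
  proof -
    define X where "X i = (Id d - P i) * S * P i" for i
    have Xm: "X i \<in> mats d d" if "i < N" for i unfolding X_def using Pm[OF that] Sm by (auto intro!: mats_intro)
    have X1: "P i * X i = 0" if "i < N" for i
    proof -
      have "P i * X i = (P i * (Id d - P i)) * S * P i" by (simp add: X_def mult.assoc)
      then show ?thesis using that by (simp add: right_diff_distrib PId PP)
    qed
    have X2: "X i * P i = X i" if "i < N" for i using PP[OF that] by (simp add: X_def mult.assoc)
    have X3: "rl re (X i)" if "i < N" for i
      using Pm(3)[OF that] Sm(3) by (auto simp: X_def rl_def cconj_simps)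
    have "inner S (\<Sum>i<N. 2 *\<^sub>R (X i + adj (X i))) = 0"
      unfolding S_def P_def using X1 X2 unfolding P_def by (intro variation(1)[OF A Xm _ _ X3 \<rho> min]) auto
    moreover have SX: "inner S (X i) = (norm (X i))\<^sup>2" "inner S (adj (X i)) = (norm (X i))\<^sup>2" if i: "i < N" for i
    proof -
      have "inner S (X i) = inner (X i) (X i)"
      proof -
        have e: "X i = (Id d - P i) * X i * P i"
          using Id_times[OF Xm[OF i]] X1[OF i] X2[OF i] by (simp add: left_diff_distrib)
        have "inner (X i) S = inner ((Id d - P i) * X i * P i) S" by (subst e[symmetric]) (rule refl)
        also have "\<dots> = inner ((Id d - P i) * X i) (S * adj (P i))" by (rule inner_times_right)
        also have "\<dots> = inner (X i) (adj (Id d - P i) * (S * adj (P i)))" by (rule inner_times_left)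
        also have "\<dots> = inner (X i) (X i)" by (simp add: adj_minus Pm(2)[OF i] X_def[of i] mult.assoc)
        finally show ?thesis by (simp add: inner_commute)
      qed
      then show 1: "inner S (X i) = (norm (X i))\<^sup>2" by (simp add: power2_norm_eq_inner)
      have "inner S (adj (X i)) = inner (adj S) (X i)"
      proof -
        have "tr (adj S * adj (X i)) = cnj (tr (X i * S))"
          unfolding adj_times[symmetric] using Xm[OF i] Sm by (simp add: tr_mats[of _ d d] mats_intro)
        then show ?thesis unfolding inner_tr by (simp add: tr_times_commute)
      qed
      then show "inner S (adj (X i)) = (norm (X i))\<^sup>2" using 1 by (simp add: Sm)
    qed
    ultimately have "(\<Sum>i<N. 4 * (norm (X i))\<^sup>2) = 0"
      by (simp add: inner_sum_right inner_add_right)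
    then have "\<forall>i\<in>{..<N}. 4 * (norm (X i))\<^sup>2 = 0" by (subst (asm) sum_nonneg_eq_0_iff) auto
    then show ?thesis using that by (simp add: X_def)
  qed
  have PS: "P i * S = S * P i" if i: "i < N" for i
  proof -
    have "S * P i \<in> mats d d" using Pm[OF i] Sm by (intro mats_intro)
    then have "S * P i = P i * S * P i"
      using PS0[OF i] by (simp add: left_diff_distrib mult.assoc)
    then have 1: "S * P i = P i * (S * P i)" by (simp only: mult.assoc)
    then have "adj (S * P i) = adj (P i * (S * P i))" by simp
    then have 2: "P i * S = P i * (S * P i)" by (simp only: adj_times Pm(2)[OF i] Sm(2) mult.assoc)
    show ?thesis by (rule trans[OF 2 1[symmetric]])
  qed
  obtain pr \<Lambda> where pr: "projector d pr" "pr \<noteq> 0" "S * pr = \<Lambda> *\<^sub>R pr"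
    "\<And>M. M \<in> mats d d \<Longrightarrow> S * M = \<Lambda> *\<^sub>R M \<Longrightarrow> pr * M = M"
    "\<And>M. M \<in> mats d d \<Longrightarrow> pr * M = 0 \<Longrightarrow> M \<noteq> 0 \<Longrightarrow> inner M (S * M) < \<Lambda> * (norm M)\<^sup>2"
    using top_eigenprojector[OF Sm(1,2) d] by blast
  have prm: "pr \<in> mats d d" "adj pr = pr" "pr * pr = pr" using pr(1) by (auto simp: projector_def)
  have prS: "pr * S = \<Lambda> *\<^sub>R pr" using arg_cong[OF pr(3), of adj] by (simp add: adj_simps prm Sm)
  have comm: "P i * pr = pr * P i" if i: "i < N" for i
  proof -
    have "S * (P i * pr) = P i * (S * pr)" using PS[OF i] by (metis mult.assoc)
    then have "S * (P i * pr) = \<Lambda> *\<^sub>R (P i * pr)" by (simp add: pr(3))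
    then have 1: "pr * (P i * pr) = P i * pr" using Pm[OF i] prm by (intro pr(4)) (auto intro: mats_intro)
    then have "adj (pr * (P i * pr)) = adj (P i * pr)" by simp
    then have 2: "pr * (P i * pr) = pr * P i" by (simp only: adj_times prm Pm(2)[OF i] mult.assoc)
    show ?thesis by (rule trans[OF 1[symmetric] 2])
  qed
  have cpr: "cconj pr = pr" if re
  proof -
    have "cconj S = S" using Sm(3) that by (simp add: rl_def)
    then have "S * cconj pr = \<Lambda> *\<^sub>R cconj pr" using arg_cong[OF pr(3), of cconj] by (simp add: cconj_simps)
    then have 1: "pr * cconj pr = cconj pr" using prm by (intro pr(4)) (auto intro: mats_intro)
    have 2: "cconj pr * pr = pr" using arg_cong[OF 1, of cconj] by (simp add: cconj_simps)
    have "adj (cconj pr) = cconj pr" by (simp add: prm flip: cconj_adj)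
    then have "cconj pr * pr = cconj pr" using arg_cong[OF 1, of adj] by (simp add: adj_times prm)
    then show ?thesis using 2 by simp
  qed
  define R where "R i = (Id d - pr) * (Id d - P i)" for i
  define p where "p i = P i * pr" for i
  note prId = Id_times[OF prm(1)] times_Id[OF prm(1)]
  have pm: "p i \<in> mats d d" if "i < N" for i unfolding p_def using Pm[OF that] prm by (intro mats_intro)
  have R2: "R i = Id d - pr - P i + P i * pr" if "i < N" for i
    unfolding R_def using that by (simp add: algebra_simps PId prId Id_times[OF mats_Diag] comm)
  have Rm: "R i \<in> mats d d" if "i < N" for i unfolding R_def using Pm[OF that] prm by (auto intro!: mats_intro)
  have comm': "P i * (pr * Z) = pr * (P i * Z)" if "i < N" for i Z using comm[OF that] by (metis mult.assoc)
  have PP': "P i * (P i * Z) = P i * Z" if "i < N" for i Z using PP[OF that] by (metis mult.assoc)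
  have prpr': "pr * (pr * Z) = pr * Z" for Z using prm by (metis mult.assoc)
  have projp: "projector d (p i)" if "i < N" for i
    unfolding projector_def using pm[OF that] that
    by (auto simp: p_def adj_times prm Pm comm mult.assoc comm' PP PP' prpr')
  have projR: "projector d (R i)" if i: "i < N" for i
    unfolding projector_def
  proof (intro conjI Rm[OF i])
    show "adj (R i) = R i" unfolding R2[OF i] by (simp add: adj_simps prm Pm(2)[OF i] comm[OF i])
    have P1: "P i * (Id d - P i) = 0" "(Id d - P i) * (Id d - P i) = Id d - P i"
      using i by (simp_all add: algebra_simps PId PP Id_times[OF mats_Diag])
    have c: "(Id d - P i) * (Id d - pr) = (Id d - pr) * (Id d - P i)"
      using i by (simp add: algebra_simps PId prId Id_times[OF mats_Diag] comm)
    have p1: "(Id d - pr) * (Id d - pr) = Id d - pr"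
      by (simp add: algebra_simps prId Id_times[OF mats_Diag] prm)
    have "R i * R i = (Id d - pr) * ((Id d - P i) * (Id d - pr)) * (Id d - P i)" by (simp add: R_def mult.assoc)
    also have "\<dots> = ((Id d - pr) * (Id d - pr)) * ((Id d - P i) * (Id d - P i))" unfolding c by (simp add: mult.assoc)
    finally show "R i * R i = R i" unfolding p1 P1 R_def .
  qed
  have PR: "P i * R i = 0" "pr * R i = 0" if "i < N" for i
    unfolding R2[OF that] using that by (simp_all add: algebra_simps PId prId PP PP' prm comm comm' prpr')
  have pP: "p i * P i = p i" "p i * pr = p i" if "i < N" for i
    using that by (simp_all add: p_def mult.assoc prm comm comm' PP prpr')
  \<comment> \<open>A tuple with sum zero does not change \<open>S\<close> to first order. At second order, it moves part of the \<open>V\<^sub>i\<close>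
    from the top eigenspace to smaller eigenvalues, which decreases the potential unless it is zero.\<close>
  have inj_rl: "\<forall>i<N. X i = 0"
    if X: "\<And>i. i < N \<Longrightarrow> X i \<in> mats d d \<and> R i * X i * p i = X i" "(\<Sum>i<N. X i) = 0"
      and real: "\<And>i. i < N \<Longrightarrow> rl re (X i)" for X
  proof (rule ccontr)
    assume "\<not> (\<forall>i<N. X i = 0)"
    then obtain i1 where i1: "i1 < N" "X i1 \<noteq> 0" by blast
    have Xm: "X i \<in> mats d d" and XR: "R i * X i * p i = X i" if "i < N" for i using X(1)[OF that] by auto
    have PX: "P i * X i = 0" "pr * X i = 0" if "i < N" for i
      by (metis XR[OF that] PR[OF that] mult.assoc mult_zero_left)+
    have XP: "X i * P i = X i" "X i * pr = X i" if "i < N" for i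
      by (metis XR[OF that] pP[OF that] mult.assoc)+
    have "0 \<le> (norm (\<Sum>i<N. 2 *\<^sub>R (X i + adj (X i))))\<^sup>2 + 2 * inner S (\<Sum>i<N. 4 *\<^sub>R (X i * adj (X i) - adj (X i) * X i))"
      unfolding S_def P_def using PX XP unfolding P_def by (intro variation(2)[OF A Xm _ _ real \<rho> min]) auto
    moreover have "(\<Sum>i<N. 2 *\<^sub>R (X i + adj (X i))) = 2 *\<^sub>R ((\<Sum>i<N. X i) + adj (\<Sum>i<N. X i))"
      by (simp add: scaleR_sum_right adj_sum sum.distrib scaleR_add_right)
    then have "(\<Sum>i<N. 2 *\<^sub>R (X i + adj (X i))) = 0" unfolding X(2) by simp
    ultimately have ge: "0 \<le> inner S (\<Sum>i<N. 4 *\<^sub>R (X i * adj (X i) - adj (X i) * X i))" by simp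
    have S1: "inner S (X i * adj (X i)) = inner (X i) (S * X i)" if "i < N" for i
    proof -
      have "inner S (X i * adj (X i)) = inner (X i * adj (X i)) S" by (rule inner_commute)
      also have "\<dots> = inner (X i) (S * X i)" unfolding inner_times_right by simp
      finally show ?thesis .
    qed
    have S2: "inner S (adj (X i) * X i) = \<Lambda> * (norm (X i))\<^sup>2" if "i < N" for i
    proof -
      have "X i * S = X i * (pr * S)" using XP(2)[OF that] by (metis mult.assoc)
      also have "\<dots> = \<Lambda> *\<^sub>R X i" unfolding prS using XP(2)[OF that] by simp
      finally have XS: "X i * S = \<Lambda> *\<^sub>R X i" .
      have "inner S (adj (X i) * X i) = inner (adj (X i) * X i) S" by (rule inner_commute)
      also have "\<dots> = inner (X i) (X i * S)" unfolding inner_times_left by simp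
      also have "\<dots> = \<Lambda> * (norm (X i))\<^sup>2" unfolding XS by (simp add: power2_norm_eq_inner)
      finally show ?thesis .
    qed
    have "inner S (\<Sum>i<N. 4 *\<^sub>R (X i * adj (X i) - adj (X i) * X i)) = (\<Sum>i<N. 4 * (inner (X i) (S * X i) - \<Lambda> * (norm (X i))\<^sup>2))"
      unfolding inner_sum_right using S1 S2 by (intro sum.cong refl) (simp add: inner_diff_right)
    also have "\<dots> < (\<Sum>i<N. 0)"
    proof (rule sum_strict_mono_ex1)
      show "\<forall>i\<in>{..<N}. 4 * (inner (X i) (S * X i) - \<Lambda> * (norm (X i))\<^sup>2) \<le> 0"
      proof
        fix i assume "i \<in> {..<N}"
        then show "4 * (inner (X i) (S * X i) - \<Lambda> * (norm (X i))\<^sup>2) \<le> 0"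
          using pr(5)[of "X i"] Xm[of i] PX(2)[of i] by (cases "X i = 0") auto
      qed
      show "\<exists>i\<in>{..<N}. 4 * (inner (X i) (S * X i) - \<Lambda> * (norm (X i))\<^sup>2) < 0"
        using pr(5)[of "X i1"] Xm[of i1] PX(2)[of i1] i1 by (intro bexI[of _ i1]) auto
    qed simp
    finally show False using ge by simp
  qed
  \<comment> \<open>In the real case the projectors are real, so the real and imaginary parts of a complex tuple are
    real tuples of the same kind.\<close>
  have inj: "\<forall>i<N. X i = 0"
    if X: "\<And>i. i < N \<Longrightarrow> X i \<in> mats d d \<and> R i * X i * p i = X i" "(\<Sum>i<N. X i) = 0" for X
  proof (cases re)
    case False
    then show ?thesis using X by (intro inj_rl) (auto simp: rl_def)
  next
    case True
    have cP: "cconj (P i) = P i" if "i < N" for i using Pm(3)[OF that] True by (simp add: rl_def)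
    have cX: "R i * cconj (X i) * p i = cconj (X i)" if "i < N" for i
    proof -
      have "cconj (R i * X i * p i) = cconj (X i)" using X(1)[OF that] by simp
      then show ?thesis by (simp add: R_def p_def cconj_simps cP[OF that] cpr[OF True])
    qed
    have cS: "(\<Sum>i<N. cconj (X i)) = 0" using arg_cong[OF X(2), of cconj] by (simp add: cconj_sum)
    have "\<forall>i<N. X i + cconj (X i) = 0"
      using X cX cS by (intro inj_rl)
        (auto simp: sum.distrib distrib_left distrib_right rl_def cconj_simps add.commute intro: mats_intro)
    moreover have "\<forall>i<N. cscale \<i> (X i - cconj (X i)) = 0"
    proof (intro inj_rl)
      show "(\<Sum>i<N. cscale \<i> (X i - cconj (X i))) = 0"
        unfolding cscale_sum[symmetric] sum_subtractf X(2) cS by simp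
      show "rl re (cscale \<i> (X i - cconj (X i)))" for i
        unfolding rl_def by (auto intro!: fmat_eqI simp: algebra_simps)
      show "cscale \<i> (X i - cconj (X i)) \<in> mats d d \<and> R i * cscale \<i> (X i - cconj (X i)) * p i = cscale \<i> (X i - cconj (X i))"
        if "i < N" for i
        using X(1)[OF that] cX[OF that] by (auto simp: right_diff_distrib left_diff_distrib intro: mats_intro)
    qed
    ultimately show ?thesis
    proof (intro allI impI)
      fix i assume *: "\<forall>i<N. X i + cconj (X i) = 0" "\<forall>i<N. cscale \<i> (X i - cconj (X i)) = 0" "i < N"
      then have "cscale (- \<i>) (cscale \<i> (X i - cconj (X i))) = 0" "X i + cconj (X i) = 0" by auto
      then have "X i - cconj (X i) = 0" "X i + cconj (X i) = 0" by auto
      then have "2 *\<^sub>R X i = 0" by (metis add.right_neutral add_diff_cancel_left' diff_add_cancel diff_eq_eq eq_iff_diff_eq_0 scaleR_2)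
      then show "X i = 0" by simp
    qed
  qed
  have "\<exists>M. M \<in> mats d d \<and> (\<forall>i<N. R i * M * p i = (if i = j then R i * elem a b * p i else 0))"
    if "j < N \<and> a < d \<and> b < d" for j a b
    by (rule duality[of N d R p j "elem a b"]) (use that projR projp inj mats_elem in auto)
  then obtain \<Phi> where \<Phi>: "\<And>j a b. j < N \<and> a < d \<and> b < d \<Longrightarrow>
      \<Phi> j a b \<in> mats d d \<and> (\<forall>i<N. R i * \<Phi> j a b * p i = (if i = j then R i * elem a b * p i else 0))" by metis
  define Phi where "Phi j a b = (if j < N \<and> a < d \<and> b < d then (Id d - pr) * \<Phi> j a b * pr else 0)" for j a b
  define Z where "Z i = (adj (A i) - adj (T i)) * A i" for i
  have pc2: "(Id d - pr) * (Id d - pr) = Id d - pr"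
    by (simp add: algebra_simps prId Id_times[OF mats_Diag] prm)
  have Rpc: "R i * (Id d - pr) = R i" if "i < N" for i
  proof -
    have "R i * pr = 0" unfolding R2[OF that] using that by (simp add: algebra_simps prId prm comm prpr')
    then show ?thesis using times_Id[OF Rm[OF that]] by (simp add: right_diff_distrib)
  qed
  interpret frame_pair d N pr P Z Phi k A T
  proof
    show "projector d pr" by (rule pr(1))
    show "projector d (P i)" if "i < N" for i by (rule projP[OF that])
    show "P i * pr = pr * P i" if "i < N" for i by (rule comm[OF that])
    show "Z i \<in> mats d d" if "i < N" for i unfolding Z_def using A(1)[OF that] T(1)[OF that] by (auto intro!: mats_intro)
    show "Phi i a b \<in> mats d d" for i a b
      unfolding Phi_def using \<Phi>[of i a b] prm by (auto intro!: mats_intro)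
    show "(Id d - pr) * Phi i a b * pr = Phi i a b" for i a b
    proof -
      have "(Id d - pr) * ((Id d - pr) * M * pr) * pr = ((Id d - pr) * (Id d - pr)) * M * (pr * pr)" for M by (simp add: mult.assoc)
      then show ?thesis unfolding Phi_def pc2 prm by simp
    qed
    fix i Y assume i: "i < N" and Y: "\<And>j. j < N \<Longrightarrow> Y j \<in> mats d d"
    have RPhi: "R i * Phi j a b * p i = (if i = j then R i * elem a b * p i else 0)" if "j < N" "a < d" "b < d" for j a b
    proof -
      have "pr * p i = p i" using i by (simp add: p_def comm prpr')
      then have "R i * Phi j a b * p i = (R i * (Id d - pr)) * \<Phi> j a b * p i"
        unfolding Phi_def using that by (simp add: mult.assoc)
      then show ?thesis unfolding Rpc[OF i] using \<Phi>[of j a b] that i by simp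
    qed
    have "R i * (\<Sum>j<N. \<Sum>a<d. \<Sum>b<d. cscale (entry (Y j) a b) (Phi j a b)) * p i
      = (\<Sum>j<N. \<Sum>a<d. \<Sum>b<d. cscale (entry (Y j) a b) (R i * Phi j a b * p i))"
      by (simp add: sum_distrib_left sum_distrib_right)
    also have "\<dots> = (\<Sum>j<N. if i = j then (\<Sum>a<d. \<Sum>b<d. cscale (entry (Y i) a b) (R i * elem a b * p i)) else 0)"
      by (intro sum.cong refl) (auto simp: RPhi)
    also have "\<dots> = (\<Sum>a<d. \<Sum>b<d. cscale (entry (Y i) a b) (R i * elem a b * p i))" using i by simp
    also have "\<dots> = R i * (\<Sum>a<d. \<Sum>b<d. cscale (entry (Y i) a b) (elem a b)) * p i"
      by (simp add: sum_distrib_left sum_distrib_right)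
    also have "\<dots> = R i * Y i * p i" using complex_expansion[OF Y[OF i]] by simp
    finally show "(Id d - pr) * (Id d - P i) * (\<Sum>j<N. \<Sum>a<d. \<Sum>b<d. cscale (entry (Y j) a b) (Phi j a b)) * (P i * pr)
      = (Id d - pr) * (Id d - P i) * Y i * (P i * pr)" unfolding R_def p_def .
  qed (use d A T in \<open>auto simp: P_def Z_def\<close>)
  have trS: "tr S = of_nat (sum k {..<N})"
  proof -
    have "tr S = (\<Sum>i<N. tr (A i * adj (A i)))" unfolding S_def P_def tr_sum by (intro sum.cong refl tr_times_commute)
    then show ?thesis using A(2) by simp
  qed
  have c: "c * real d = real (sum k {..<N})"
  proof -
    have "(\<Sum>i<N. tr (adj (T i) * T i)) = (\<Sum>i<N. tr (T i * adj (T i)))" by (intro sum.cong refl tr_times_commute)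
    then have "tr (c *\<^sub>R Id d) = of_nat (sum k {..<N})" unfolding tight[symmetric] tr_sum using T(2) by simp
    then have "complex_of_real (c * real d) = complex_of_real (real (sum k {..<N}))"
      by (simp add: tr_scaleR scaleR_conv_of_real)
    then show ?thesis unfolding of_real_eq_iff .
  qed
  \<comment> \<open>The largest eigenvalue exceeds the average \<open>n / d\<close> of the eigenvalues, as \<open>S\<close> is not scalar.\<close>
  have top: "real (sum k {..<N}) < \<Lambda> * real d"
  proof -
    have pcm: "Id d - pr \<in> mats d d" using prm by (auto intro!: mats_intro)
    have "Id d - pr \<noteq> 0"
    proof
      assume "Id d - pr = 0"
      then have "pr = Id d" by simp
      then have "S = \<Lambda> *\<^sub>R Id d" using pr(3) Sm(1) by simp
      then show False using not_scalar that unfolding S_def P_def by blast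
    qed
    moreover have "pr * (Id d - pr) = 0" by (simp add: right_diff_distrib prId prm)
    ultimately have lt: "inner (Id d - pr) (S * (Id d - pr)) < \<Lambda> * (norm (Id d - pr))\<^sup>2" by (intro pr(5) pcm)
    have "S * (Id d - pr) = S - \<Lambda> *\<^sub>R pr" using Sm(1) by (simp add: right_diff_distrib pr(3))
    then have "(Id d - pr) * (S * (Id d - pr)) = S - \<Lambda> *\<^sub>R pr"
      using Id_times[OF Sm(1)] by (simp add: left_diff_distrib right_diff_distrib prId prS prm)
    then have 1: "inner (Id d - pr) (S * (Id d - pr)) = Re (tr S) - \<Lambda> * Re (tr pr)"
      unfolding inner_tr by (simp add: adj_minus prm tr_minus tr_scaleR)
    have 2: "(norm (Id d - pr))\<^sup>2 = real d - Re (tr pr)"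
      unfolding norm_sq_tr by (simp add: adj_minus prm pc2 tr_minus)
    show ?thesis using lt unfolding 1 2 trS by (simp add: algebra_simps)
  qed
  have r0pos: "r0 > 0"
  proof (rule ccontr)
    assume "\<not> r0 > 0"
    then have "tr pr = 0" using r0(1) by simp
    then have "tr (adj pr * pr) = 0" by (simp add: prm)
    then have "(norm pr)\<^sup>2 = 0" unfolding norm_sq_tr by simp
    then show False using pr(2) by simp
  qed
  have "(\<Sum>i<N. tr (P i * pr)) = tr (S * pr)" by (simp add: S_def sum_distrib_right tr_sum)
  also have "\<dots> = of_real (\<Lambda> * real r0)" unfolding pr(3) by (simp add: tr_scaleR r0 scaleR_conv_of_real)
  finally have "(\<Sum>i<N. tr (P i * pr)) = of_real (\<Lambda> * real r0)" .
  moreover have "(\<Sum>i<N. tr (P i * pr)) = of_real (real (\<Sum>i<N. r i))"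
    using a_simps(5) by (simp add: local.p_def)
  ultimately have sr: "real (\<Sum>i<N. r i) = \<Lambda> * real r0" by (metis of_real_eq_iff)
  have "real (sum k {..<N}) * real r0 < \<Lambda> * real d * real r0" using top r0pos by (intro mult_strict_right_mono) auto
  also have "\<dots> = real d * real (\<Sum>i<N. r i)" unfolding sr by simp
  finally have "real (sum k {..<N} * r0) < real (d * (\<Sum>i<N. r i))" by simp
  then have "sum k {..<N} * r0 < d * (\<Sum>i<N. r i)" unfolding of_nat_less_iff .
  then show False by (rule not_tight[OF tight c])
qed

section \<open>Translation to matrices over the real and complex numbers\<close>

(* The infix operators for indexing and scalar products refer to vectors of arbitrary dimension here. *)
unbundle no vec_syntax and no inner_syntax

lemma (in vec_space) rank_eq_ncols_iff:
  assumes A: "A \<in> carrier_mat n nc"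
  shows "rank A = nc \<longleftrightarrow> (\<forall>v\<in>carrier_vec nc. A *\<^sub>v v = 0\<^sub>v n \<longrightarrow> v = 0\<^sub>v nc)"
proof
  assume r: "rank A = nc"
  have dist: "distinct (cols A)"
  proof (rule ccontr)
    assume nd: "\<not> distinct (cols A)"
    have "lin_indpt {}" by (simp add: lin_dep_def)
    then obtain S where S: "maximal S (\<lambda>T. T \<subseteq> set (cols A) \<and> lin_indpt T)"
      using maximal_exists_superset[of "set (cols A)" "\<lambda>T. T \<subseteq> set (cols A) \<and> lin_indpt T" "{}"] by auto
    then have "card S \<le> card (set (cols A))" by (intro card_mono) (auto simp: maximal_def)
    also have "\<dots> < length (cols A)" using nd card_distinct card_length le_neq_implies_less by blast
    finally show False using rank_card_indpt[OF A S] r A by simp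
  qed
  show "\<forall>v\<in>carrier_vec nc. A *\<^sub>v v = 0\<^sub>v n \<longrightarrow> v = 0\<^sub>v nc"
    using full_rank_lin_indpt[OF A r dist] lin_depI[OF A _ _ _ dist] by blast
next
  assume inj: "\<forall>v\<in>carrier_vec nc. A *\<^sub>v v = 0\<^sub>v n \<longrightarrow> v = 0\<^sub>v nc"
  have dist: "distinct (cols A)"
  proof (rule ccontr)
    assume "\<not> distinct (cols A)"
    then obtain i j where ij: "i < nc" "j < nc" "i \<noteq> j" "col A i = col A j"
      using A by (auto simp: distinct_conv_nth)
    define v where "v = unit_vec nc i - (unit_vec nc j :: 'a Matrix.vec)"
    have v: "v \<in> carrier_vec nc" by (simp add: v_def)
    have "A *\<^sub>v v = 0\<^sub>v n"
    proof (rule eq_vecI)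
      fix a assume "a < dim_vec (0\<^sub>v n)"
      then have a: "a < n" by simp
      have "(A *\<^sub>v v) $ a = Matrix.row A a \<bullet> unit_vec nc i - Matrix.row A a \<bullet> unit_vec nc j"
        unfolding v_def using A a by (simp add: scalar_prod_minus_distrib[of _ nc])
      also have "\<dots> = A $$ (a, i) - A $$ (a, j)" using A a ij by simp
      also have "A $$ (a, i) = A $$ (a, j)"
      proof -
        have "vec_index (Matrix.col A i) a = vec_index (Matrix.col A j) a" by (simp only: ij(4))
        then show ?thesis using A a ij(1,2) by simp
      qed
      finally show "(A *\<^sub>v v) $ a = 0\<^sub>v n $ a" using a by simp
    qed (use A in auto)
    then have "v = 0\<^sub>v nc" using inj v by blast
    then have "v $ i = 0" using ij by simp
    then show False using ij by (simp add: v_def)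
  qed
  have "lin_indpt (set (cols A))" using lin_depE[OF A _ dist] inj by blast
  then show "rank A = nc" by (rule lin_indpt_full_rank[OF A dist])
qed

lemma (in vec_space) rank_times_eq:
  assumes B: "B \<in> carrier_mat n k" and A: "A \<in> carrier_mat k n" and BAB: "B * A * B = B"
  shows "rank (B * A) = rank B"
proof -
  have BA: "B * A \<in> carrier_mat n n" using A B by simp
  have "col_space (B * A) = col_space B"
    unfolding col_space_eq[OF BA] col_space_eq[OF B]
  proof (intro Collect_cong conj_cong)
    fix y
    show "(\<exists>x\<in>carrier_vec (dim_col (B * A)). B * A *\<^sub>v x = y) = (\<exists>x\<in>carrier_vec (dim_col B). B *\<^sub>v x = y)"
    proof
      assume "\<exists>x\<in>carrier_vec (dim_col (B * A)). B * A *\<^sub>v x = y"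
      then obtain x where x: "x \<in> carrier_vec n" "B * A *\<^sub>v x = y" using A by auto
      then have "B *\<^sub>v (A *\<^sub>v x) = y" using assoc_mult_mat_vec[OF B A x(1)] by simp
      then show "\<exists>x\<in>carrier_vec (dim_col B). B *\<^sub>v x = y" using A B mult_mat_vec_carrier[OF A x(1)] by (intro bexI[of _ "A *\<^sub>v x"]) auto
    next
      assume "\<exists>x\<in>carrier_vec (dim_col B). B *\<^sub>v x = y"
      then obtain x where x: "x \<in> carrier_vec k" "B *\<^sub>v x = y" using B by auto
      have "B * A *\<^sub>v (B *\<^sub>v x) = B * A * B *\<^sub>v x" using assoc_mult_mat_vec[OF BA B x(1)] by simp
      then have "B * A *\<^sub>v (B *\<^sub>v x) = y" using x BAB by simp
      then show "\<exists>x\<in>carrier_vec (dim_col (B * A)). B * A *\<^sub>v x = y"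
        using A B x mult_mat_vec_carrier[OF B x(1)] by (intro bexI[of _ "B *\<^sub>v x"]) auto
    qed
  qed (use A B in auto)
  then show ?thesis unfolding rank_def col_space_def by simp
qed

lemma product_open_box:
  assumes "openin (product_topology X I) S" "x \<in> S"
  obtains U where "\<And>i. i \<in> I \<Longrightarrow> openin (X i) (U i)" "x \<in> Pi\<^sub>E I U" "Pi\<^sub>E I U \<subseteq> S"
  using assms unfolding openin_product_topology_alt by metis

lemma mat_open_ball:
  fixes A :: "'a :: real_normed_vector Matrix.mat"
  assumes V: "openin (mat_topology m n) V" and A: "A \<in> V"
  obtains \<rho> where "\<rho> > 0"
    "\<And>B. B \<in> carrier_mat m n \<Longrightarrow> (\<And>i j. i < m \<Longrightarrow> j < n \<Longrightarrow> norm (B $$ (i, j) - A $$ (i, j)) < \<rho>) \<Longrightarrow> B \<in> V"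
proof -
  define I where "I = {..<m} \<times> {..<n}"
  define f where "f M = restrict (\<lambda>ij. M $$ ij) I" for M :: "'a Matrix.mat"
  have f: "f M ij = M $$ ij" if "ij \<in> I" for M ij using that by (simp add: f_def)
  have fE: "f M \<in> Pi\<^sub>E I U" if "\<And>ij. ij \<in> I \<Longrightarrow> M $$ ij \<in> U ij" for M U
    using that unfolding f_def by (intro PiE_I) auto
  have finI: "finite I" by (simp add: I_def)
  have "openin (pullback_topology (carrier_mat m n) f (product_topology (\<lambda>_. euclidean) I)) V"
    using V unfolding mat_topology_def f_def I_def .
  then obtain W where W: "openin (product_topology (\<lambda>_. euclidean) I) W" "V = f -` W \<inter> carrier_mat m n"
    unfolding openin_pullback_topology by blast
  have fA: "f A \<in> W" using A W(2) by blast
  obtain U where U: "\<And>ij. ij \<in> I \<Longrightarrow> openin euclidean (U ij)" "f A \<in> Pi\<^sub>E I U" "Pi\<^sub>E I U \<subseteq> W"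
  proof (rule product_open_box[OF W(1) fA])
    fix U assume "\<And>ij. ij \<in> I \<Longrightarrow> openin euclidean (U ij)" "f A \<in> Pi\<^sub>E I U" "Pi\<^sub>E I U \<subseteq> W"
    then show thesis by (rule that)
  qed
  have "\<exists>\<rho>>0. \<forall>x. dist x (A $$ ij) < \<rho> \<longrightarrow> x \<in> U ij" if "ij \<in> I" for ij
  proof -
    have "open (U ij)" using U(1)[OF that] by simp
    moreover have "A $$ ij \<in> U ij" using PiE_mem[OF U(2) that] unfolding f[OF that] .
    moreover have "\<forall>x\<in>U ij. \<exists>e>0. \<forall>y. dist y x < e \<longrightarrow> y \<in> U ij"
      by (rule iffD1[OF open_dist]) fact
    ultimately show ?thesis by simp
  qed
  then have "\<forall>ij\<in>I. \<exists>\<rho>>0. \<forall>x. dist x (A $$ ij) < \<rho> \<longrightarrow> x \<in> U ij" by (rule ballI)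
  from bchoice[OF this] obtain \<rho> where \<rho>': "\<forall>ij\<in>I. \<rho> ij > 0 \<and> (\<forall>x. dist x (A $$ ij) < \<rho> ij \<longrightarrow> x \<in> U ij)" ..
  have \<rho>: "\<rho> ij > 0" "dist x (A $$ ij) < \<rho> ij \<Longrightarrow> x \<in> U ij" if "ij \<in> I" for ij x
    using bspec[OF \<rho>' that] by simp_all
  define r where "r = Min (insert 1 (\<rho> ` I))"
  have r: "r > 0" unfolding r_def using \<rho>(1) finI by (subst Min_gr_iff) auto
  have rl: "r \<le> \<rho> ij" if "ij \<in> I" for ij unfolding r_def using that finI by (intro Min_le) auto
  show ?thesis
  proof (rule that[OF r])
    fix B :: "'a Matrix.mat"
    assume B: "B \<in> carrier_mat m n" "\<And>i j. i < m \<Longrightarrow> j < n \<Longrightarrow> norm (B $$ (i, j) - A $$ (i, j)) < r"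
    have "B $$ ij \<in> U ij" if ij: "ij \<in> I" for ij
    proof (rule \<rho>(2)[OF ij])
      have "dist (B $$ ij) (A $$ ij) < r" using B(2)[of "fst ij" "snd ij"] ij by (auto simp: dist_norm I_def)
      then show "dist (B $$ ij) (A $$ ij) < \<rho> ij" using rl[OF ij] by (rule less_le_trans)
    qed
    then have "f B \<in> Pi\<^sub>E I U" by (rule fE)
    then have "f B \<in> W" using U(3) by (rule rev_subsetD)
    then show "B \<in> V" unfolding W(2) using B(1) by simp
  qed
qed

text \<open>
  The scalars are embedded into the complex numbers, either as the reals (\<open>re = True\<close>) or as all
  complex numbers (\<open>re = False\<close>).
\<close>

locale scalar_embedding =
  fixes emb :: "'a :: {conjugatable_ordered_field, real_normed_field} \<Rightarrow> complex" and re :: bool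
  assumes emb_add: "emb (x + y) = emb x + emb y" and emb_mult: "emb (x * y) = emb x * emb y" and emb_1: "emb 1 = 1"
    and emb_conj: "emb (conjugate x) = cnj (emb x)" and emb_norm: "cmod (emb x) = norm x"
    and emb_pos: "0 < x \<longleftrightarrow> Im (emb x) = 0 \<and> 0 < Re (emb x)"
    and emb_range: "z \<in> range emb \<longleftrightarrow> (re \<longrightarrow> Im z = 0)"
begin

lemma emb_0: "emb 0 = 0"
  using emb_add[of 0 0] by simp

lemma emb_diff: "emb (x - y) = emb x - emb y"
  using emb_add[of "x - y" y] by simp

lemma emb_inj: "emb x = emb y \<longleftrightarrow> x = y"
  using emb_norm[of "x - y"] by (auto simp: emb_diff)

lemma emb_sum: "emb (sum f S) = (\<Sum>x\<in>S. emb (f x))"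
  by (induction S rule: infinite_finite_induct) (auto simp: emb_0 emb_add)

definition fm :: "'a Matrix.mat \<Rightarrow> fmat" where
  "fm A = Fmat (\<lambda>i j. if i < dim_row A \<and> j < dim_col A then emb (A $$ (i, j)) else 0)"

definition mf :: "nat \<Rightarrow> nat \<Rightarrow> fmat \<Rightarrow> 'a Matrix.mat" where
  "mf m n M = Matrix.mat m n (\<lambda>(i, j). inv_into UNIV emb (entry M i j))"

lemma entry_fm: "entry (fm A) i j = (if i < dim_row A \<and> j < dim_col A then emb (A $$ (i, j)) else 0)"
  unfolding fm_def by (subst entry_Fmat[of "dim_row A + dim_col A"]) auto

lemma fm_mats: "A \<in> carrier_mat m n \<Longrightarrow> fm A \<in> mats m n"
  by (intro matsI) (auto simp: entry_fm)

lemma fm_inj: "A \<in> carrier_mat m n \<Longrightarrow> B \<in> carrier_mat m n \<Longrightarrow> fm A = fm B \<Longrightarrow> A = B"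
proof (rule eq_matI)
  assume A: "A \<in> carrier_mat m n" and B: "B \<in> carrier_mat m n" and *: "fm A = fm B"
  fix i j assume "i < dim_row B" "j < dim_col B"
  then show "A $$ (i, j) = B $$ (i, j)"
    using arg_cong[OF *, of "\<lambda>M. entry M i j"] A B by (simp add: entry_fm emb_inj)
qed auto

lemma fm_times: "A \<in> carrier_mat m n \<Longrightarrow> B \<in> carrier_mat n k \<Longrightarrow> fm (A * B) = fm A * fm B"
proof (rule mats_eqI)
  assume A: "A \<in> carrier_mat m n" and B: "B \<in> carrier_mat n k"
  show "fm (A * B) \<in> mats m k" "fm A * fm B \<in> mats m k" using fm_mats[OF A] fm_mats[OF B] A B
    by (auto intro!: fm_mats mats_times_same[of _ m n])
  fix i j assume ij: "i < m" "j < k"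
  then show "entry (fm (A * B)) i j = entry (fm A * fm B) i j"
    using A B fm_mats[OF A] by (simp add: entry_times_mats[of _ m n] entry_fm scalar_prod_def emb_sum emb_mult lessThan_atLeast0)
qed

lemma mat_adjoint_carrier: "A \<in> carrier_mat m n \<Longrightarrow> mat_adjoint A \<in> carrier_mat n m"
  unfolding mat_adjoint_def by auto

lemma mat_adjoint_index:
  assumes "(A :: 'a Matrix.mat) \<in> carrier_mat m n" "i < n" "j < m"
  shows "mat_adjoint A $$ (i, j) = conjugate (A $$ (j, i))"
  using assms unfolding mat_adjoint_def by (subst mat_of_rows_index) auto

lemma fm_adj: "A \<in> carrier_mat m n \<Longrightarrow> fm (mat_adjoint A) = adj (fm A)"
proof (rule mats_eqI[of _ n m])
  assume A: "A \<in> carrier_mat m n"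
  show "fm (mat_adjoint A) \<in> mats n m" "adj (fm A) \<in> mats n m"
    using fm_mats[OF A] fm_mats[OF mat_adjoint_carrier[OF A]] by (auto intro: mats_intro)
  fix i j assume "i < n" "j < m"
  then show "entry (fm (mat_adjoint A)) i j = entry (adj (fm A)) i j"
    using A mat_adjoint_carrier[OF A] mat_adjoint_index[OF A] by (simp add: entry_fm emb_conj)
qed

lemma fm_one: "fm (1\<^sub>m n) = Id n"
  by (rule fmat_eqI) (auto simp: entry_fm emb_1 emb_0)

lemma fm_rl: "rl re (fm A)"
  unfolding rl_def
proof
  assume re
  then have "Im (emb x) = 0" for x using emb_range[of "emb x"] by auto
  then show "cconj (fm A) = fm A" by (intro fmat_eqI) (simp add: entry_fm complex_eq_iff)
qed

lemma mf_carrier: "mf m n M \<in> carrier_mat m n"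
  by (simp add: mf_def)

lemma fm_mf:
  assumes "M \<in> mats m n" "rl re M"
  shows "fm (mf m n M) = M"
proof (rule mats_eqI[OF fm_mats[OF mf_carrier] assms(1)])
  fix i j assume ij: "i < m" "j < n"
  have "Im (entry M i j) = 0" if re
  proof -
    have "entry (cconj M) i j = entry M i j" using assms(2) that by (simp only: rl_def)
    then show ?thesis by (simp add: complex_eq_iff)
  qed
  then have "entry M i j \<in> range emb" using emb_range by blast
  then show "entry (fm (mf m n M)) i j = entry M i j" using ij by (simp add: entry_fm mf_def f_inv_into_f)
qed

lemma frobenius_fm: "frobenius_norm A = norm (fm A)"
proof -
  have "(norm (fm A))\<^sup>2 = (\<Sum>i<dim_row A. \<Sum>j<dim_col A. (norm (A $$ (i, j)))\<^sup>2)"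
    by (subst norm_fmat_sq[of "dim_row A" "dim_col A"]) (auto simp: entry_fm emb_norm)
  then show ?thesis unfolding frobenius_norm_def by (metis norm_ge_zero real_sqrt_unique)
qed

lemma frame_operator_fm:
  assumes "\<And>i. i < N \<Longrightarrow> A i \<in> carrier_mat (k i) d"
  shows "fm (frame_operator d N A) = (\<Sum>i<N. adj (fm (A i)) * fm (A i))"
proof (rule mats_eqI[of _ d d])
  have AA: "fm (mat_adjoint (A i) * A i) = adj (fm (A i)) * fm (A i)" if "i < N" for i
    using fm_times[OF mat_adjoint_carrier assms[OF that], OF assms[OF that]] fm_adj[OF assms[OF that]] by simp
  have AAc: "mat_adjoint (A i) * A i \<in> carrier_mat d d" if "i < N" for i
    using assms[OF that] mat_adjoint_carrier[OF assms[OF that]] by simp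
  show "fm (frame_operator d N A) \<in> mats d d" by (rule fm_mats) (simp add: frame_operator_def)
  show "(\<Sum>i<N. adj (fm (A i)) * fm (A i)) \<in> mats d d"
    using fm_mats[OF assms] by (intro mats_intro) auto
  fix i j assume ij: "i < d" "j < d"
  have "entry (fm (frame_operator d N A)) i j = (\<Sum>l<N. emb ((mat_adjoint (A l) * A l) $$ (i, j)))"
    using ij by (simp add: entry_fm frame_operator_def emb_sum)
  also have "\<dots> = (\<Sum>l<N. entry (fm (mat_adjoint (A l) * A l)) i j)"
  proof (rule sum.cong[OF refl])
    fix l assume "l \<in> {..<N}"
    then have "mat_adjoint (A l) * A l \<in> carrier_mat d d" using AAc by simp
    then show "emb ((mat_adjoint (A l) * A l) $$ (i, j)) = entry (fm (mat_adjoint (A l) * A l)) i j"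
      using ij by (subst entry_fm) (auto dest: carrier_matD)
  qed
  also have "\<dots> = entry (\<Sum>l<N. adj (fm (A l)) * fm (A l)) i j" using AA by simp
  finally show "entry (fm (frame_operator d N A)) i j = entry (\<Sum>l<N. adj (fm (A l)) * fm (A l)) i j" .
qed

lemma potential_fm:
  assumes "\<And>i. i < N \<Longrightarrow> A i \<in> carrier_mat (k i) d"
  shows "fusion_frame_potential d N A = (norm (\<Sum>i<N. adj (fm (A i)) * fm (A i)))\<^sup>2"
  unfolding fusion_frame_potential_def frobenius_fm using frame_operator_fm[of N A k d] assms by simp

text \<open>
  If \<open>A\<^sup>* A\<close> is idempotent, then \<open>A\<^sup>* A A\<^sup>* = A\<^sup>*\<close>. The rank condition makes \<open>A\<^sup>*\<close> injective, so it cancels from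
  the left, and \<open>A A\<^sup>*\<close> is the identity.
\<close>

lemma coisometry_iff:
  assumes A: "A \<in> carrier_mat k d"
  shows "orthogonal_projector d (mat_adjoint A * A) \<and> vec_space.rank d (mat_adjoint A * A) = k
    \<longleftrightarrow> fm A * adj (fm A) = Id k"
proof -
  interpret vec_space "TYPE('a)" d .
  define B where "B = mat_adjoint A"
  have B: "B \<in> carrier_mat d k" unfolding B_def by (rule mat_adjoint_carrier[OF A])
  have BA: "B * A \<in> carrier_mat d d" using A B by simp
  have fB: "fm B = adj (fm A)" unfolding B_def by (rule fm_adj[OF A])
  have fBA: "fm (B * A) = adj (fm A) * fm A" unfolding fm_times[OF B A] fB ..
  have fAB: "fm (A * B) = fm A * adj (fm A)" unfolding fm_times[OF A B] fB ..
  have fA: "fm A \<in> mats k d" by (rule fm_mats[OF A])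
  show ?thesis
  proof
    assume *: "orthogonal_projector d (mat_adjoint A * A) \<and> vec_space.rank d (mat_adjoint A * A) = k"
    have "fm (B * A * (B * A)) = fm (B * A)" using * by (simp add: orthogonal_projector_def B_def)
    then have PP: "adj (fm A) * (fm A * (adj (fm A) * fm A)) = adj (fm A) * fm A"
      unfolding fm_times[OF BA BA] fBA by (simp add: mult.assoc)
    define X where "X = fm A * adj (fm A) * fm A - fm A"
    have "adj X * X = 0"
      unfolding X_def by (simp add: adj_simps algebra_simps PP)
    then have "fm A * adj (fm A) * fm A = fm A" by (simp add: X_def)
    then have "adj (fm A * adj (fm A) * fm A) = adj (fm A)" by simp
    then have "adj (fm A) * fm A * adj (fm A) = adj (fm A)" by (simp add: adj_times mult.assoc)
    then have "fm (B * A * B) = fm B" unfolding fm_times[OF BA B] fBA fB .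
    then have BAB: "B * A * B = B" using A B by (intro fm_inj[of _ d k]) auto
    have "rank B = k" using * rank_times_eq[OF B A BAB] by (simp add: B_def)
    then have inj: "\<forall>v\<in>carrier_vec k. B *\<^sub>v v = 0\<^sub>v d \<longrightarrow> v = 0\<^sub>v k" using rank_eq_ncols_iff[OF B] by simp
    have AB: "A * B \<in> carrier_mat k k" using A B by simp
    have "A * B = 1\<^sub>m k"
    proof (rule eq_matI)
      fix i j assume ij: "i < dim_row (1\<^sub>m k :: 'a Matrix.mat)" "j < dim_col (1\<^sub>m k :: 'a Matrix.mat)"
      define v where "v = col (A * B) j - unit_vec k j"
      have v: "v \<in> carrier_vec k" unfolding v_def using AB ij by auto
      have cv: "col (A * B) j \<in> carrier_vec k" using A by (intro carrier_vecI) simp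
      have "B *\<^sub>v v = B *\<^sub>v col (A * B) j - B *\<^sub>v unit_vec k j"
        unfolding v_def using B cv by (intro mult_minus_distrib_mat_vec) auto
      also have "B *\<^sub>v col (A * B) j = col (B * (A * B)) j"
        using A B ij by (intro eq_vecI) auto
      also have "B * (A * B) = B" using BAB assoc_mult_mat[OF B A B] by simp
      also have "B *\<^sub>v unit_vec k j = col B j" using B ij by (intro eq_vecI) auto
      also have "col B j - col B j = 0\<^sub>v d" using B by (intro eq_vecI) auto
      finally have "v = 0\<^sub>v k" using inj v by blast
      then have "v $ i = 0" using ij by simp
      then show "(A * B) $$ (i, j) = 1\<^sub>m k $$ (i, j)" using ij A B by (auto simp: v_def split: if_splits)
    qed (use A B in auto)
    then show "fm A * adj (fm A) = Id k" using fAB fm_one by metis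
  next
    assume *: "fm A * adj (fm A) = Id k"
    have PP: "adj (fm A) * fm A * (adj (fm A) * fm A) = adj (fm A) * fm A"
    proof -
      have "adj (fm A) * fm A * (adj (fm A) * fm A) = adj (fm A) * (fm A * adj (fm A)) * fm A" by (simp add: mult.assoc)
      then show ?thesis unfolding * using times_Id[OF mats_adj[OF fA]] by simp
    qed
    have "B * A * (B * A) = B * A"
      using BA by (intro fm_inj[of _ d d]) (auto simp: fm_times[OF BA BA] fBA PP)
    moreover have "mat_adjoint (B * A) = B * A"
      using BA mat_adjoint_carrier[OF BA] by (intro fm_inj[of _ d d]) (auto simp: fm_adj[OF BA] fBA adj_times)
    ultimately have proj: "orthogonal_projector d (B * A)"
      using BA by (simp add: orthogonal_projector_def hermitian_mat_def)
    have "fm (B * A * B) = fm B"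
      unfolding fm_times[OF BA B] fBA fB mult.assoc * using times_Id[OF mats_adj[OF fA]] by simp
    then have BAB: "B * A * B = B" using A B by (intro fm_inj[of _ d k]) auto
    have "fm (A * B) = fm (1\<^sub>m k)" unfolding fAB fm_one * ..
    then have AB1: "A * B = 1\<^sub>m k" using A B by (intro fm_inj[of _ k k]) auto
    have "rank B = k"
      unfolding rank_eq_ncols_iff[OF B]
    proof (intro ballI impI)
      fix v :: "'a Matrix.vec" assume v: "v \<in> carrier_vec k" "B *\<^sub>v v = 0\<^sub>v d"
      have "A *\<^sub>v (B *\<^sub>v v) = A * B *\<^sub>v v" using assoc_mult_mat_vec[OF A B v(1)] by simp
      then have "v = A *\<^sub>v 0\<^sub>v d" using v AB1 by simp
      then show "v = 0\<^sub>v k" using A by (auto simp: eq_vecI)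
    qed
    then show "orthogonal_projector d (mat_adjoint A * A) \<and> vec_space.rank d (mat_adjoint A * A) = k"
      using proj rank_times_eq[OF B A BAB] by (simp add: B_def)
  qed
qed

definition fv :: "'a Matrix.vec \<Rightarrow> fmat" where
  "fv v = Fmat (\<lambda>i j. if j = 0 \<and> i < dim_vec v then emb (vec_index v i) else 0)"

lemma entry_fv: "entry (fv v) i j = (if j = 0 \<and> i < dim_vec v then emb (vec_index v i) else 0)"
  unfolding fv_def by (subst entry_Fmat[of "Suc (dim_vec v)"]) auto

lemma fv_mats: "v \<in> carrier_vec d \<Longrightarrow> fv v \<in> mats d 1"
  by (intro matsI) (auto simp: entry_fv)

lemma fv_eq_0: "v \<in> carrier_vec d \<Longrightarrow> fv v = 0 \<longleftrightarrow> v = 0\<^sub>v d"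
proof
  assume v: "v \<in> carrier_vec d" "fv v = 0"
  show "v = 0\<^sub>v d"
  proof (rule eq_vecI)
    fix i assume "i < dim_vec (0\<^sub>v d :: 'a Matrix.vec)"
    then show "v $ i = 0\<^sub>v d $ i"
      using arg_cong[OF v(2), of "\<lambda>A. entry A i 0"] v(1) emb_inj[of "v $ i" 0] by (simp add: entry_fv emb_0)
  qed (use v in auto)
qed (auto intro!: fmat_eqI simp: entry_fv emb_0)

lemma quadratic_form_fm:
  assumes M: "M \<in> carrier_mat d d" and v: "v \<in> carrier_vec d"
  shows "emb ((M *\<^sub>v v) \<bullet>c v) = tr (adj (fv v) * (fm M * fv v))"
proof -
  have Mv: "entry (fm M * fv v) i 0 = emb ((M *\<^sub>v v) $ i)" if "i < d" for i
    using that M v fm_mats[OF M]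
    by (simp add: entry_times_mats[of _ d d] entry_fm entry_fv scalar_prod_def emb_sum emb_mult lessThan_atLeast0)
  have m: "adj (fv v) * (fm M * fv v) \<in> mats 1 1"
    using fv_mats[OF v] fm_mats[OF M] by (intro mats_intro)
  have "tr (adj (fv v) * (fm M * fv v)) = entry (adj (fv v) * (fm M * fv v)) 0 0"
    by (simp add: tr_mats[OF m] One_nat_def)
  also have "\<dots> = (\<Sum>i<d. cnj (emb (v $ i)) * emb ((M *\<^sub>v v) $ i))"
    using fv_mats[OF v] v by (subst entry_times_mats[of _ 1 d]) (auto simp: Mv entry_fv intro!: mats_intro sum.cong)
  also have "\<dots> = emb ((M *\<^sub>v v) \<bullet>c v)"
    using M v by (simp add: scalar_prod_def emb_sum emb_mult emb_conj lessThan_atLeast0 mult.commute)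
  finally show ?thesis ..
qed

lemma frame_quadratic_form:
  "tr (adj V * ((\<Sum>i<N. adj (b i) * b i) * V)) = of_real (\<Sum>i<N. (norm (b i * V))\<^sup>2)"
proof -
  have "adj V * ((\<Sum>i<N. adj (b i) * b i) * V) = (\<Sum>i<N. adj (b i * V) * (b i * V))"
    by (simp add: sum_distrib_left sum_distrib_right adj_times mult.assoc)
  then show ?thesis by (simp add: tr_sum tr_adj_self)
qed

text \<open>
  The frame operator is always positive semidefinite, so only its kernel matters. The determinant
  makes it evident that positive definiteness is an open condition.
\<close>

lemma positive_definite_iff:
  assumes A: "\<And>i. i < N \<Longrightarrow> A i \<in> carrier_mat (k i) d"
  shows "positive_definite_mat d (frame_operator d N A) \<longleftrightarrow> dt d (\<Sum>i<N. adj (fm (A i)) * fm (A i)) \<noteq> 0"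
proof -
  define S where "S = (\<Sum>i<N. adj (fm (A i)) * fm (A i))"
  have F: "frame_operator d N A \<in> carrier_mat d d" by (simp add: frame_operator_def)
  have fF: "fm (frame_operator d N A) = S" unfolding S_def by (rule frame_operator_fm[OF A])
  have Sm: "S \<in> mats d d" using fm_mats[OF F] fF by simp
  have Sa: "adj S = S" by (simp add: S_def adj_sum adj_times)
  have herm: "hermitian_mat (frame_operator d N A)"
    unfolding hermitian_mat_def
    using F mat_adjoint_carrier[OF F] by (intro fm_inj[of _ d d]) (auto simp: fm_adj[OF F] fF Sa)
  have qf: "emb ((frame_operator d N A *\<^sub>v v) \<bullet>c v) = of_real (\<Sum>i<N. (norm (fm (A i) * fv v))\<^sup>2)"
    if "v \<in> carrier_vec d" for v
    unfolding quadratic_form_fm[OF F that] fF unfolding S_def by (rule frame_quadratic_form)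
  have kernel: "(\<Sum>i<N. (norm (fm (A i) * V))\<^sup>2) = 0 \<longleftrightarrow> S * V = 0" for V
  proof
    assume "(\<Sum>i<N. (norm (fm (A i) * V))\<^sup>2) = 0"
    then have "\<forall>i\<in>{..<N}. (norm (fm (A i) * V))\<^sup>2 = 0" by (subst (asm) sum_nonneg_eq_0_iff) auto
    then have "adj (fm (A i)) * fm (A i) * V = 0" if "i < N" for i using that by (simp add: mult.assoc)
    then show "S * V = 0" by (simp add: S_def sum_distrib_right)
  next
    assume "S * V = 0"
    then have "tr (adj V * (S * V)) = 0" by simp
    then have "complex_of_real (\<Sum>i<N. (norm (fm (A i) * V))\<^sup>2) = 0"
      unfolding S_def frame_quadratic_form .
    then show "(\<Sum>i<N. (norm (fm (A i) * V))\<^sup>2) = 0" by (simp only: of_real_eq_0_iff)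
  qed
  have nonneg: "0 \<le> (\<Sum>i<N. (norm (fm (A i) * V))\<^sup>2)" for V by (intro sum_nonneg) auto
  show ?thesis
    unfolding S_def[symmetric]
  proof
    assume pd: "positive_definite_mat d (frame_operator d N A)"
    show "dt d S \<noteq> 0"
    proof
      assume "dt d S = 0"
      have "\<exists>v. v \<in> carrier_vec d \<and> v \<noteq> 0\<^sub>v d \<and> frame_operator d N A *\<^sub>v v = 0\<^sub>v d"
      proof (subst det_0_iff_vec_prod_zero_field[OF F, symmetric])
        have "emb (Determinant.det (frame_operator d N A)) = dt d S"
        proof -
          have es: "emb (signof p) = signof p" for p :: "nat \<Rightarrow> nat"
            using emb_diff[of 0 1] by (simp add: sign_def emb_1 emb_0)
          have ep: "emb (prod f X) = (\<Prod>x\<in>X. emb (f x))" for f and X :: "nat set"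
            by (induction X rule: infinite_finite_induct) (auto simp: emb_1 emb_mult)
          show ?thesis
            unfolding Determinant.det_def'[OF F] dt_leibniz emb_sum emb_mult es ep fF[symmetric]
          proof (intro sum.cong refl arg_cong2[of _ _ _ _ "(*)"] prod.cong)
            fix p i assume "p \<in> {p. p permutes {0..<d}}" "i \<in> {0..<d}"
            then have "p i < d" "i < d" using permutes_in_image[of p "{0..<d}" i] by auto
            then show "emb (frame_operator d N A $$ (i, p i)) = entry (fm (frame_operator d N A)) i (p i)"
              using F by (simp add: entry_fm)
          qed
        qed
        then have "emb (Determinant.det (frame_operator d N A)) = emb 0" using \<open>dt d S = 0\<close> by (simp add: emb_0)
        then show "Determinant.det (frame_operator d N A) = 0" unfolding emb_inj .
      qed
      then obtain v where v: "v \<in> carrier_vec d" "v \<noteq> 0\<^sub>v d" "frame_operator d N A *\<^sub>v v = 0\<^sub>v d" by blast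
      then have "0 < (0\<^sub>v d :: 'a Matrix.vec) \<bullet>c v" using pd unfolding positive_definite_mat_def by metis
      then show False using v by simp
    qed
  next
    assume dt: "dt d S \<noteq> 0"
    obtain W where W: "W * S = Id d" using dt_nonzero_inverse[OF Sm dt] by blast
    have "0 < (frame_operator d N A *\<^sub>v v) \<bullet>c v" if v: "v \<in> carrier_vec d" "v \<noteq> 0\<^sub>v d" for v
    proof -
      have "fv v \<noteq> 0" using fv_eq_0[OF v(1)] v(2) by simp
      have "S * fv v \<noteq> 0"
      proof
        assume "S * fv v = 0"
        then have "W * (S * fv v) = 0" by simp
        then have "fv v = 0" unfolding mult.assoc[symmetric] W using fv_mats[OF v(1)] by simp
        then show False using \<open>fv v \<noteq> 0\<close> by simp
      qed
      then have "0 < (\<Sum>i<N. (norm (fm (A i) * fv v))\<^sup>2)" using kernel[of "fv v"] nonneg[of "fv v"] by linarith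
      then show ?thesis unfolding emb_pos qf[OF v(1)] by simp
    qed
    then show "positive_definite_mat d (frame_operator d N A)"
      unfolding positive_definite_mat_def using F herm by blast
  qed
qed

lemma fusion_frames_iff:
  "A \<in> fusion_frames d N k \<longleftrightarrow> A \<in> (\<Pi>\<^sub>E i\<in>{..<N}. carrier_mat (k i) d) \<and>
    (\<forall>i<N. fm (A i) * adj (fm (A i)) = Id (k i)) \<and> dt d (\<Sum>i<N. adj (fm (A i)) * fm (A i)) \<noteq> 0"
proof (cases "A \<in> (\<Pi>\<^sub>E i\<in>{..<N}. carrier_mat (k i) d)")
  case True
  then have A: "A i \<in> carrier_mat (k i) d" if "i < N" for i using that by (auto dest: PiE_mem)
  have "(\<forall>i<N. orthogonal_projector d (mat_adjoint (A i) * A i) \<and> vec_space.rank d (mat_adjoint (A i) * A i) = k i)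
    \<longleftrightarrow> (\<forall>i<N. fm (A i) * adj (fm (A i)) = Id (k i))"
    using coisometry_iff[OF A] by blast
  then show ?thesis unfolding fusion_frames_def using True positive_definite_iff[OF A] by simp
qed (simp add: fusion_frames_def)

lemma open_ball_fusion_frames:
  assumes U: "openin (fusion_frame_topology d N k) U" and A: "A \<in> U"
  obtains \<rho> where "\<rho> > 0"
    "\<And>B. B \<in> fusion_frames d N k \<Longrightarrow> (\<And>i. i < N \<Longrightarrow> norm (fm (B i) - fm (A i)) < \<rho>) \<Longrightarrow> B \<in> U"
proof -
  obtain V where V: "openin (product_topology (\<lambda>i. mat_topology (k i) d) {..<N}) V" "U = V \<inter> fusion_frames d N k"
    using U unfolding fusion_frame_topology_def openin_subtopology by blast
  have Ac: "A i \<in> carrier_mat (k i) d" if "i < N" for i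
    using A V(2) that unfolding fusion_frames_def by (auto dest: PiE_mem)
  have "A \<in> V" using A V(2) by blast
  obtain W where W: "\<And>i. i \<in> {..<N} \<Longrightarrow> openin (mat_topology (k i) d) (W i)" "A \<in> Pi\<^sub>E {..<N} W" "Pi\<^sub>E {..<N} W \<subseteq> V"
  proof (rule product_open_box[OF V(1) \<open>A \<in> V\<close>])
    fix W assume "\<And>i. i \<in> {..<N} \<Longrightarrow> openin (mat_topology (k i) d) (W i)" "A \<in> Pi\<^sub>E {..<N} W" "Pi\<^sub>E {..<N} W \<subseteq> V"
    then show thesis by (rule that)
  qed
  have "\<exists>\<rho>>0. \<forall>B. B \<in> carrier_mat (k i) d \<longrightarrow> norm (fm B - fm (A i)) < \<rho> \<longrightarrow> B \<in> W i" if i: "i < N" for i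
  proof -
    have Wi: "openin (mat_topology (k i) d) (W i)" "A i \<in> W i"
      using W(1)[of i] PiE_mem[OF W(2), of i] i by simp_all
    obtain \<rho> where \<rho>: "\<rho> > 0" "\<And>B. B \<in> carrier_mat (k i) d \<Longrightarrow>
        (\<And>a b. a < k i \<Longrightarrow> b < d \<Longrightarrow> norm (B $$ (a, b) - A i $$ (a, b)) < \<rho>) \<Longrightarrow> B \<in> W i"
      using mat_open_ball[OF Wi] by blast
    have "norm (B $$ (a, b) - A i $$ (a, b)) < \<rho>"
      if "B \<in> carrier_mat (k i) d" "norm (fm B - fm (A i)) < \<rho>" "a < k i" "b < d" for B a b
    proof -
      have "norm (B $$ (a, b) - A i $$ (a, b)) = cmod (entry (fm B - fm (A i)) a b)"
        using that Ac[OF i] by (simp add: entry_fm emb_norm flip: emb_diff)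
      then show ?thesis using norm_entry_le[of "fm B - fm (A i)" a b] that(2) by linarith
    qed
    then have "B \<in> W i" if "B \<in> carrier_mat (k i) d" "norm (fm B - fm (A i)) < \<rho>" for B
      using that by (intro \<rho>(2))
    then show ?thesis using \<rho>(1) by (intro exI[of _ \<rho>]) simp
  qed
  then have "\<forall>i\<in>{..<N}. \<exists>\<rho>>0. \<forall>B. B \<in> carrier_mat (k i) d \<longrightarrow> norm (fm B - fm (A i)) < \<rho> \<longrightarrow> B \<in> W i"
    by simp
  from bchoice[OF this] obtain \<rho> where
    "\<forall>i\<in>{..<N}. \<rho> i > 0 \<and> (\<forall>B. B \<in> carrier_mat (k i) d \<longrightarrow> norm (fm B - fm (A i)) < \<rho> i \<longrightarrow> B \<in> W i)" ..
  then have \<rho>: "\<And>i. i < N \<Longrightarrow> \<rho> i > 0"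
    "\<And>i B. i < N \<Longrightarrow> B \<in> carrier_mat (k i) d \<Longrightarrow> norm (fm B - fm (A i)) < \<rho> i \<Longrightarrow> B \<in> W i"
    by simp_all
  define r where "r = Min (insert 1 (\<rho> ` {..<N}))"
  have r: "r > 0" unfolding r_def using \<rho>(1) by (subst Min_gr_iff) auto
  have rl: "r \<le> \<rho> i" if "i < N" for i unfolding r_def using that by (intro Min_le) auto
  show ?thesis
  proof (rule that[OF r])
    fix B assume B: "B \<in> fusion_frames d N k" "\<And>i. i < N \<Longrightarrow> norm (fm (B i) - fm (A i)) < r"
    have BP: "B \<in> (\<Pi>\<^sub>E i\<in>{..<N}. carrier_mat (k i) d)" using B(1) unfolding fusion_frames_def by blast
    have "B i \<in> W i" if "i < N" for i
      using PiE_mem[OF BP, of i] that less_le_trans[OF B(2)[OF that] rl[OF that]] by (intro \<rho>(2)) simp_all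
    then have "B \<in> Pi\<^sub>E {..<N} W" using PiE_arb[OF BP] by (intro PiE_I) auto
    then have "B \<in> V" using W(3) by (rule rev_subsetD)
    then show "B \<in> U" unfolding V(2) using B(1) by simp
  qed
qed

lemma trace_frame:
  assumes "\<And>i. i < N \<Longrightarrow> b i * adj (b i) = Id (k i)"
  shows "tr (\<Sum>i<N. adj (b i) * b i) = of_nat (sum k {..<N})"
proof -
  have "tr (\<Sum>i<N. adj (b i) * b i) = (\<Sum>i<N. tr (b i * adj (b i)))"
    unfolding tr_sum by (intro sum.cong refl tr_times_commute)
  then show ?thesis using assms by simp
qed

text \<open>
  Tuples with orthonormal rows near \<open>A\<close> have an invertible frame operator, so they are fusion frames
  and belong to the neighbourhood on which \<open>A\<close> is minimal. Hence \<open>A\<close> is tight, and tight frames attain the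
  lower bound \<open>n\<^sup>2 / d\<close> of the potential.
\<close>

theorem local_minimum_global:
  assumes d: "d > 0" and T: "tight_fusion_frame d N k (T :: nat \<Rightarrow> 'a Matrix.mat)"
    and A: "local_minimum (fusion_frame_topology d N k) (fusion_frame_potential d N) (A :: nat \<Rightarrow> 'a Matrix.mat)"
  shows "global_minimum (fusion_frames d N k) (fusion_frame_potential d N) A"
proof -
  define n where "n = sum k {..<N}"
  have carr: "B i \<in> carrier_mat (k i) d" if "B \<in> fusion_frames d N k" "i < N" for B :: "nat \<Rightarrow> 'a Matrix.mat" and i
    using that unfolding fusion_frames_def by (auto dest: PiE_mem)
  have iso: "fm (B i) * adj (fm (B i)) = Id (k i)" if "B \<in> fusion_frames d N k" "i < N" for B i
    using that fusion_frames_iff by blast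
  define S where "S B = (\<Sum>i<N. adj (fm (B i)) * fm (B i))" for B :: "nat \<Rightarrow> 'a Matrix.mat"
  have pot: "fusion_frame_potential d N B = (norm (S B))\<^sup>2" if "B \<in> fusion_frames d N k" for B
    unfolding S_def using carr[OF that] by (rule potential_fm)
  have trS: "tr (S B) = of_nat n" if "B \<in> fusion_frames d N k" for B
    unfolding S_def n_def using iso[OF that] by (rule trace_frame)
  obtain U where U: "openin (fusion_frame_topology d N k) U" "A \<in> U"
    "\<And>x. x \<in> U \<Longrightarrow> fusion_frame_potential d N A \<le> fusion_frame_potential d N x"
    using A unfolding local_minimum_def by blast
  have AF: "A \<in> fusion_frames d N k" using openin_subset[OF U(1)] U(2) by auto
  have TF: "T \<in> fusion_frames d N k" using T by (simp add: tight_fusion_frame_def)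
  obtain c0 where c0: "frame_operator d N T = c0 \<cdot>\<^sub>m 1\<^sub>m d" using T unfolding tight_fusion_frame_def by blast
  have "S T = fm (c0 \<cdot>\<^sub>m 1\<^sub>m d)" unfolding S_def c0[symmetric] using carr[OF TF] by (rule frame_operator_fm[symmetric])
  then have ST: "S T = cscale (emb c0) (Id d)"
    by (simp add:) (rule fmat_eqI, auto simp: entry_fm emb_mult emb_0 emb_1)
  then have "emb c0 * of_nat d = of_nat n" using trS[OF TF] by (simp add: tr_cscale)
  then have "emb c0 = complex_of_real (real n / real d)" using d by (simp add: field_simps)
  then have ST': "S T = (real n / real d) *\<^sub>R Id d" unfolding ST by (simp only: cscale_of_real)
  obtain \<rho>1 where \<rho>1: "\<rho>1 > 0"
    "\<And>B. B \<in> fusion_frames d N k \<Longrightarrow> (\<And>i. i < N \<Longrightarrow> norm (fm (B i) - fm (A i)) < \<rho>1) \<Longrightarrow> B \<in> U"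
    using open_ball_fusion_frames[OF U(1,2)] by blast
  have dtA: "dt d (S A) \<noteq> 0" using AF unfolding fusion_frames_iff S_def by blast
  have "((\<lambda>M. dt d M) \<longlongrightarrow> dt d (S A)) (at (S A))" by (intro tendsto_dt tendsto_ident_at)
  then have "\<forall>\<^sub>F M in at (S A). dt d M \<noteq> 0" using dtA by (rule tendsto_imp_eventually_ne)
  then obtain \<sigma> where \<sigma>: "\<sigma> > 0" "\<And>M. M \<noteq> S A \<Longrightarrow> dist M (S A) < \<sigma> \<Longrightarrow> dt d M \<noteq> 0"
    unfolding eventually_at by blast
  \<comment> \<open>A Lipschitz constant of the frame operator on tuples with orthonormal rows.\<close>
  define L where "L = (\<Sum>i<N. 2 * norm (Id (k i))) + 1"
  have L: "L > 0" unfolding L_def by (intro add_nonneg_pos sum_nonneg) auto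
  define \<rho> where "\<rho> = min \<rho>1 (\<sigma> / L)"
  have \<rho>: "\<rho> > 0" "\<rho> \<le> \<rho>1" "\<rho> * L \<le> \<sigma>" using \<rho>1 \<sigma> L by (auto simp: \<rho>_def min_def field_simps)
  obtain \<Lambda> where \<Lambda>: "(\<Sum>i<N. adj (fm (A i)) * fm (A i)) = \<Lambda> *\<^sub>R Id d"
  proof (rule local_minimum_tight[OF d, of N "\<lambda>i. fm (A i)" k re "\<lambda>i. fm (T i)" "real n / real d" \<rho>])
    show "fm (A i) \<in> mats (k i) d" if "i < N" for i using carr[OF AF that] by (rule fm_mats)
    show "fm (T i) \<in> mats (k i) d" if "i < N" for i using carr[OF TF that] by (rule fm_mats)
    show "(\<Sum>i<N. adj (fm (T i)) * fm (T i)) = (real n / real d) *\<^sub>R Id d" using ST' unfolding S_def .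
    fix b :: "nat \<Rightarrow> fmat"
    assume b: "\<And>i. i < N \<Longrightarrow> b i \<in> mats (k i) d \<and> b i * adj (b i) = Id (k i) \<and> rl re (b i) \<and> norm (b i - fm (A i)) < \<rho>"
    define B where "B i = (if i < N then mf (k i) d (b i) else undefined)" for i
    have fB: "fm (B i) = b i" if "i < N" for i using b[OF that] that by (simp add: B_def fm_mf)
    have SB: "S B = (\<Sum>i<N. adj (b i) * b i)" unfolding S_def
    proof (rule sum.cong[OF refl])
      fix i assume "i \<in> {..<N}"
      then have "fm (B i) = b i" by (intro fB) simp
      then show "adj (fm (B i)) * fm (B i) = adj (b i) * b i" by (simp only:)
    qed
    have "dist (S B) (S A) < \<sigma>"
    proof -
      have "S B - S A = (\<Sum>i<N. adj (b i - fm (A i)) * b i + adj (fm (A i)) * (b i - fm (A i)))"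
        unfolding SB unfolding S_def sum_subtractf[symmetric] by (intro sum.cong refl) (simp add: adj_minus algebra_simps)
      also have "norm \<dots> \<le> (\<Sum>i<N. \<rho> * (2 * norm (Id (k i))))"
      proof (intro sum_norm_le)
        fix i assume "i \<in> {..<N}"
        then have i: "i < N" by simp
        have le: "norm (b i - fm (A i)) \<le> \<rho>" using b[OF i] by simp
        have nb: "norm (b i) = norm (Id (k i))" "norm (fm (A i)) = norm (Id (k i))"
          using b[OF i] iso[OF AF i] by (auto intro: coisometry_norm)
        have "norm (adj (b i - fm (A i)) * b i) \<le> \<rho> * norm (Id (k i))"
          by (rule order_trans[OF norm_mult_ineq]) (simp add: nb mult_right_mono[OF le])
        moreover have "norm (adj (fm (A i)) * (b i - fm (A i))) \<le> \<rho> * norm (Id (k i))"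
          by (rule order_trans[OF norm_mult_ineq]) (use mult_right_mono[OF le norm_ge_zero[of "Id (k i)"]] in \<open>simp add: nb mult.commute\<close>)
        ultimately show "norm (adj (b i - fm (A i)) * b i + adj (fm (A i)) * (b i - fm (A i))) \<le> \<rho> * (2 * norm (Id (k i)))"
          using norm_triangle_ineq[of "adj (b i - fm (A i)) * b i" "adj (fm (A i)) * (b i - fm (A i))"] by linarith
      qed
      also have "\<dots> = \<rho> * (L - 1)" by (simp add: L_def sum_distrib_left)
      also have "\<dots> < \<rho> * L" using \<rho>(1) by simp
      finally show ?thesis using \<rho>(3) by (simp add: dist_norm)
    qed
    then have "dt d (S B) \<noteq> 0" using \<sigma>(2)[of "S B"] dtA by metis
    then have BF: "B \<in> fusion_frames d N k"
      unfolding fusion_frames_iff S_def using b fB by (auto simp: B_def mf_carrier)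
    have "B \<in> U"
    proof (rule \<rho>1(2)[OF BF])
      fix i assume "i < N"
      then show "norm (fm (B i) - fm (A i)) < \<rho>1" using fB b \<rho>(2) by fastforce
    qed
    then have "(norm (S A))\<^sup>2 \<le> (norm (S B))\<^sup>2" using U(3)[of B] pot[OF AF] pot[OF BF] by simp
    then have "norm (S A) \<le> norm (\<Sum>i<N. adj (b i) * b i)" unfolding SB by (rule power2_le_imp_le) simp
    then show "norm (\<Sum>i<N. adj (fm (A i)) * fm (A i)) \<le> norm (\<Sum>i<N. adj (b i) * b i)" unfolding S_def .
  qed (use iso[OF AF] iso[OF TF] fm_rl \<rho> in auto)
  have SA: "S A = \<Lambda> *\<^sub>R Id d" using \<Lambda> by (simp add: S_def)
  have "complex_of_real (\<Lambda> * real d) = complex_of_real (real n)"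
    using trS[OF AF] unfolding SA by (simp add: tr_scaleR scaleR_conv_of_real)
  then have \<Lambda>n: "\<Lambda> * real d = real n" unfolding of_real_eq_iff .
  have "(norm (S A))\<^sup>2 \<le> (norm (S B))\<^sup>2" if B: "B \<in> fusion_frames d N k" for B
  proof -
    have "inner (Id d) (S B) = real n"
    proof -
      have "S B \<in> mats d d" unfolding S_def using fm_mats[OF carr[OF B]] by (intro mats_intro) auto
      then show ?thesis unfolding inner_tr using trS[OF B] by simp
    qed
    then have "real n \<le> norm (Id d) * norm (S B)" using norm_cauchy_schwarz[of "Id d" "S B"] by simp
    then have "(real n)\<^sup>2 \<le> (norm (Id d) * norm (S B))\<^sup>2" by (intro power_mono) auto
    then have "(real n)\<^sup>2 \<le> real d * (norm (S B))\<^sup>2" by (simp add: power_mult_distrib norm_Id)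
    moreover have "(norm (S A))\<^sup>2 = \<Lambda>\<^sup>2 * real d"
      unfolding SA norm_scaleR norm_Id by (simp add: power_mult_distrib)
    then have "real d * (norm (S A))\<^sup>2 = (real n)\<^sup>2"
      unfolding \<Lambda>n[symmetric] by (simp add: power_mult_distrib power2_eq_square)
    ultimately have "real d * (norm (S A))\<^sup>2 \<le> real d * (norm (S B))\<^sup>2" by simp
    then show ?thesis using d by simp
  qed
  then show ?thesis unfolding global_minimum_def using AF pot by simp
qed

end

theorem corollary1p15:
  fixes d N :: nat and k :: "nat \<Rightarrow> nat"
  assumes "d > 0" and "N > 0" and "\<forall>i<N. k i > 0"
  shows
    "((\<exists>T :: nat \<Rightarrow> real mat. tight_fusion_frame d N k T) \<longrightarrow>
      (\<forall>A :: nat \<Rightarrow> real mat.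
         local_minimum (fusion_frame_topology d N k) (fusion_frame_potential d N) A \<longrightarrow>
         global_minimum (fusion_frames d N k) (fusion_frame_potential d N) A)) \<and>
     ((\<exists>T :: nat \<Rightarrow> complex mat. tight_fusion_frame d N k T) \<longrightarrow>
      (\<forall>A :: nat \<Rightarrow> complex mat.
         local_minimum (fusion_frame_topology d N k) (fusion_frame_potential d N) A \<longrightarrow>
         global_minimum (fusion_frames d N k) (fusion_frame_potential d N) A))"
proof -
  interpret R: scalar_embedding complex_of_real True
    by standard (auto simp: complex_is_Real_iff[symmetric] Reals_def)
  interpret C: scalar_embedding "\<lambda>z. z" False
    by standard (auto simp: less_complex_def)
  show ?thesis
    by (intro conjI impI allI; elim exE) (rule R.local_minimum_global[OF assms(1)] C.local_minimum_global[OF assms(1)]; assumption)+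
qed

end
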